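(* For every $a,b>0$ and every $\beta>\alpha\ge 0$, the following limit exists almost surely and is given by $$ f^{\alpha,\beta}(a,b):=\lim_{t\to \infty}\frac{L^{\alpha,\beta}(at,bt)}{t}= \begin{cases} a\sqrt{\beta-\alpha} &\text{ if }\frac{b}{a} > \frac{\alpha+\beta}{2},\\[2mm] \dfrac{2\sqrt{(\beta a-b)( b-a\alpha)}}{\sqrt{\beta -\alpha}} &\text{ if } \frac{\alpha+\beta}{2} \geq \frac{b}{a} \geq \frac{2}{1/\beta+1/\alpha} ,\\[2mm] b\sqrt{\frac{1}{\alpha}-\frac{1}{\beta}} &\text{ if }\frac{b}{a} < \frac{2}{1/\beta+1/\alpha}, \end{cases} $$ where for $\alpha=0$ the quantity $\frac{2}{1/\beta+1/\alpha}$ is understood to be $0$ (so that the third case does not occur).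
   Context: $\Xi$ is a homogeneous Poisson point process with intensity one in the quarter-plane $[0,+\infty)^2$. For $0\le\alpha<\beta<\infty$, the partial order $\stackrel{\alpha,\beta}{\preccurlyeq}$ on $[0,+\infty)^2$ is defined by: $(x,y)\stackrel{\alpha,\beta}{\preccurlyeq}(x',y')$ if and only if $x\le x'$ and $\alpha(x'-x)\le y'-y\le \beta(x'-x)$ (i.e. $x\le x'$ and $\alpha\le \frac{y'-y}{x'-x}\le\beta$). For $x,y\ge 0$, $L^{\alpha,\beta}(x,y)$ denotes the maximal number $L$ of (distinct) points $(u_1,v_1),\dots,(u_L,v_L)$ of $\Xi\cap([0,x]\times[0,y])$ such that $(u_1,v_1)\stackrel{\alpha,\beta}{\preccurlyeq}(u_2,v_2)\stackrel{\alpha,\beta}{\preccurlyeq}\cdots\stackrel{\alpha,\beta}{\preccurlyeq}(u_L,v_L)$. *)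

theory Defs
  imports "HOL-Probability.Probability"
begin

text \<open>
  A homogeneous Poisson point process of intensity \<open>r\<close> on a Borel set \<open>S\<close>, realised as a random
  locally finite subset of \<open>S\<close> (hence a simple point process). Boundedness of the test sets makes
  all counts finite, so that \<open>card\<close> is the true number of points.
  The Poisson probabilities are written out because \<open>poisson_pmf\<close> is specified for positive rates
  only, whereas null sets (in particular \<open>{}\<close>) have rate \<open>0\<close>; with \<open>0 ^ 0 = 1\<close> the formula then
  says that the count is almost surely \<open>0\<close>.
\<close>

locale homogeneous_poisson_process = prob_space M
  for M :: "'w measure" +
  fixes S :: "'a::euclidean_space set" and r :: real and \<Xi> :: "'w \<Rightarrow> 'a set"
  assumes S_borel: "S \<in> sets borel"
    and intensity_nonneg: "0 \<le> r"
    and points_in_S: "\<omega> \<in> space M \<Longrightarrow> \<Xi> \<omega> \<subseteq> S"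
    and locally_finite: "\<omega> \<in> space M \<Longrightarrow> bounded B \<Longrightarrow> finite (\<Xi> \<omega> \<inter> B)"
    and count_measurable:
      "B \<in> sets borel \<Longrightarrow> B \<subseteq> S \<Longrightarrow> bounded B \<Longrightarrow>
        (\<lambda>\<omega>. card (\<Xi> \<omega> \<inter> B)) \<in> measurable M (count_space UNIV)"
    and count_poisson:
      "B \<in> sets borel \<Longrightarrow> B \<subseteq> S \<Longrightarrow> bounded B \<Longrightarrow>
        prob {\<omega> \<in> space M. card (\<Xi> \<omega> \<inter> B) = k}
          = (r * measure lborel B) ^ k / fact k * exp (- (r * measure lborel B))"
    and counts_indep:
      "\<And>(n::nat) B. (\<And>i. i < n \<Longrightarrow> B i \<in> sets borel \<and> B i \<subseteq> S \<and> bounded (B i)) \<Longrightarrow>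
        disjoint_family_on B {..<n} \<Longrightarrow>
        indep_vars (\<lambda>_. count_space UNIV) (\<lambda>i \<omega>. card (\<Xi> \<omega> \<inter> B i)) {..<n}"

definition quarter_plane :: "(real \<times> real) set" where
  "quarter_plane = {0..} \<times> {0..}"

definition slope_le :: "real \<Rightarrow> real \<Rightarrow> real \<times> real \<Rightarrow> real \<times> real \<Rightarrow> bool" where
  "slope_le \<alpha> \<beta> p q \<longleftrightarrow>
     fst p \<le> fst q \<and>
     \<alpha> * (fst q - fst p) \<le> snd q - snd p \<and>
     snd q - snd p \<le> \<beta> * (fst q - fst p)"

text \<open>
  The maximum is meaningful when \<open>A\<close> has finitely many points in the rectangle; the empty chain
  shows that the set of lengths is nonempty.
\<close>

definition longest_chain :: "real \<Rightarrow> real \<Rightarrow> (real \<times> real) set \<Rightarrow> real \<Rightarrow> real \<Rightarrow> nat" where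
  "longest_chain \<alpha> \<beta> A x y =
     Max {length ps |ps. distinct ps \<and> set ps \<subseteq> A \<inter> ({0..x} \<times> {0..y}) \<and>
                         successively (slope_le \<alpha> \<beta>) ps}"

text \<open>
  The convention for \<open>\<alpha> = 0\<close> has to be made explicit: in HOL, \<open>1 / 0 = 0\<close>, so the formula
  \<open>2 / (1/\<beta> + 1/\<alpha>)\<close> alone would yield \<open>2 * \<beta>\<close> instead of \<open>0\<close>.
\<close>

definition harmonic_threshold :: "real \<Rightarrow> real \<Rightarrow> real" where
  "harmonic_threshold \<alpha> \<beta> = (if \<alpha> = 0 then 0 else 2 / (1 / \<beta> + 1 / \<alpha>))"

end

theory Submission
  imports Defs "HOL-Real_Asymp.Real_Asymp"
begin

text \<open>
  The linear coordinates \<open>w = y - \<alpha> x\<close> and \<open>e = \<beta> x - y\<close> turn the cone order into the product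
  order and multiply areas by \<open>\<beta> - \<alpha>\<close>. Hence the heart of the matter is that the longest
  increasing chain of a Poisson process in a box of area \<open>A\<close> has length \<open>(2 + o(1)) sqrt A\<close>.

  The box is cut into \<open>n \<times> n\<close> cells, so that only the Bernoulli field of occupied cells matters.
  Its last passage times become stationary once independent Bernoulli sources and sinks are put on
  the axes (Burke property), where they are a sum of two binomial variables. Chebyshev's
  inequality gives the upper bound. For the lower bound, an optimal path of the stationary model
  leaves the axes at some point; by the upper bound this point must be close to the origin, so that
  the chain without sources and sinks is almost as long.

  All exceptional probabilities are of order \<open>1 / sqrt A\<close>, hence summable along \<open>t = k\<^sup>2\<close>, and
  monotonicity interpolates. The three cases maximise \<open>2 sqrt (w e / (\<beta> - \<alpha>))\<close> over the
  displacements that fit into the rectangle.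
\<close>

section \<open>Last passage times with sources and sinks\<close>

text \<open>The tail bounds involve quantities of size \<open>sqrt A\<close> but never the mesh,
  because \<open>p * n * n \<le> A\<close> for cells occupied with probability \<open>p\<close>. So
  \<open>n\<close> can be chosen last, as large as the comparison of points with cells requires.
  Stationarity has a one-cell reason. A cell turns two incoming increments into none, turns none
  into two if it is occupied, and passes a single one on; so Bernoulli increments of densities
  \<open>u\<close> and \<open>v\<close> survive iff \<open>u * v = p * (1 - u) * (1 - v)\<close>.
  With odds \<open>u / (1 - u) = lam * sqrt p\<close> and \<open>v / (1 - v) = sqrt p / lam\<close>
  this holds for every \<open>lam > 0\<close>, a free parameter that tunes the model to a direction.
  The obstacle in the lower bound is the exit point. In units of \<open>s = n * sqrt p\<close>, a
  path leaving an axis at fraction \<open>x\<close> has length about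
  \<open>x + 2 * sqrt (1 - x)\<close> at most, while the optimal one has about 2; the gap is the
  square of \<open>1 - sqrt (1 - x)\<close>. The \<open>n\<close> possible exits are too many for a
  union bound with Chebyshev, so they are rounded to \<open>J + 1\<close> grid points, with
  \<open>J\<close> fixed in advance.\<close>

fun lpp :: "(nat \<Rightarrow> nat) \<Rightarrow> (nat \<Rightarrow> nat) \<Rightarrow> (nat \<times> nat \<Rightarrow> bool) \<Rightarrow> nat \<Rightarrow> nat \<Rightarrow> nat" where
  "lpp f g \<xi> 0 j = g j"
| "lpp f g \<xi> (Suc i) 0 = f (Suc i)"
| "lpp f g \<xi> (Suc i) (Suc j) =
     max (max (lpp f g \<xi> i (Suc j)) (lpp f g \<xi> (Suc i) j)) (lpp f g \<xi> i j + of_bool (\<xi> (Suc i, Suc j)))"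

abbreviation lpp0 :: "(nat \<times> nat \<Rightarrow> bool) \<Rightarrow> nat \<Rightarrow> nat \<Rightarrow> nat" where
  "lpp0 \<equiv> lpp (\<lambda>_. 0) (\<lambda>_. 0)"

definition translate :: "nat \<Rightarrow> nat \<Rightarrow> (nat \<times> nat \<Rightarrow> bool) \<Rightarrow> nat \<times> nat \<Rightarrow> bool" where
  "translate a b \<xi> = (\<lambda>(i, j). \<xi> (a + i, b + j))"

lemma lpp0_0_right [simp]: "lpp0 \<xi> i 0 = 0"
  by (cases i) auto

lemma lpp_0_right: "f 0 = g 0 \<Longrightarrow> lpp f g \<xi> i 0 = f i"
  by (cases i) auto

lemma lpp_mono:
  assumes "\<And>i. f i \<le> f' i" "\<And>j. g j \<le> g' j"
    and "\<And>i' j'. 1 \<le> i' \<Longrightarrow> i' \<le> i \<Longrightarrow> 1 \<le> j' \<Longrightarrow> j' \<le> j \<Longrightarrow> \<xi> (i', j') \<Longrightarrow> \<xi>' (i', j')"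
  shows "lpp f g \<xi> i j \<le> lpp f' g' \<xi>' i j"
  using assms
proof (induction f g \<xi> i j rule: lpp.induct)
  case (3 f g \<xi> i j)
  have "lpp f g \<xi> i (Suc j) \<le> lpp f' g' \<xi>' i (Suc j)"
    "lpp f g \<xi> (Suc i) j \<le> lpp f' g' \<xi>' (Suc i) j"
    "lpp f g \<xi> i j \<le> lpp f' g' \<xi>' i j"
    by (intro "3.IH" "3.prems"; simp)+
  moreover have "of_bool (\<xi> (Suc i, Suc j)) \<le> (of_bool (\<xi>' (Suc i, Suc j)) :: nat)"
    using "3.prems"(3)[of "Suc i" "Suc j"] by auto
  ultimately show ?case by simp linarith
qed auto

lemma lpp0_cong:
  assumes "\<And>i' j'. 1 \<le> i' \<Longrightarrow> i' \<le> i \<Longrightarrow> 1 \<le> j' \<Longrightarrow> j' \<le> j \<Longrightarrow> \<xi> (i', j') = \<xi>' (i', j')"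
  shows "lpp0 \<xi> i j = lpp0 \<xi>' i j"
  by (rule antisym; rule lpp_mono) (use assms in auto)

lemma lpp0_mono_left: "i \<le> i' \<Longrightarrow> lpp0 \<xi> i j \<le> lpp0 \<xi> i' j"
proof (induction rule: dec_induct)
  case (step k)
  moreover have "lpp0 \<xi> k j \<le> lpp0 \<xi> (Suc k) j"
    by (cases j) auto
  ultimately show ?case by linarith
qed auto

lemma lpp0_mono_right: "j \<le> j' \<Longrightarrow> lpp0 \<xi> i j \<le> lpp0 \<xi> i j'"
proof (induction rule: dec_induct)
  case (step k)
  moreover have "lpp0 \<xi> i k \<le> lpp0 \<xi> i (Suc k)"
    by (cases i) auto
  ultimately show ?case by linarith
qed auto

lemma lpp0_translate_le: "lpp0 (translate a b \<xi>) i j \<le> lpp0 \<xi> (a + i) (b + j)"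
proof (induction "\<lambda>_::nat. 0::nat" "\<lambda>_::nat. 0::nat" "translate a b \<xi>" i j rule: lpp.induct)
  case (3 i j)
  then show ?case by (simp add: translate_def) linarith
qed auto

lemma translate_translate: "translate a b (translate c d \<xi>) = translate (c + a) (d + b) \<xi>"
  by (auto simp: translate_def fun_eq_iff ac_simps)

text \<open>A maximising path leaves one of the two boundaries once and never returns to it.\<close>

lemma lpp_exit:
  assumes "f 0 = 0" "g 0 = 0"
  shows "(\<exists>z\<le>i. lpp f g \<xi> i j \<le> f z + lpp0 (translate z 0 \<xi>) (i - z) j) \<or>
         (\<exists>z\<le>j. lpp f g \<xi> i j \<le> g z + lpp0 (translate 0 z \<xi>) i (j - z))"
  using assms
proof (induction f g \<xi> i j rule: lpp.induct)
  case (1 f g \<xi> j)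
  then show ?case by (intro disjI2 exI[of _ j]) auto
next
  case (2 f g \<xi> i)
  then show ?case by (intro disjI1 exI[of _ "Suc i"]) auto
next
  case (3 f g \<xi> i j)
  let ?A = "\<lambda>i j z. f z + lpp0 (translate z 0 \<xi>) (i - z) j"
  let ?B = "\<lambda>i j z. g z + lpp0 (translate 0 z \<xi>) i (j - z)"
  have Amono: "?A i j z \<le> ?A i' j' z" if "i \<le> i'" "j \<le> j'" for i j i' j' z
    by (rule add_left_mono, rule le_trans[OF lpp0_mono_left lpp0_mono_right]) (use that in auto)
  have Bmono: "?B i j z \<le> ?B i' j' z" if "i \<le> i'" "j \<le> j'" for i j i' j' z
    by (rule add_left_mono, rule le_trans[OF lpp0_mono_left lpp0_mono_right]) (use that in auto)
  consider "lpp f g \<xi> (Suc i) (Suc j) = lpp f g \<xi> i (Suc j)"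
    | "lpp f g \<xi> (Suc i) (Suc j) = lpp f g \<xi> (Suc i) j"
    | "lpp f g \<xi> (Suc i) (Suc j) = lpp f g \<xi> i j + of_bool (\<xi> (Suc i, Suc j))"
    by (simp only: lpp.simps) linarith
  then show ?case
  proof cases
    case 1
    have "(\<exists>z\<le>i. lpp f g \<xi> i (Suc j) \<le> ?A i (Suc j) z) \<or> (\<exists>z\<le>Suc j. lpp f g \<xi> i (Suc j) \<le> ?B i (Suc j) z)"
      using "3.IH" "3.prems" by blast
    then show ?thesis
      unfolding 1 using Amono[of i "Suc i" "Suc j" "Suc j"] Bmono[of i "Suc i" "Suc j" "Suc j"]
      by (meson le_SucI le_refl le_trans lessI less_imp_le)
  next
    case 2
    have "(\<exists>z\<le>Suc i. lpp f g \<xi> (Suc i) j \<le> ?A (Suc i) j z) \<or> (\<exists>z\<le>j. lpp f g \<xi> (Suc i) j \<le> ?B (Suc i) j z)"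
      using "3.IH" "3.prems" by blast
    then show ?thesis
      unfolding 2 using Amono[of "Suc i" "Suc i" j "Suc j"] Bmono[of "Suc i" "Suc i" "j" "Suc j"]
      by (meson le_SucI le_refl le_trans lessI less_imp_le)
  next
    case 3
    note eq = this
    \<comment> \<open>Since \<open>z \<le> i\<close>, the new cell is the upper right cell of the
      translated box and extends the path inside it.\<close>
    have A': "?A i j z + of_bool (\<xi> (Suc i, Suc j)) \<le> ?A (Suc i) (Suc j) z" if "z \<le> i" for z
      using that by (simp add: Suc_diff_le translate_def)
    have B': "?B i j z + of_bool (\<xi> (Suc i, Suc j)) \<le> ?B (Suc i) (Suc j) z" if "z \<le> j" for z
      using that by (simp add: Suc_diff_le translate_def)
    have "(\<exists>z\<le>i. lpp f g \<xi> i j \<le> ?A i j z) \<or> (\<exists>z\<le>j. lpp f g \<xi> i j \<le> ?B i j z)"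
      using "3.IH" "3.prems" by blast
    then show ?thesis
    proof (elim disjE exE conjE)
      fix z assume "z \<le> i" "lpp f g \<xi> i j \<le> ?A i j z"
      with A'[of z] eq show ?thesis by (intro disjI1 exI[of _ z]) linarith
    next
      fix z assume "z \<le> j" "lpp f g \<xi> i j \<le> ?B i j z"
      with B'[of z] eq show ?thesis by (intro disjI2 exI[of _ z]) linarith
    qed
  qed
qed

section \<open>The stationary model: boundary counts and the sweep of increments\<close>

text \<open>Written as the cardinality of a set of occupied cells, the form to which
  \<open>bernoulli_field_card_deviation\<close> applies. Counting from index 1 makes the counts on
  both axes vanish at the origin, as \<open>lpp_exit\<close> requires.\<close>

definition bdx :: "(nat \<times> nat \<Rightarrow> bool) \<Rightarrow> nat \<Rightarrow> nat" where
  "bdx \<zeta> i = card {k \<in> {1..i} \<times> {0}. \<zeta> k}"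

definition bdy :: "(nat \<times> nat \<Rightarrow> bool) \<Rightarrow> nat \<Rightarrow> nat" where
  "bdy \<zeta> j = card {k \<in> {0} \<times> {1..j}. \<zeta> k}"

lemma bdx_0 [simp]: "bdx \<zeta> 0 = 0" and bdy_0 [simp]: "bdy \<zeta> 0 = 0"
  by (simp_all add: bdx_def bdy_def)

lemma bdx_Suc: "bdx \<zeta> (Suc i) = bdx \<zeta> i + of_bool (\<zeta> (Suc i, 0))"
proof -
  have "{k \<in> {1..Suc i} \<times> {0}. \<zeta> k} =
      (if \<zeta> (Suc i, 0) then insert (Suc i, 0) {k \<in> {1..i} \<times> {0}. \<zeta> k} else {k \<in> {1..i} \<times> {0}. \<zeta> k})"
    by (auto simp: le_Suc_eq)
  moreover have "finite {k \<in> {1..i} \<times> {0::nat}. \<zeta> k}"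
    by (rule finite_subset[of _ "{1..i} \<times> {0}"]) auto
  ultimately show ?thesis by (auto simp: bdx_def)
qed

lemma bdy_Suc: "bdy \<zeta> (Suc j) = bdy \<zeta> j + of_bool (\<zeta> (0, Suc j))"
proof -
  have "{k \<in> {0} \<times> {1..Suc j}. \<zeta> k} =
      (if \<zeta> (0, Suc j) then insert (0, Suc j) {k \<in> {0} \<times> {1..j}. \<zeta> k} else {k \<in> {0} \<times> {1..j}. \<zeta> k})"
    by (auto simp: le_Suc_eq)
  moreover have "finite {k \<in> {0::nat} \<times> {1..j}. \<zeta> k}"
    by (rule finite_subset[of _ "{0} \<times> {1..j}"]) auto
  ultimately show ?thesis by (auto simp: bdy_def)
qed

lemma bdx_mono: "i \<le> i' \<Longrightarrow> bdx \<zeta> i \<le> bdx \<zeta> i'"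
  by (induction rule: dec_induct) (auto simp: bdx_Suc)

lemma bdy_mono: "i \<le> i' \<Longrightarrow> bdy \<zeta> i \<le> bdy \<zeta> i'"
  by (induction rule: dec_induct) (auto simp: bdy_Suc)

abbreviation lppb :: "(nat \<times> nat \<Rightarrow> bool) \<Rightarrow> nat \<Rightarrow> nat \<Rightarrow> nat" where
  "lppb \<zeta> \<equiv> lpp (bdx \<zeta>) (bdy \<zeta>) \<zeta>"

text \<open>
  The axis entry \<open>(i, 0)\<close> holds the current horizontal increment of column \<open>i\<close>, the entry \<open>(0, j)\<close>
  the current vertical increment of row \<open>j\<close>; visiting cell \<open>(i, j)\<close> moves both across the cell.
  The consumed cell is reset to \<open>False\<close>, the default value of the product measure.
\<close>

definition cell_step :: "nat \<Rightarrow> nat \<Rightarrow> (nat \<times> nat \<Rightarrow> bool) \<Rightarrow> nat \<times> nat \<Rightarrow> bool" where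
  "cell_step i j \<zeta> = \<zeta>(
     (i, 0) := ((\<zeta> (i, 0) \<or> \<zeta> (i, j)) \<and> \<not> \<zeta> (0, j)),
     (0, j) := ((\<zeta> (0, j) \<or> \<zeta> (i, j)) \<and> \<not> \<zeta> (i, 0)),
     (i, j) := False)"

fun col_sweep :: "nat \<Rightarrow> nat \<Rightarrow> (nat \<times> nat \<Rightarrow> bool) \<Rightarrow> nat \<times> nat \<Rightarrow> bool" where
  "col_sweep i 0 \<zeta> = \<zeta>"
| "col_sweep i (Suc j) \<zeta> = cell_step i (Suc j) (col_sweep i j \<zeta>)"

fun sweep :: "nat \<Rightarrow> nat \<Rightarrow> (nat \<times> nat \<Rightarrow> bool) \<Rightarrow> nat \<times> nat \<Rightarrow> bool" where
  "sweep m 0 \<zeta> = \<zeta>"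
| "sweep m (Suc i) \<zeta> = col_sweep (Suc i) m (sweep m i \<zeta>)"

lemma col_unchanged:
  "1 \<le> i' \<Longrightarrow> i' \<noteq> i \<or> j < j' \<Longrightarrow> col_sweep i j \<zeta> (i', j') = \<zeta> (i', j')"
  "j < j' \<Longrightarrow> 1 \<le> i \<Longrightarrow> col_sweep i j \<zeta> (0, j') = \<zeta> (0, j')"
  by (induction j) (auto simp: cell_step_def)

lemma sweep_unchanged: "i < i' \<Longrightarrow> sweep m i \<zeta> (i', j') = \<zeta> (i', j')"
  by (induction i) (auto simp: col_unchanged)

text \<open>Induction up the column \<open>Suc i\<close>. If a cell has lower increment
  \<open>x\<close>, left increment \<open>y\<close> and occupation \<open>s\<close>, all 0 or 1, its
  upper right value exceeds the lower left one by \<open>max x (max y s)\<close>. Subtracting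
  \<open>y\<close> or \<open>x\<close> gives exactly the two Boolean updates of
  \<open>cell_step\<close>.\<close>

lemma lpp_col:
  fixes W :: "nat \<Rightarrow> nat \<Rightarrow> nat"
  assumes W0: "W (Suc i) 0 = W i 0 + of_bool (\<sigma> (Suc i, 0))"
    and WS: "\<And>j. W (Suc i) (Suc j) = max (max (W i (Suc j)) (W (Suc i) j)) (W i j + of_bool (\<sigma> (Suc i, Suc j)))"
    and Wy: "\<And>j. j < m \<Longrightarrow> W i (Suc j) = W i j + of_bool (\<sigma> (0, Suc j))"
    and "j \<le> m"
  shows "W (Suc i) j = W i j + of_bool (col_sweep (Suc i) j \<sigma> (Suc i, 0)) \<and>
    (\<forall>k<j. W (Suc i) (Suc k) = W (Suc i) k + of_bool (col_sweep (Suc i) j \<sigma> (0, Suc k)))"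
  using \<open>j \<le> m\<close>
proof (induction j)
  case 0
  then show ?case using W0 by simp
next
  case (Suc j)
  then have IH: "W (Suc i) j = W i j + of_bool (col_sweep (Suc i) j \<sigma> (Suc i, 0))"
    "\<And>k. k < j \<Longrightarrow> W (Suc i) (Suc k) = W (Suc i) k + of_bool (col_sweep (Suc i) j \<sigma> (0, Suc k))" by auto
  have c: "col_sweep (Suc i) j \<sigma> (Suc i, Suc j) = \<sigma> (Suc i, Suc j)" "col_sweep (Suc i) j \<sigma> (0, Suc j) = \<sigma> (0, Suc j)"
    by (simp_all add: col_unchanged)
  have y: "W i (Suc j) = W i j + of_bool (\<sigma> (0, Suc j))"
    using Wy Suc by auto
  have "W (Suc i) (Suc j) = W i (Suc j) + of_bool (col_sweep (Suc i) (Suc j) \<sigma> (Suc i, 0))"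
    "W (Suc i) (Suc j) = W (Suc i) j + of_bool (col_sweep (Suc i) (Suc j) \<sigma> (0, Suc j))"
    using WS[of j] IH(1) y c by (auto simp: cell_step_def of_bool_def split: if_splits)
  moreover have "col_sweep (Suc i) (Suc j) \<sigma> (0, Suc k) = col_sweep (Suc i) j \<sigma> (0, Suc k)" if "k < j" for k
    using that by (simp add: cell_step_def)
  ultimately show ?case using IH(2) by (auto simp: less_Suc_eq)
qed

lemma lppb_sweep:
  "j < m \<Longrightarrow> lppb \<zeta> i (Suc j) = lppb \<zeta> i j + of_bool (sweep m i \<zeta> (0, Suc j))"
proof (induction i arbitrary: j)
  case 0
  then show ?case by (simp add: bdy_Suc)
next
  case (Suc i)
  have "lppb \<zeta> (Suc i) m = lppb \<zeta> i m + of_bool (col_sweep (Suc i) m (sweep m i \<zeta>) (Suc i, 0)) \<and>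
    (\<forall>k<m. lppb \<zeta> (Suc i) (Suc k) = lppb \<zeta> (Suc i) k + of_bool (col_sweep (Suc i) m (sweep m i \<zeta>) (0, Suc k)))"
  proof (rule lpp_col[where W = "lppb \<zeta>"])
    show "lppb \<zeta> (Suc i) 0 = lppb \<zeta> i 0 + of_bool (sweep m i \<zeta> (Suc i, 0))"
      by (simp add: lpp_0_right bdx_Suc sweep_unchanged)
    show "lppb \<zeta> (Suc i) (Suc j) = max (max (lppb \<zeta> i (Suc j)) (lppb \<zeta> (Suc i) j))
        (lppb \<zeta> i j + of_bool (sweep m i \<zeta> (Suc i, Suc j)))" for j
      by (simp add: sweep_unchanged)
  qed (rule Suc.IH, auto)
  with Suc.prems show ?case
    unfolding sweep.simps by blast
qed

text \<open>Read along the bottom edge to \<open>(n, 0)\<close> and then up the right edge, whose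
  increments are the axis entries \<open>(0, j)\<close> once all \<open>n\<close> columns have been
  swept.\<close>

lemma lppb_eq: "lppb \<zeta> n m = bdx \<zeta> n + bdy (sweep m n \<zeta>) m"
proof -
  have "lppb \<zeta> n j = bdx \<zeta> n + bdy (sweep m n \<zeta>) j" if "j \<le> m" for j
    using that
  proof (induction j)
    case (Suc j)
    then show ?case using lppb_sweep[of j m \<zeta> n] by (simp add: bdy_Suc)
  qed (simp add: lpp_0_right)
  then show ?thesis by simp
qed

section \<open>Strict chains of occupied cells\<close>

definition strictly_below :: "nat \<times> nat \<Rightarrow> nat \<times> nat \<Rightarrow> bool" where
  "strictly_below c d \<longleftrightarrow> fst c < fst d \<and> snd c < snd d"

lemma length_chain_le_lpp0:
  assumes "sorted_wrt strictly_below cs" "set cs \<subseteq> {1..n} \<times> {1..m}" "\<And>c. c \<in> set cs \<Longrightarrow> \<xi> c"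
  shows "length cs \<le> lpp0 \<xi> n m"
  using assms
proof (induction cs arbitrary: n m rule: rev_induct)
  case (snoc c cs)
  obtain i j where c: "c = (Suc i, Suc j)" "Suc i \<le> n" "Suc j \<le> m"
    using snoc.prems(2) by (cases c; cases "fst c"; cases "snd c") auto
  have "set cs \<subseteq> {1..i} \<times> {1..j}"
  proof
    fix d assume d: "d \<in> set cs"
    with snoc.prems(1) have "strictly_below d c" by (auto simp: sorted_wrt_append)
    with d snoc.prems(2) c show "d \<in> {1..i} \<times> {1..j}"
      by (cases d) (auto simp: strictly_below_def)
  qed
  then have "length cs \<le> lpp0 \<xi> i j"
    using snoc by (auto simp: sorted_wrt_append)
  moreover have "\<xi> (Suc i, Suc j)" using snoc.prems(3) c by auto
  ultimately have "length (cs @ [c]) \<le> lpp0 \<xi> (Suc i) (Suc j)" by simp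
  also have "\<dots> \<le> lpp0 \<xi> n m"
    using lpp0_mono_left lpp0_mono_right c le_trans by blast
  finally show ?case .
qed auto

lemma lpp0_attained:
  "\<exists>cs. sorted_wrt strictly_below cs \<and> set cs \<subseteq> {1..n} \<times> {1..m} \<and> (\<forall>c\<in>set cs. \<xi> c) \<and> length cs = lpp0 \<xi> n m"
proof (induction "\<lambda>_::nat. 0::nat" "\<lambda>_::nat. 0::nat" \<xi> n m rule: lpp.induct)
  case (3 \<xi> i j)
  consider "lpp0 \<xi> (Suc i) (Suc j) = lpp0 \<xi> i (Suc j)" | "lpp0 \<xi> (Suc i) (Suc j) = lpp0 \<xi> (Suc i) j"
    | "lpp0 \<xi> (Suc i) (Suc j) = lpp0 \<xi> i j + 1" "\<xi> (Suc i, Suc j)"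
  proof -
    have "lpp0 \<xi> (Suc i) (Suc j) = max (max (lpp0 \<xi> i (Suc j)) (lpp0 \<xi> (Suc i) j)) (lpp0 \<xi> i j + of_bool (\<xi> (Suc i, Suc j)))"
      by simp
    then have "lpp0 \<xi> (Suc i) (Suc j) = lpp0 \<xi> i (Suc j) \<or> lpp0 \<xi> (Suc i) (Suc j) = lpp0 \<xi> (Suc i) j \<or>
        lpp0 \<xi> (Suc i) (Suc j) = lpp0 \<xi> i j + 1 \<and> \<xi> (Suc i, Suc j)"
      \<comment> \<open>For an unoccupied cell the diagonal term is at most the value at
        \<open>(i, Suc j)\<close>, so the third alternative can insist on occupation.\<close>
      using lpp0_mono_right[of j "Suc j" \<xi> i]
      by (cases "\<xi> (Suc i, Suc j)") (simp_all only: of_bool_def if_True if_False max_def split: if_splits, auto)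
    then show thesis using that by blast
  qed
  then show ?case
  proof cases
    case 1
    with 3(1) show ?thesis by (fastforce simp del: lpp.simps)
  next
    case 2
    with 3(2) show ?thesis by (fastforce simp del: lpp.simps)
  next
    case c: 3
    from 3(3) obtain cs where cs: "sorted_wrt strictly_below cs" "set cs \<subseteq> {1..i} \<times> {1..j}"
      "\<forall>c\<in>set cs. \<xi> c" "length cs = lpp0 \<xi> i j" by auto
    have "sorted_wrt strictly_below (cs @ [(Suc i, Suc j)])"
      using cs by (auto simp: sorted_wrt_append strictly_below_def)
    moreover have "set (cs @ [(Suc i, Suc j)]) \<subseteq> {1..Suc i} \<times> {1..Suc j}" using cs(2) by auto
    ultimately show ?thesis using c cs(3,4)
      by (intro exI[of _ "cs @ [(Suc i, Suc j)]"]) (auto simp del: lpp.simps)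
  qed
qed auto

section \<open>Tail bounds for Bernoulli fields\<close>

text \<open>The Burke property of a single cell. A mixed pair of increments comes out exactly when
  the same pair went in, whatever \<open>s\<close> is. The output \<open>(True, True)\<close> arises
  only from an occupied cell without incoming increments, so \<open>uv\<close> is exactly the
  equation for its probability; \<open>(False, False)\<close> follows by normalisation.\<close>

lemma bernoulli_cell_invariant:
  assumes "0 \<le> u" "u \<le> 1" "0 \<le> v" "v \<le> 1" "0 \<le> p" "p \<le> 1" and uv: "u * v = p * (1 - u) * (1 - v)"
  shows "map_pmf (\<lambda>(x, y, s). ((x \<or> s) \<and> \<not> y, (y \<or> s) \<and> \<not> x))
      (pair_pmf (bernoulli_pmf u) (pair_pmf (bernoulli_pmf v) (bernoulli_pmf p))) =
    pair_pmf (bernoulli_pmf u) (bernoulli_pmf v)"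
    (is "map_pmf ?h ?P = ?Q")
proof (rule pmf_eqI)
  fix z :: "bool \<times> bool"
  obtain x y where z: "z = (x, y)" by (cases z)
  have uv': "p * u + (p * v + u * v) = p + p * (u * v)"
    using uv by (simp add: algebra_simps)
  have "pmf (map_pmf ?h ?P) z = (\<Sum>w\<in>{w. ?h w = z}. pmf ?P w)"
    by (simp add: pmf_map measure_measure_pmf_finite vimage_def)
  also have "\<dots> = (\<Sum>w\<in>UNIV. if ?h w = z then pmf ?P w else 0)"
    by (subst sum.inter_filter[symmetric]) auto
  also have "\<dots> = (\<Sum>x\<in>UNIV. \<Sum>y\<in>UNIV. \<Sum>s\<in>UNIV. if ?h (x, y, s) = z then pmf ?P (x, y, s) else 0)"
    unfolding sum.cartesian_product UNIV_Times_UNIV by (intro sum.cong) auto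
  also have "\<dots> = pmf ?Q z"
    using assms(1-6) unfolding z
    by (cases x; cases y) (simp_all add: UNIV_bool pmf_pair, simp_all add: algebra_simps uv')
  finally show "pmf (map_pmf ?h ?P) z = pmf ?Q z" .
qed

abbreviation bernoulli_field :: "'a set \<Rightarrow> ('a \<Rightarrow> real) \<Rightarrow> ('a \<Rightarrow> bool) pmf" where
  "bernoulli_field A q \<equiv> Pi_pmf A False (\<lambda>c. bernoulli_pmf (q c))"

text \<open>Only three coordinates change; the field on the remaining set \<open>R\<close> is split
  off and the one-cell invariance applied to the three. The consumed cell is deterministic
  afterwards and therefore leaves the index set.\<close>

lemma cell_step_law:
  fixes U :: "(nat \<times> nat) set"
  assumes U: "finite U" "(i, j) \<in> U" "(i, 0) \<in> U" "(0, j) \<in> U" and ij: "1 \<le> i" "1 \<le> j"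
    and q: "\<And>c. 0 \<le> q c \<and> q c \<le> 1"
    and uv: "q (i, 0) * q (0, j) = q (i, j) * (1 - q (i, 0)) * (1 - q (0, j))"
  shows "map_pmf (cell_step i j) (bernoulli_field U q) = bernoulli_field (U - {(i, j)}) q"
proof -
  define R where "R = U - {(i, j), (i, 0), (0, j)}"
  have R: "finite R" "(i, j) \<notin> R" "(i, 0) \<notin> R" "(0, j) \<notin> R" using U by (auto simp: R_def)
  define F where "F = (\<lambda>(x, y). map_pmf (\<lambda>f. f((0, j) := y, (i, 0) := x)) (bernoulli_field R q))"
  have U1: "U = insert (i, 0) (insert (0, j) (insert (i, j) R))"
    and U2: "U - {(i, j)} = insert (i, 0) (insert (0, j) R)"
    using U ij by (auto simp: R_def)
  have ne: "(i, 0) \<notin> insert (0, j) (insert (i, j) R)" "(0, j) \<notin> insert (i, j) R"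
    "(i, 0) \<notin> insert (0, j) R" using R ij by auto
  \<comment> \<open>Fields are \<open>False\<close> off their index set, so erasing
    \<open>(i, j)\<close> gives back \<open>f\<close> at that place and the result is again an
    update of a field on \<open>R\<close>.\<close>
  have out: "f (i, j) = False" if "f \<in> set_pmf (bernoulli_field R q)" for f
    using that set_Pi_pmf_subset[OF R(1)] R(2) by fast
  have upd: "cell_step i j (f((i, j) := s, (0, j) := y, (i, 0) := x)) =
      f((0, j) := ((y \<or> s) \<and> \<not> x), (i, 0) := ((x \<or> s) \<and> \<not> y))"
    if "f \<in> set_pmf (bernoulli_field R q)" for f x y s
    using out[OF that] ij by (auto simp: cell_step_def fun_eq_iff)
  have "map_pmf (cell_step i j) (bernoulli_field U q) =
     do {x \<leftarrow> bernoulli_pmf (q (i, 0)); y \<leftarrow> bernoulli_pmf (q (0, j)); s \<leftarrow> bernoulli_pmf (q (i, j));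
         f \<leftarrow> bernoulli_field R q;
         return_pmf (cell_step i j (f((i, j) := s, (0, j) := y, (i, 0) := x)))}"
    unfolding U1 using R ne
    by (simp add: Pi_pmf_insert' map_bind_pmf bind_assoc_pmf bind_return_pmf)
  also have "\<dots> =
     do {x \<leftarrow> bernoulli_pmf (q (i, 0)); y \<leftarrow> bernoulli_pmf (q (0, j)); s \<leftarrow> bernoulli_pmf (q (i, j));
         F ((x \<or> s) \<and> \<not> y, (y \<or> s) \<and> \<not> x)}"
    by (intro bind_pmf_cong refl) (auto simp: F_def map_pmf_def upd intro!: bind_pmf_cong)
  also have "\<dots> = bind_pmf (map_pmf (\<lambda>(x, y, s). ((x \<or> s) \<and> \<not> y, (y \<or> s) \<and> \<not> x))
      (pair_pmf (bernoulli_pmf (q (i, 0))) (pair_pmf (bernoulli_pmf (q (0, j))) (bernoulli_pmf (q (i, j)))))) F"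
    by (simp add: bind_map_pmf pair_pmf_def bind_assoc_pmf bind_return_pmf)
  also have "\<dots> = bind_pmf (pair_pmf (bernoulli_pmf (q (i, 0))) (bernoulli_pmf (q (0, j)))) F"
    using q uv by (subst bernoulli_cell_invariant) auto
  also have "\<dots> = bernoulli_field (U - {(i, j)}) q"
    unfolding U2 using R ne
    by (simp add: Pi_pmf_insert' pair_pmf_def F_def map_pmf_def bind_assoc_pmf bind_return_pmf)
  finally show ?thesis .
qed

text \<open>When a cell is visited, its state and the two increments meeting there are still
  independent of each other and of the rest, which is what \<open>cell_step_law\<close> needs. The
  outcome is that the swept axis entries have their original law.\<close>

lemma sweep_law:
  assumes q: "\<And>c. 0 \<le> q c \<and> q c \<le> 1"
    and uv: "\<And>i j. 1 \<le> i \<Longrightarrow> 1 \<le> j \<Longrightarrow> q (i, 0) * q (0, j) = q (i, j) * (1 - q (i, 0)) * (1 - q (0, j))"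
    and "i \<le> n"
  shows "map_pmf (sweep m i) (bernoulli_field ({0..n} \<times> {0..m}) q) =
    bernoulli_field ({0..n} \<times> {0..m} - {1..i} \<times> {1..m}) q"
  using \<open>i \<le> n\<close>
proof (induction i)
  case 0
  have "{0..n} \<times> {0..m} - {1..0::nat} \<times> {1..m} = {0..n} \<times> {0..m}" by auto
  then show ?case by (simp add: pmf.map_ident)
next
  case (Suc i)
  have c: "map_pmf (col_sweep (Suc i) j) (bernoulli_field ({0..n} \<times> {0..m} - {1..i} \<times> {1..m}) q) =
    bernoulli_field ({0..n} \<times> {0..m} - {1..i} \<times> {1..m} - {Suc i} \<times> {1..j}) q" if "j \<le> m" for j
    using that
  proof (induction j)
    case 0
    then show ?case by (simp add: pmf.map_ident)
  next
    case (Suc j)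
    have "map_pmf (col_sweep (Suc i) (Suc j)) (bernoulli_field ({0..n} \<times> {0..m} - {1..i} \<times> {1..m}) q) =
      map_pmf (cell_step (Suc i) (Suc j)) (map_pmf (col_sweep (Suc i) j) (bernoulli_field ({0..n} \<times> {0..m} - {1..i} \<times> {1..m}) q))"
      unfolding pmf.map_comp by (rule arg_cong[where f = "\<lambda>h. map_pmf h _"]) auto
    also have "map_pmf (col_sweep (Suc i) j) (bernoulli_field ({0..n} \<times> {0..m} - {1..i} \<times> {1..m}) q) =
      bernoulli_field ({0..n} \<times> {0..m} - {1..i} \<times> {1..m} - {Suc i} \<times> {1..j}) q"
      using Suc by simp
    also have "map_pmf (cell_step (Suc i) (Suc j)) \<dots> = 
       bernoulli_field ({0..n} \<times> {0..m} - {1..i} \<times> {1..m} - {Suc i} \<times> {1..j} - {(Suc i, Suc j)}) q"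
      using Suc.prems \<open>Suc i \<le> n\<close> q uv by (intro cell_step_law) auto
    also have "{0..n} \<times> {0..m} - {1..i} \<times> {1..m} - {Suc i} \<times> {1..j} - {(Suc i, Suc j)} =
       {0..n} \<times> {0..m} - {1..i} \<times> {1..m} - {Suc i} \<times> {1..Suc j}"
      by (auto simp: le_Suc_eq)
    finally show ?case .
  qed
  have "map_pmf (sweep m (Suc i)) (bernoulli_field ({0..n} \<times> {0..m}) q) =
    map_pmf (col_sweep (Suc i) m) (map_pmf (sweep m i) (bernoulli_field ({0..n} \<times> {0..m}) q))"
    unfolding pmf.map_comp by (rule arg_cong[where f = "\<lambda>h. map_pmf h _"]) auto
  also have "\<dots> = bernoulli_field ({0..n} \<times> {0..m} - {1..i} \<times> {1..m} - {Suc i} \<times> {1..m}) q"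
    using Suc c[of m] by simp
  also have "{0..n} \<times> {0..m} - {1..i} \<times> {1..m} - {Suc i} \<times> {1..m} = {0..n} \<times> {0..m} - {1..Suc i} \<times> {1..m}"
    by (auto simp: le_Suc_eq)
  finally show ?case .
qed

section \<open>Concentration of boundary counts\<close>

lemma bernoulli_field_marginal:
  assumes "finite A" "B \<subseteq> A"
  shows "map_pmf (\<lambda>f x. if x \<in> B then f x else False) (bernoulli_field A q) = bernoulli_field B q"
  by (rule Pi_pmf_subset[symmetric]) (use assms in auto)

text \<open>The count is binomial and Chebyshev's inequality applies; the factor
  \<open>1 - u\<close> of the variance is bounded by 1.\<close>

lemma bernoulli_field_card_deviation:
  fixes u :: real
  assumes A: "finite A" and B: "B \<subseteq> A" and q: "\<And>c. c \<in> B \<Longrightarrow> q c = u" and u: "0 \<le> u" "u \<le> 1" and r: "0 < r"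
  shows "measure_pmf.prob (bernoulli_field A q) {\<zeta>. r \<le> \<bar>real (card {c\<in>B. \<zeta> c}) - card B * u\<bar>}
    \<le> card B * u / r\<^sup>2"
proof -
  have fB: "finite B" using A B finite_subset by blast
  let ?S = "\<lambda>\<zeta>. real (card {c\<in>B. \<zeta> c})"
  have "map_pmf (\<lambda>\<zeta>. card {c\<in>B. \<zeta> c}) (bernoulli_field A q) =
    map_pmf (\<lambda>\<zeta>. card {c\<in>B. \<zeta> c}) (map_pmf (\<lambda>f x. if x \<in> B then f x else False) (bernoulli_field A q))"
    by (simp add: pmf.map_comp o_def cong: conj_cong)
  also have "\<dots> = map_pmf (\<lambda>\<zeta>. card {c\<in>B. \<zeta> c}) (bernoulli_field B (\<lambda>_. u))"
    using A B q by (subst bernoulli_field_marginal) (auto intro!: arg_cong[where f = "map_pmf _"] Pi_pmf_cong)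
  also have "\<dots> = binomial_pmf (card B) u"
    using fB u by (subst binomial_pmf_altdef'[of B]) auto
  finally have law: "map_pmf (\<lambda>\<zeta>. card {c\<in>B. \<zeta> c}) (bernoulli_field A q) = binomial_pmf (card B) u" .
  define D where "D = binomial_pmf (card B) u"
  have int: "integrable (measure_pmf D) (f :: nat \<Rightarrow> real)" for f
    unfolding D_def using u by (intro integrable_measure_pmf_finite finite_set_pmf_binomial_pmf) auto
  \<comment> \<open>Both moments are carried together through the recursion that adds one Bernoulli
    trial.\<close>
  have moments: "measure_pmf.expectation (binomial_pmf k u) (\<lambda>x. real x) = k * u \<and>
     measure_pmf.expectation (binomial_pmf k u) (\<lambda>x. (real x)\<^sup>2) = (k * u)\<^sup>2 + k * u * (1 - u)" for k
  proof (induction k)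
    case 0
    then show ?case using u by (simp add: binomial_pmf_0)
  next
    case (Suc k)
    have int: "integrable (measure_pmf (binomial_pmf k u)) (f :: nat \<Rightarrow> real)" for f
      using u by (intro integrable_measure_pmf_finite finite_set_pmf_binomial_pmf) auto
    have fin: "finite (set_pmf (binomial_pmf k u))" 
      using u by (intro finite_set_pmf_binomial_pmf) auto
    have E: "measure_pmf.expectation (binomial_pmf (Suc k) u) (f :: nat \<Rightarrow> real) =
      u * measure_pmf.expectation (binomial_pmf k u) (\<lambda>x. f (Suc x)) +
      (1 - u) * measure_pmf.expectation (binomial_pmf k u) f" for f
    proof -
      have "binomial_pmf (Suc k) u = bernoulli_pmf u \<bind> (\<lambda>b. map_pmf (\<lambda>x. of_bool b + x) (binomial_pmf k u))"
        using u by (subst binomial_pmf_Suc)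
          (auto simp: map_pmf_def of_bool_def intro!: bind_pmf_cong)
      then show ?thesis
        using u fin by (subst \<open>binomial_pmf (Suc k) u = _\<close>, subst pmf_expectation_bind[of UNIV])
          (auto simp: UNIV_bool)
    qed
    show ?case
      unfolding E using Suc int
      by (simp add: power2_eq_square algebra_simps Bochner_Integration.integral_add)
  qed
  have "measure_pmf.prob D {x. r \<le> \<bar>real x - measure_pmf.expectation D real\<bar>} \<le>
     measure_pmf.variance D real / r\<^sup>2"
    using measure_pmf.Chebyshev_inequality[of real D r] int r by auto
  also have "measure_pmf.variance D real = card B * u * (1 - u)"
    using moments[of "card B"] int by (subst measure_pmf.variance_eq) (auto simp: D_def)
  also have "measure_pmf.expectation D real = card B * u"
    using moments[of "card B"] by (simp add: D_def)
  also have "measure_pmf.prob D {x. r \<le> \<bar>real x - card B * u\<bar>} =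
      measure_pmf.prob (bernoulli_field A q) {\<zeta>. r \<le> \<bar>?S \<zeta> - card B * u\<bar>}"
    unfolding D_def law[symmetric] by (simp add: vimage_def)
  finally have "measure_pmf.prob (bernoulli_field A q) {\<zeta>. r \<le> \<bar>?S \<zeta> - card B * u\<bar>} \<le> card B * u * (1 - u) / r\<^sup>2" .
  also have "\<dots> \<le> card B * u / r\<^sup>2"
    using u r by (intro divide_right_mono mult_left_le) auto
  finally show ?thesis .
qed

text \<open>The passage time sees only the cells of its own box, whose marginal is a relabelled copy
  of the field on \<open>{1..n} \<times> {1..m}\<close>. The density \<open>q\<close> is free
  elsewhere, so boundary densities do not interfere.\<close>

lemma lpp0_translate_law:
  fixes A :: "(nat \<times> nat) set" and Q :: "nat \<Rightarrow> bool"
  assumes A: "finite A" "{a+1..a+n} \<times> {b+1..b+m} \<subseteq> A" and q: "\<And>c. c \<in> {a+1..a+n} \<times> {b+1..b+m} \<Longrightarrow> q c = p"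
  shows "measure_pmf.prob (bernoulli_field A q) {\<zeta>. Q (lpp0 (translate a b \<zeta>) n m)} =
    measure_pmf.prob (bernoulli_field ({1..n} \<times> {1..m}) (\<lambda>_. p)) {\<zeta>. Q (lpp0 \<zeta> n m)}"
proof -
  let ?B = "{a+1..a+n} \<times> {b+1..b+m}"
  define h where "h = (\<lambda>(i, j). (a + i, b + j))"
  have "bij_betw h ({1..n} \<times> {1..m}) ?B"
  proof (rule bij_betw_byWitness[where f' = "\<lambda>(i, j). (i - a, j - b)"])
    show "h ` ({1..n} \<times> {1..m}) \<subseteq> ?B" "(\<lambda>(i, j). (i - a, j - b)) ` ?B \<subseteq> {1..n} \<times> {1..m}"
      by (auto simp: h_def)
  qed (auto simp: h_def)
  moreover have "h x \<notin> ?B" if "x \<notin> {1..n} \<times> {1..m}" for x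
    using that by (cases x) (auto simp: h_def)
  ultimately have "bernoulli_field ({1..n} \<times> {1..m}) (\<lambda>_. p) = map_pmf (\<lambda>g. g \<circ> h) (bernoulli_field ?B (\<lambda>_. p))"
    by (intro Pi_pmf_bij_betw) auto
  also have "bernoulli_field ?B (\<lambda>_. p) = bernoulli_field ?B q"
    using q by (intro Pi_pmf_cong) auto
  also have "\<dots> = map_pmf (\<lambda>f x. if x \<in> ?B then f x else False) (bernoulli_field A q)"
    using A by (subst bernoulli_field_marginal) auto
  finally have "bernoulli_field ({1..n} \<times> {1..m}) (\<lambda>_. p) =
    map_pmf (\<lambda>f. (\<lambda>x. if x \<in> ?B then f x else False) \<circ> h) (bernoulli_field A q)"
    by (simp add: pmf.map_comp o_def)
  moreover have "lpp0 ((\<lambda>x. if x \<in> ?B then f x else False) \<circ> h) n m = lpp0 (translate a b f) n m" for f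
    by (rule lpp0_cong) (auto simp: h_def translate_def)
  ultimately show ?thesis by (simp add: vimage_def)
qed

lemma translate_0_0 [simp]: "translate 0 0 \<xi> = \<xi>"
  by (auto simp: translate_def)

text \<open>Sinks of density \<open>v\<close> on the vertical axis, sources of density
  \<open>u\<close> on the horizontal one. The relation between \<open>u\<close>, \<open>v\<close>
  and \<open>p\<close> that makes the model stationary is not built in; it is a hypothesis of
  \<open>burke_field_bdy_sweep\<close>.\<close>

definition burke_field :: "nat \<Rightarrow> nat \<Rightarrow> real \<Rightarrow> real \<Rightarrow> real \<Rightarrow> (nat \<times> nat \<Rightarrow> bool) pmf" where
  "burke_field n m u v p =
     bernoulli_field ({0..n} \<times> {0..m}) (\<lambda>(i, j). if i = 0 then v else if j = 0 then u else p)"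

lemma burke_field_bdx:
  assumes "0 \<le> u" "u \<le> 1" "0 < r" "i \<le> n"
  shows "measure_pmf.prob (burke_field n m u v p) {\<zeta>. r \<le> \<bar>real (bdx \<zeta> i) - i * u\<bar>} \<le> i * u / r\<^sup>2"
proof -
  have "card ({1..i} \<times> {0::nat}) = i" by (simp add: card_cartesian_product)
  with bernoulli_field_card_deviation[of "{0..n} \<times> {0..m}" "{1..i} \<times> {0}" _ u r] assms show ?thesis
    unfolding burke_field_def bdx_def by fastforce
qed

lemma burke_field_bdy:
  assumes "0 \<le> v" "v \<le> 1" "0 < r" "j \<le> m"
  shows "measure_pmf.prob (burke_field n m u v p) {\<zeta>. r \<le> \<bar>real (bdy \<zeta> j) - j * v\<bar>} \<le> j * v / r\<^sup>2"
proof -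
  have "card ({0::nat} \<times> {1..j}) = j" by (simp add: card_cartesian_product)
  with bernoulli_field_card_deviation[of "{0..n} \<times> {0..m}" "{0} \<times> {1..j}" _ v r] assms show ?thesis
    unfolding burke_field_def bdy_def by fastforce
qed

text \<open>The increments along the right edge depend on the whole field, yet by
  \<open>sweep_law\<close> they have the same law as the sinks on the left edge.\<close>

lemma burke_field_bdy_sweep:
  assumes "0 \<le> u" "u \<le> 1" "0 \<le> v" "v \<le> 1" "0 \<le> p" "p \<le> 1" "u * v = p * (1 - u) * (1 - v)" "0 < r"
  shows "measure_pmf.prob (burke_field n m u v p) {\<zeta>. r \<le> \<bar>real (bdy (sweep m n \<zeta>) m) - m * v\<bar>} \<le> m * v / r\<^sup>2"
proof -
  let ?q = "\<lambda>(i, j). if i = 0 then v else if j = 0 then u else p"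
  let ?E = "{\<zeta>. r \<le> \<bar>real (bdy \<zeta> m) - m * v\<bar>}"
  have "measure_pmf.prob (burke_field n m u v p) {\<zeta>. r \<le> \<bar>real (bdy (sweep m n \<zeta>) m) - m * v\<bar>} =
      measure_pmf.prob (map_pmf (sweep m n) (burke_field n m u v p)) ?E"
    by (simp add: vimage_def)
  also have "map_pmf (sweep m n) (burke_field n m u v p) =
      bernoulli_field ({0..n} \<times> {0..m} - {1..n} \<times> {1..m}) ?q"
    unfolding burke_field_def by (rule sweep_law) (use assms in auto)
  also have "measure_pmf.prob \<dots> ?E \<le> m * v / r\<^sup>2"
  proof -
    have "card ({0::nat} \<times> {1..m}) = m" by (simp add: card_cartesian_product)
    with bernoulli_field_card_deviation[of "{0..n} \<times> {0..m} - {1..n} \<times> {1..m}" "{0} \<times> {1..m}" ?q v r] assms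
    show ?thesis unfolding bdy_def by fastforce
  qed
  finally show ?thesis .
qed

lemma burke_field_lpp0_law:
  assumes "a + n' \<le> n" "b + m' \<le> m"
  shows "measure_pmf.prob (burke_field n m u v p) {\<zeta>. Q (lpp0 (translate a b \<zeta>) n' m')} =
    measure_pmf.prob (bernoulli_field ({1..n'} \<times> {1..m'}) (\<lambda>_. p)) {\<zeta>. Q (lpp0 \<zeta> n' m')}"
  unfolding burke_field_def by (rule lpp0_translate_law) (use assms in auto)

section \<open>Upper tail by comparison with the stationary model\<close>

lemma lpp0_le_lppb: "lpp0 \<zeta> n m \<le> lppb \<zeta> n m"
  by (rule lpp_mono) auto

text \<open>Boundary points only lengthen paths, and the stationary passage time is a sum of two
  binomial counts whose means add up to at most \<open>sqrt p * (lam * n + m / lam)\<close>. The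
  counts need not be independent, so each gets its own deviation \<open>r\<close>.\<close>

lemma lpp0_upper_tail_slope:
  fixes p lam r :: real
  assumes p: "0 \<le> p" "p \<le> 1" and lam: "0 < lam" and r: "0 < r"
  shows "measure_pmf.prob (bernoulli_field ({1..n} \<times> {1..m}) (\<lambda>_. p))
      {\<zeta>. sqrt p * (lam * n + m / lam) + 2 * r \<le> lpp0 \<zeta> n m} \<le> sqrt p * (lam * n + m / lam) / r\<^sup>2"
proof -
  \<comment> \<open>\<open>a\<close> and \<open>b\<close> are the odds of \<open>u\<close> and
    \<open>v\<close>, so that stationarity becomes \<open>a * b = p\<close>; \<open>lam\<close>
    distributes \<open>p\<close> between the two axes.\<close>
  define a b where "a = lam * sqrt p" and "b = sqrt p / lam"
  have ab: "0 \<le> a" "0 \<le> b" "a * b = p" using p lam by (auto simp: a_def b_def)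
  define u v where "u = a / (1 + a)" and "v = b / (1 + b)"
  have u: "0 \<le> u" "u \<le> 1" "u \<le> a" and v: "0 \<le> v" "v \<le> 1" "v \<le> b"
    using ab(1,2) by (auto simp: u_def v_def field_simps)
  have "1 - u = 1 / (1 + a)" "1 - v = 1 / (1 + b)"
    using ab by (auto simp: u_def v_def field_simps)
  then have uv: "u * v = p * (1 - u) * (1 - v)"
    by (simp add: u_def v_def flip: ab(3))
  let ?F = "burke_field n m u v p"
  let ?X = "{\<zeta>. r \<le> \<bar>real (bdx \<zeta> n) - n * u\<bar>}" and ?Y = "{\<zeta>. r \<le> \<bar>real (bdy (sweep m n \<zeta>) m) - m * v\<bar>}"
  have nu: "n * u + m * v \<le> sqrt p * (lam * n + m / lam)"
    using mult_left_mono[OF u(3), of "real n"] mult_left_mono[OF v(3), of "real m"]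
    by (simp add: a_def b_def algebra_simps)
  have "measure_pmf.prob (bernoulli_field ({1..n} \<times> {1..m}) (\<lambda>_. p))
      {\<zeta>. sqrt p * (lam * n + m / lam) + 2 * r \<le> lpp0 \<zeta> n m} =
    measure_pmf.prob ?F {\<zeta>. sqrt p * (lam * n + m / lam) + 2 * r \<le> lpp0 \<zeta> n m}"
    using burke_field_lpp0_law[of 0 n n 0 m m u v p "\<lambda>l. sqrt p * (lam * n + m / lam) + 2 * r \<le> real l"] by simp
  also have "\<dots> \<le> measure_pmf.prob ?F (?X \<union> ?Y)"
  proof (rule measure_pmf.finite_measure_mono, rule subsetI)
    fix \<zeta> assume "\<zeta> \<in> {\<zeta>. sqrt p * (lam * n + m / lam) + 2 * r \<le> lpp0 \<zeta> n m}"
    moreover have "lpp0 \<zeta> n m \<le> bdx \<zeta> n + bdy (sweep m n \<zeta>) m"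
      using lpp0_le_lppb lppb_eq by metis
    then have "real (lpp0 \<zeta> n m) \<le> bdx \<zeta> n + bdy (sweep m n \<zeta>) m" by linarith
    ultimately show "\<zeta> \<in> ?X \<union> ?Y" using nu by (auto simp: abs_if)
  qed auto
  also have "\<dots> \<le> measure_pmf.prob ?F ?X + measure_pmf.prob ?F ?Y"
    by (rule measure_Un_le) auto
  also have "\<dots> \<le> n * u / r\<^sup>2 + m * v / r\<^sup>2"
    using u v uv p r by (intro add_mono burke_field_bdx burke_field_bdy_sweep) auto
  also have "\<dots> \<le> sqrt p * (lam * n + m / lam) / r\<^sup>2"
    using divide_right_mono[OF nu, of "r\<^sup>2"] by (simp add: add_divide_distrib)
  finally show ?thesis .
qed

lemma lpp0_upper_tail:
  fixes p r :: real
  assumes p: "0 \<le> p" "p \<le> 1" and r: "0 < r"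
  shows "measure_pmf.prob (bernoulli_field ({1..n} \<times> {1..m}) (\<lambda>_. p))
      {\<zeta>. 2 * sqrt (p * n * m) + 2 * r \<le> lpp0 \<zeta> n m} \<le> 2 * sqrt (p * n * m) / r\<^sup>2"
proof (cases "n = 0 \<or> m = 0")
  case True
  then show ?thesis using r by auto
next
  case False
  \<comment> \<open>This choice balances the two terms of the mean, the equality case of the
    arithmetic-geometric inequality.\<close>
  define lam where "lam = sqrt m / sqrt n"
  have lam: "0 < lam" using False by (simp add: lam_def)
  have "lam * n = sqrt n * sqrt m" "m / lam = sqrt n * sqrt m"
    using False real_sqrt_mult_self[of "real n"] real_sqrt_mult_self[of "real m"]
    by (simp_all add: lam_def divide_simps mult.assoc)
  then have "sqrt p * (lam * n + m / lam) = 2 * sqrt (p * n * m)"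
    by (simp add: real_sqrt_mult)
  with lpp0_upper_tail_slope[OF p lam r, of n m] show ?thesis by simp
qed

section \<open>Lower tail by localising the exit point\<close>

text \<open>\<open>x\<close> is the fraction of the axis at which the path exits and
  \<open>d\<close> the grid width. With all errors at most \<open>\<eta>\<close>, the assumption
  \<open>exit\<close> bounds \<open>2 - x - 2 * w = (1 - w)\<^sup>2\<close> by
  \<open>8 * \<eta>\<close>, where \<open>w = sqrt (1 - x)\<close>. Hence
  \<open>1 - w \<le> 3 * sqrt \<eta>\<close> and \<open>x \<le> 6 * sqrt \<eta>\<close>; the
  remaining errors add up to at most \<open>6 * \<eta>\<close>, which explains the 12.\<close>

lemma exit_point_arith:
  fixes s \<eta> \<sigma> x d :: real
  assumes s: "0 < s" and \<eta>: "0 < \<eta>" "\<eta> \<le> 1" and \<sigma>: "0 \<le> \<sigma>" "\<sigma> \<le> \<eta>" and x: "0 \<le> x" "x \<le> 1" and d: "d \<le> \<eta>"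
    and exit: "2 * (s / (1 + \<sigma>)) - 2 * (\<eta> * s) \<le> (x + d) * s + \<eta> * s + (2 * (s * sqrt (1 - x)) + 2 * (\<eta> * s))"
  shows "(2 - 12 * sqrt \<eta>) * s \<le> 2 * (s / (1 + \<sigma>)) - 2 * (\<eta> * s) - ((x + d) * s + \<eta> * s)"
proof -
  define w where "w = sqrt (1 - x)"
  have w: "0 \<le> w" "w \<le> 1" "w\<^sup>2 = 1 - x" using x by (auto simp: w_def)
  have inv: "1 - \<sigma> \<le> 1 / (1 + \<sigma>)" using \<sigma> by (simp add: field_simps)
  have "(2 * (1 / (1 + \<sigma>)) - 2 * \<eta>) * s \<le> (x + d + \<eta> + 2 * w + 2 * \<eta>) * s"
    using exit by (simp add: algebra_simps w_def)
  with s have "2 * (1 / (1 + \<sigma>)) - 2 * \<eta> \<le> x + d + \<eta> + 2 * w + 2 * \<eta>" by simp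
  then have "(1 - w)\<^sup>2 \<le> 8 * \<eta>"
    using inv \<sigma> d w(3) by (simp add: power2_eq_square algebra_simps)
  also have "\<dots> \<le> (3 * sqrt \<eta>)\<^sup>2" using \<eta> by (simp add: power_mult_distrib)
  finally have w3: "1 - w \<le> 3 * sqrt \<eta>"
    using \<eta> by (auto intro: power2_le_imp_le[of "1 - w" "3 * sqrt \<eta>"])
  have "(1 - w) * (1 + w) = 1 - w\<^sup>2" by (simp add: power2_eq_square algebra_simps)
  then have "x = (1 - w) * (1 + w)" using w(3) by simp
  also have "\<dots> \<le> (1 - w) * 2" using w by (intro mult_left_mono) auto
  finally have x6: "x \<le> 6 * sqrt \<eta>" using w3 by simp
  have "\<eta> \<le> sqrt \<eta>" using \<eta> real_le_rsqrt[of \<eta> \<eta>] by (simp add: power2_eq_square mult_left_le)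
  then have "2 - 12 * sqrt \<eta> \<le> 2 * (1 / (1 + \<sigma>)) - 2 * \<eta> - (x + d + \<eta>)"
    using inv \<sigma> d x6 by linarith
  from mult_right_mono[OF this, of s] s show ?thesis by (simp add: algebra_simps)
qed

text \<open>Off the bad events the stationary time is almost \<open>2 * s\<close>, its boundary part
  is small, and the rest is a path without boundary. Each of the \<open>J + 1\<close> grid points
  \<open>k * q\<close> costs four events of probability at most \<open>2 * s / r\<^sup>2\<close>
  with \<open>r = \<eta> * s\<close>, and the right edge one more:
  \<open>8 * (J + 1) + 2 = 8 * J + 10\<close>.\<close>

lemma lpp0_lower_tail:
  fixes p \<eta> :: real and J q :: nat
  assumes p: "0 < p" "p \<le> 1" and sp: "sqrt p \<le> \<eta>" and \<eta>: "0 < \<eta>" "\<eta> \<le> 1"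
    and J: "1 / J \<le> \<eta>" "1 \<le> J" and q: "1 \<le> q" and n: "n = J * q" and s: "s = n * sqrt p"
  shows "measure_pmf.prob (bernoulli_field ({1..n} \<times> {1..n}) (\<lambda>_. p))
      {\<zeta>. lpp0 \<zeta> n n < (2 - 12 * sqrt \<eta>) * s} \<le> (8 * J + 10) / (\<eta>\<^sup>2 * s)"
proof -
  define \<sigma> where "\<sigma> = sqrt p"
  define u where "u = \<sigma> / (1 + \<sigma>)"
  define r where "r = \<eta> * s"
  have \<sigma>: "0 < \<sigma>" "\<sigma> \<le> \<eta>" "\<sigma> * \<sigma> = p" using p sp by (auto simp: \<sigma>_def)
  have u: "0 \<le> u" "u \<le> 1" "u \<le> \<sigma>" and u1: "1 - u = 1 / (1 + \<sigma>)"
    using \<sigma>(1) by (auto simp: u_def field_simps)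
  have uu: "u * u = p * (1 - u) * (1 - u)"
    unfolding u1 by (simp add: u_def flip: \<sigma>(3))
  have n0: "0 < n" using n J q by auto
  have s0: "0 < s" and r0: "0 < r" using n0 p \<eta> by (auto simp: s r_def)
  have nu: "n * u = s / (1 + \<sigma>)" by (simp add: s u_def \<sigma>_def)
  have nus: "n * u \<le> s" using mult_left_mono[OF u(3), of "real n"] by (simp add: s \<sigma>_def)
  let ?F = "burke_field n n u u p"
  \<comment> \<open>\<open>X\<close> and \<open>Y\<close> control the boundary counts up to the grid
    point \<open>k * q\<close>, \<open>R\<close> and \<open>T\<close> the passage times of what lies
    beyond it, and \<open>Z\<close> the right edge.\<close>
  define X where "X k = {\<zeta>. r \<le> \<bar>real (bdx \<zeta> (k * q)) - real (k * q) * u\<bar>}" for k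
  define Y where "Y k = {\<zeta>. r \<le> \<bar>real (bdy \<zeta> (k * q)) - real (k * q) * u\<bar>}" for k
  define R where "R k = {\<zeta>. 2 * sqrt (p * real (n - k * q) * n) + 2 * r \<le> lpp0 (translate (k * q) 0 \<zeta>) (n - k * q) n}" for k
  define T where "T k = {\<zeta>. 2 * sqrt (p * n * real (n - k * q)) + 2 * r \<le> lpp0 (translate 0 (k * q) \<zeta>) n (n - k * q)}" for k
  define Z where "Z = {\<zeta>. r \<le> \<bar>real (bdy (sweep n n \<zeta>) n) - n * u\<bar>}"
  have kq: "k * q \<le> n" if "k \<le> J" for k using that by (simp add: n)
  have kqu: "real (k * q) * u \<le> s" if "k \<le> J" for k
    using order_trans[OF mult_right_mono[of "real (k * q)" "real n" u] nus] kq[OF that] u by (simp flip: of_nat_mult)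
  have X_le: "measure_pmf.prob ?F (X k) \<le> 2 * s / r\<^sup>2" and Y_le: "measure_pmf.prob ?F (Y k) \<le> 2 * s / r\<^sup>2"
    if "k \<le> J" for k
  proof -
    have *: "real (k * q) * u / r\<^sup>2 \<le> 2 * s / r\<^sup>2"
      using kqu[OF that] s0 by (intro divide_right_mono) auto
    show "measure_pmf.prob ?F (X k) \<le> 2 * s / r\<^sup>2"
      unfolding X_def using burke_field_bdx[OF u(1,2) r0 kq[OF that], of n u p] * by linarith
    show "measure_pmf.prob ?F (Y k) \<le> 2 * s / r\<^sup>2"
      unfolding Y_def using burke_field_bdy[OF u(1,2) r0 kq[OF that], of n u p] * by linarith
  qed
  have Z_le: "measure_pmf.prob ?F Z \<le> 2 * s / r\<^sup>2"
  proof -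
    have "measure_pmf.prob ?F Z \<le> n * u / r\<^sup>2"
      unfolding Z_def using u uu p r0 by (intro burke_field_bdy_sweep) auto
    also have "\<dots> \<le> 2 * s / r\<^sup>2" using nus s0 by (intro divide_right_mono) auto
    finally show ?thesis .
  qed
  have sqrt_le: "2 * sqrt (p * a * b) / r\<^sup>2 \<le> 2 * s / r\<^sup>2" if "a \<le> n" "b \<le> n" "0 \<le> a" "0 \<le> b" for a b :: real
  proof -
    have "sqrt (p * a * b) \<le> sqrt (p * n * n)"
      using that p by (intro real_sqrt_le_mono mult_mono mult_left_mono) auto
    also have "\<dots> = s" using s0 p by (simp add: s real_sqrt_mult)
    finally show ?thesis by (intro divide_right_mono) auto
  qed
  have R_le: "measure_pmf.prob ?F (R k) \<le> 2 * s / r\<^sup>2" and T_le: "measure_pmf.prob ?F (T k) \<le> 2 * s / r\<^sup>2"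
    if "k \<le> J" for k
  proof -
    have "measure_pmf.prob ?F (R k) \<le> 2 * sqrt (p * real (n - k * q) * n) / r\<^sup>2"
      unfolding R_def using kq[OF that] p r0 lpp0_upper_tail[of p r "n - k * q" n]
      by (subst burke_field_lpp0_law[where Q = "\<lambda>l. 2 * sqrt (p * real (n - k * q) * n) + 2 * r \<le> real l"]) auto
    also have "\<dots> \<le> 2 * s / r\<^sup>2" by (rule sqrt_le) auto
    finally show "measure_pmf.prob ?F (R k) \<le> 2 * s / r\<^sup>2" .
    have "measure_pmf.prob ?F (T k) \<le> 2 * sqrt (p * n * real (n - k * q)) / r\<^sup>2"
      unfolding T_def using kq[OF that] p r0 lpp0_upper_tail[of p r n "n - k * q"]
      by (subst burke_field_lpp0_law[where Q = "\<lambda>l. 2 * sqrt (p * n * real (n - k * q)) + 2 * r \<le> real l"]) auto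
    also have "\<dots> \<le> 2 * s / r\<^sup>2" by (rule sqrt_le) auto
    finally show "measure_pmf.prob ?F (T k) \<le> 2 * s / r\<^sup>2" .
  qed
  define Bad where "Bad = (\<Union>k\<le>J. X k \<union> Y k \<union> (R k \<union> T k)) \<union> Z"
  have "measure_pmf.prob ?F Bad \<le> measure_pmf.prob ?F (\<Union>k\<le>J. X k \<union> Y k \<union> (R k \<union> T k)) + measure_pmf.prob ?F Z"
    unfolding Bad_def by (rule measure_Un_le) auto
  also have "measure_pmf.prob ?F (\<Union>k\<le>J. X k \<union> Y k \<union> (R k \<union> T k)) \<le> (\<Sum>k\<le>J. measure_pmf.prob ?F (X k \<union> Y k \<union> (R k \<union> T k)))"
    by (rule measure_UNION_le) auto
  also have "\<dots> \<le> (\<Sum>k\<le>J. 8 * s / r\<^sup>2)"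
  proof (rule sum_mono)
    fix k assume k: "k \<in> {..J}"
    have "measure_pmf.prob ?F (X k \<union> Y k \<union> (R k \<union> T k)) \<le>
       measure_pmf.prob ?F (X k) + measure_pmf.prob ?F (Y k) + (measure_pmf.prob ?F (R k) + measure_pmf.prob ?F (T k))"
      by (intro order_trans[OF measure_Un_le] add_mono measure_Un_le) auto
    with X_le[of k] Y_le[of k] R_le[of k] T_le[of k] k
    show "measure_pmf.prob ?F (X k \<union> Y k \<union> (R k \<union> T k)) \<le> 8 * s / r\<^sup>2" by simp
  qed
  finally have "measure_pmf.prob ?F Bad \<le> (\<Sum>k\<le>J. 8 * s / r\<^sup>2) + 2 * s / r\<^sup>2"
    using Z_le by linarith
  also have "\<dots> = (8 * J + 10) * s / r\<^sup>2"
    by (simp add: add_divide_distrib[symmetric] algebra_simps)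
  also have "\<dots> = (8 * J + 10) / (\<eta>\<^sup>2 * s)" using s0 \<eta> by (simp add: r_def power2_eq_square field_simps)
  finally have Bad_le: "measure_pmf.prob ?F Bad \<le> (8 * J + 10) / (\<eta>\<^sup>2 * s)" .

  have good: "(2 - 12 * sqrt \<eta>) * s \<le> lpp0 \<zeta> n n" if \<zeta>: "\<zeta> \<notin> Bad" for \<zeta>
  proof -
    let ?W = "real (lppb \<zeta> n n)"
    \<comment> \<open>The stationary time is bottom edge plus right edge; \<open>X J\<close> speaks
      of the full bottom edge because \<open>J * q = n\<close>.\<close>
    have "\<zeta> \<notin> X J" "\<zeta> \<notin> Z" using \<zeta> by (auto simp: Bad_def)
    then have "n * u - r < bdx \<zeta> n" "n * u - r < bdy (sweep n n \<zeta>) n"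
      by (auto simp: X_def Z_def n abs_if split: if_splits)
    then have W: "2 * (s / (1 + \<sigma>)) - 2 * (\<eta> * s) \<le> ?W"
      unfolding lppb_eq nu r_def by simp
    \<comment> \<open>\<open>B\<close> and \<open>L\<close> belong to the exit itself,
      \<open>B'\<close> and \<open>L'\<close> to neighbouring grid points: the boundary count is
      bounded at the grid point after the exit, the remaining passage time at the one before it.
      Both axes use this step.\<close>
    have step: "(2 - 12 * sqrt \<eta>) * s \<le> lpp0 \<zeta> n n"
      if k: "k < J" and z: "?W \<le> B + L" "L \<le> lpp0 \<zeta> n n" "L \<le> L'" "B \<le> B'"
        and B': "B' < real (Suc k * q) * u + r" and L': "L' < 2 * sqrt (p * real (n - k * q) * n) + 2 * r" for k B B' L L'
    proof -
      have kqn: "real k * q \<le> real J * q" using k by (intro mult_right_mono) auto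
      have 1: "real (n - k * q) = n * (1 - k / J)"
        using k J by (simp add: n of_nat_diff field_simps)
      have "sqrt (p * real (n - k * q) * n) = sqrt (s\<^sup>2 * (1 - k / J))"
        unfolding 1 using p by (simp add: s power_mult_distrib power2_eq_square mult.assoc mult.left_commute)
      then have L'': "L' < 2 * (s * sqrt (1 - k / J)) + 2 * (\<eta> * s)"
        using L' s0 by (simp add: real_sqrt_mult r_def)
      have "real (Suc k * q) * u \<le> real (Suc k * q) * \<sigma>"
        using u by (intro mult_left_mono) auto
      also have "\<dots> = (k / J + 1 / J) * s"
        using J by (simp add: s \<sigma>_def n field_simps)
      finally have B'': "B' < (k / J + 1 / J) * s + \<eta> * s" using B' by (simp add: r_def)
      have "(2 - 12 * sqrt \<eta>) * s \<le> 2 * (s / (1 + \<sigma>)) - 2 * (\<eta> * s) - ((k / J + 1 / J) * s + \<eta> * s)"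
      proof (rule exit_point_arith)
        show "2 * (s / (1 + \<sigma>)) - 2 * (\<eta> * s) \<le> (k / J + 1 / J) * s + \<eta> * s + (2 * (s * sqrt (1 - k / J)) + 2 * (\<eta> * s))"
          using W z L'' B'' by linarith
        show "real k / J \<le> 1" using k by simp
      qed (use s0 \<eta> \<sigma> J in auto)
      then show ?thesis using W z B'' by linarith
    qed
    have "(\<exists>z\<le>n. lppb \<zeta> n n \<le> bdx \<zeta> z + lpp0 (translate z 0 \<zeta>) (n - z) n) \<or>
         (\<exists>z\<le>n. lppb \<zeta> n n \<le> bdy \<zeta> z + lpp0 (translate 0 z \<zeta>) n (n - z))"
      by (rule lpp_exit) auto
    moreover have "\<exists>k<J. k * q \<le> z \<and> z \<le> Suc k * q" if "z \<le> n" for z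
    \<comment> \<open>For \<open>z = n\<close> the quotient \<open>z div q\<close> would be
      \<open>J\<close>, out of range; this exit belongs to the interval that ends there.\<close>
    proof (cases "z = n")
      case True
      then show ?thesis using J q by (intro exI[of _ "J - 1"]) (auto simp: n)
    next
      case False
      with that have "z < J * q" by (simp add: n)
      then have "z div q < J" by (simp add: less_mult_imp_div_less)
      moreover have "z div q * q \<le> z" "z \<le> Suc (z div q) * q"
        using q dividend_less_div_times[of q z] by auto
      ultimately show ?thesis by blast
    qed
    ultimately consider (x) k z where "k < J" "k * q \<le> z" "z \<le> Suc k * q" "z \<le> n" "lppb \<zeta> n n \<le> bdx \<zeta> z + lpp0 (translate z 0 \<zeta>) (n - z) n"
      | (y) k z where "k < J" "k * q \<le> z" "z \<le> Suc k * q" "z \<le> n" "lppb \<zeta> n n \<le> bdy \<zeta> z + lpp0 (translate 0 z \<zeta>) n (n - z)"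
      by blast
    then show ?thesis
    proof cases
      case x
      have "\<zeta> \<notin> X (Suc k)" "\<zeta> \<notin> R k" using \<zeta> x(1) by (auto simp: Bad_def)
      moreover have "lpp0 (translate z 0 \<zeta>) (n - z) n \<le> lpp0 (translate (k * q) 0 \<zeta>) (n - k * q) n"
        using lpp0_translate_le[of "z - k * q" 0 "translate (k * q) 0 \<zeta>" "n - z" n] x(2,4)
        by (simp add: translate_translate)
      moreover have "lpp0 (translate z 0 \<zeta>) (n - z) n \<le> lpp0 \<zeta> n n"
        using lpp0_translate_le[of z 0 \<zeta> "n - z" n] x(4) by simp
      ultimately show ?thesis
        using x(1,5) bdx_mono[OF x(3), of \<zeta>]
        by (intro step[of k "bdx \<zeta> z" "lpp0 (translate z 0 \<zeta>) (n - z) n"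
          "lpp0 (translate (k * q) 0 \<zeta>) (n - k * q) n" "bdx \<zeta> (Suc k * q)"])
          (auto simp: X_def R_def abs_if simp del: mult_Suc split: if_splits)
    next
      case y
      have "\<zeta> \<notin> Y (Suc k)" "\<zeta> \<notin> T k" using \<zeta> y(1) by (auto simp: Bad_def)
      moreover have "lpp0 (translate 0 z \<zeta>) n (n - z) \<le> lpp0 (translate 0 (k * q) \<zeta>) n (n - k * q)"
        using lpp0_translate_le[of 0 "z - k * q" "translate 0 (k * q) \<zeta>" n "n - z"] y(2,4)
        by (simp add: translate_translate)
      moreover have "lpp0 (translate 0 z \<zeta>) n (n - z) \<le> lpp0 \<zeta> n n"
        using lpp0_translate_le[of 0 z \<zeta> n "n - z"] y(4) by simp
      moreover have "lpp0 (translate 0 (k * q) \<zeta>) n (n - k * q) < 2 * sqrt (p * real (n - k * q) * n) + 2 * r"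
        using \<open>\<zeta> \<notin> T k\<close> unfolding T_def mult.assoc mult.commute[of "real n" "real (n - k * q)"] by simp
      ultimately show ?thesis
        using y(1,5) bdy_mono[OF y(3), of \<zeta>]
        by (intro step[of k "bdy \<zeta> z" "lpp0 (translate 0 z \<zeta>) n (n - z)"
          "lpp0 (translate 0 (k * q) \<zeta>) n (n - k * q)" "bdy \<zeta> (Suc k * q)"])
          (auto simp: Y_def abs_if simp del: mult_Suc split: if_splits)
    qed
  qed
  have "measure_pmf.prob (bernoulli_field ({1..n} \<times> {1..n}) (\<lambda>_. p)) {\<zeta>. lpp0 \<zeta> n n < (2 - 12 * sqrt \<eta>) * s} =
      measure_pmf.prob ?F {\<zeta>. lpp0 \<zeta> n n < (2 - 12 * sqrt \<eta>) * s}"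
    using burke_field_lpp0_law[of 0 n n 0 n n u u p "\<lambda>l. real l < (2 - 12 * sqrt \<eta>) * s"] by simp
  also have "\<dots> \<le> measure_pmf.prob ?F Bad"
    by (rule measure_pmf.finite_measure_mono) (use good in force)+
  finally show ?thesis using Bad_le by linarith
qed

section \<open>Occupied cells of a Poisson process\<close>

lemma bernoulli_field_insert:
  assumes "finite A" "c \<notin> A" "0 \<le> q c" "q c \<le> 1"
  shows "measure_pmf.prob (bernoulli_field (insert c A) q) {\<zeta>. Q \<zeta>} =
    q c * measure_pmf.prob (bernoulli_field A q) {\<zeta>. Q (\<zeta>(c := True))} +
    (1 - q c) * measure_pmf.prob (bernoulli_field A q) {\<zeta>. Q (\<zeta>(c := False))}"
proof -
  have "measure_pmf.prob (bernoulli_field (insert c A) q) {\<zeta>. Q \<zeta>} =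
      measure_pmf.expectation (bernoulli_pmf (q c) \<bind> (\<lambda>b. map_pmf (\<lambda>\<zeta>. \<zeta>(c := b)) (bernoulli_field A q))) (indicator {\<zeta>. Q \<zeta>})"
    using assms(1,2) by (simp add: Pi_pmf_insert' map_pmf_def)
  also have "\<dots> = (\<Sum>b\<in>UNIV. pmf (bernoulli_pmf (q c)) b * measure_pmf.prob (bernoulli_field A q) {\<zeta>. Q (\<zeta>(c := b))})"
  proof -
    have fin: "finite (set_pmf (bernoulli_field A q))"
      using assms(1) by (auto intro!: finite_subset[OF set_Pi_pmf_subset'] finite_PiE_dflt)
    have "measure_pmf.expectation (bernoulli_pmf (q c) \<bind> (\<lambda>b. map_pmf (\<lambda>\<zeta>. \<zeta>(c := b)) (bernoulli_field A q))) (indicator {\<zeta>. Q \<zeta>} :: _ \<Rightarrow> real) =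
      (\<Sum>b\<in>UNIV. pmf (bernoulli_pmf (q c)) b *\<^sub>R measure_pmf.expectation (map_pmf (\<lambda>\<zeta>. \<zeta>(c := b)) (bernoulli_field A q)) (indicator {\<zeta>. Q \<zeta>}))"
      by (rule pmf_expectation_bind) (use fin in auto)
    then show ?thesis by (simp add: vimage_def)
  qed
  finally show ?thesis using assms by (simp add: UNIV_bool)
qed

text \<open>Condition on one cell: raising its probability moves weight from \<open>?N\<close> to
  \<open>?T\<close>, which is larger for an increasing \<open>Q\<close>. Needed for cells cut by the
  boundary of the quarter-plane, whose occupation probability may be below the nominal one.\<close>

lemma bernoulli_field_prob_mono:
  assumes "finite A" and q: "\<And>c. c \<in> A \<Longrightarrow> 0 \<le> q c \<and> q c \<le> p c \<and> p c \<le> 1"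
    and Q: "\<And>\<zeta> \<zeta>'. Q \<zeta> \<Longrightarrow> (\<And>c. \<zeta> c \<Longrightarrow> \<zeta>' c) \<Longrightarrow> Q \<zeta>'"
  shows "measure_pmf.prob (bernoulli_field A q) {\<zeta>. Q \<zeta>} \<le> measure_pmf.prob (bernoulli_field A p) {\<zeta>. Q \<zeta>}"
  using assms
proof (induction A arbitrary: Q rule: finite_induct)
  case (insert c A)
  let ?T = "\<lambda>q. measure_pmf.prob (bernoulli_field A q) {\<zeta>. Q (\<zeta>(c := True))}"
  let ?N = "\<lambda>q. measure_pmf.prob (bernoulli_field A q) {\<zeta>. Q (\<zeta>(c := False))}"
  have c: "0 \<le> q c" "q c \<le> p c" "p c \<le> 1" using insert.prems(1) by auto
  have mono: "Q (\<zeta>'(c := b))" if "Q (\<zeta>(c := b))" "\<And>c. \<zeta> c \<Longrightarrow> \<zeta>' c" for \<zeta> \<zeta>' b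
    using that by (intro insert.prems(2)[OF that(1)]) (auto split: if_splits)
  have T: "?T q \<le> ?T p" and N: "?N q \<le> ?N p"
    by (rule insert.IH; use insert.prems(1) mono in blast)+
  have NT: "?N p \<le> ?T p"
    by (rule measure_pmf.finite_measure_mono) (auto intro: insert.prems(2) split: if_splits)
  have "q c * ?T q + (1 - q c) * ?N q \<le> q c * ?T p + (1 - q c) * ?N p"
    using T N c by (intro add_mono mult_left_mono) auto
  also have "\<dots> \<le> p c * ?T p + (1 - p c) * ?N p"
    using mult_right_mono[of "q c" "p c" "?T p - ?N p"] NT c by (simp add: algebra_simps)
  finally show ?case
    using bernoulli_field_insert[of A c q Q] bernoulli_field_insert[of A c p Q] insert.hyps c by simp
qed auto

section \<open>Counts and occupancy patterns\<close>

context homogeneous_poisson_process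
begin

lemma count_eq_0_iff: "\<omega> \<in> space M \<Longrightarrow> bounded B \<Longrightarrow> card (\<Xi> \<omega> \<inter> B) = 0 \<longleftrightarrow> \<Xi> \<omega> \<inter> B = {}"
  using locally_finite[of \<omega> B] by auto

lemma count_events [measurable]:
  "B \<in> sets borel \<Longrightarrow> B \<subseteq> S \<Longrightarrow> bounded B \<Longrightarrow> {\<omega> \<in> space M. P (card (\<Xi> \<omega> \<inter> B))} \<in> events"
  using measurable_sets[OF count_measurable, of B "Collect P"] by (simp add: vimage_def Int_def conj_commute)

text \<open>The exact value is \<open>1 - (1 + ?a) * exp (- ?a)\<close>, and
  \<open>exp (- ?a) \<ge> 1 - ?a\<close> leaves the square of \<open>?a\<close>.\<close>

lemma prob_count_ge_2:
  assumes B: "B \<in> sets borel" "B \<subseteq> S" "bounded B"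
  shows "prob {\<omega> \<in> space M. 2 \<le> card (\<Xi> \<omega> \<inter> B)} \<le> (r * measure lborel B)\<^sup>2"
proof -
  let ?a = "r * measure lborel B" and ?N = "\<lambda>\<omega>. card (\<Xi> \<omega> \<inter> B)"
  have a: "0 \<le> ?a" using intensity_nonneg by simp
  have eq: "{\<omega> \<in> space M. 2 \<le> ?N \<omega>} = space M - ({\<omega> \<in> space M. ?N \<omega> = 0} \<union> {\<omega> \<in> space M. ?N \<omega> = 1})"
    by auto
  have "prob ({\<omega> \<in> space M. ?N \<omega> = 0} \<union> {\<omega> \<in> space M. ?N \<omega> = 1}) =
      prob {\<omega> \<in> space M. ?N \<omega> = 0} + prob {\<omega> \<in> space M. ?N \<omega> = 1}"
    using count_events[OF B] by (intro finite_measure_Union) auto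
  also have "\<dots> = (1 + ?a) * exp (- ?a)"
    using count_poisson[OF B, of 0] count_poisson[OF B, of 1] by (simp add: algebra_simps)
  finally have "prob {\<omega> \<in> space M. 2 \<le> ?N \<omega>} = 1 - (1 + ?a) * exp (- ?a)"
    unfolding eq using count_events[OF B] by (subst prob_compl) auto
  moreover have "(1 + ?a) * (1 - ?a) \<le> (1 + ?a) * exp (- ?a)"
    using a exp_ge_add_one_self[of "- ?a"] by (intro mult_left_mono) auto
  ultimately show ?thesis by (simp add: power2_eq_square algebra_simps)
qed

text \<open>A bounded set is occupied iff its count, being finite, is nonzero, so a pattern is an
  event about independent counts. Independence is given for families indexed by
  \<open>{..<n}\<close>, hence the enumeration \<open>h\<close>.\<close>

lemma prob_occupancy_pattern:
  fixes B :: "'i \<Rightarrow> 'a set"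
  assumes I: "finite I" and B: "\<And>i. i \<in> I \<Longrightarrow> B i \<in> sets borel \<and> B i \<subseteq> S \<and> bounded (B i)"
    and disj: "disjoint_family_on B I"
  shows "prob {\<omega> \<in> space M. \<forall>i\<in>I. (\<Xi> \<omega> \<inter> B i \<noteq> {}) = f i} =
    (\<Prod>i\<in>I. pmf (bernoulli_pmf (1 - exp (- (r * measure lborel (B i))))) (f i))"
proof -
  obtain h where h: "bij_betw h {0..<card I} I" using ex_bij_betw_nat_finite[OF I] by blast
  let ?n = "card I"
  have hI: "h k \<in> I" if "k < ?n" for k using h that by (auto simp: bij_betw_def)
  define A where "A k = {c::nat. (c \<noteq> 0) = f (h k)}" for k
  let ?X = "\<lambda>k \<omega>. card (\<Xi> \<omega> \<inter> B (h k))"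
  have disj': "disjoint_family_on (\<lambda>k. B (h k)) {..<?n}"
    using disj h hI unfolding disjoint_family_on_def bij_betw_def inj_on_def
    by (metis atLeast0LessThan lessThan_iff)
  have indep: "indep_vars (\<lambda>_. count_space UNIV) ?X {..<?n}"
    using B hI disj' by (intro counts_indep) auto
  have ev: "(?X k -` A k \<inter> space M) = {\<omega> \<in> space M. (\<Xi> \<omega> \<inter> B (h k) \<noteq> {}) = f (h k)}" if "k < ?n" for k
    using count_eq_0_iff[of _ "B (h k)"] B[OF hI[OF that]] by (auto simp: A_def)
  have pr: "prob (?X k -` A k \<inter> space M) = pmf (bernoulli_pmf (1 - exp (- (r * measure lborel (B (h k)))))) (f (h k))"
    if "k < ?n" for k
  proof -
    note Bk = B[OF hI[OF that]]
    have p0: "prob {\<omega> \<in> space M. ?X k \<omega> = 0} = exp (- (r * measure lborel (B (h k))))"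
      using count_poisson[of "B (h k)" 0] Bk by simp
    have "0 \<le> r * measure lborel (B (h k))" using intensity_nonneg by simp
    moreover have "{\<omega> \<in> space M. ?X k \<omega> \<noteq> 0} = space M - {\<omega> \<in> space M. ?X k \<omega> = 0}" by auto
    then have "prob {\<omega> \<in> space M. ?X k \<omega> \<noteq> 0} = 1 - prob {\<omega> \<in> space M. ?X k \<omega> = 0}"
      using prob_compl[OF count_events[of "B (h k)" "\<lambda>c. c = 0"]] Bk by simp
    ultimately show ?thesis
      using p0 by (cases "f (h k)") (simp_all add: A_def vimage_def Int_def conj_commute)
  qed
  show ?thesis
  proof (cases "?n = 0")
    case True
    then show ?thesis using I by (simp add: prob_space)
  next
    case False
    have "{\<omega> \<in> space M. \<forall>i\<in>I. (\<Xi> \<omega> \<inter> B i \<noteq> {}) = f i} = (\<Inter>k\<in>{..<?n}. ?X k -` A k \<inter> space M)"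
    proof -
      have "(\<forall>i\<in>I. (\<Xi> \<omega> \<inter> B i \<noteq> {}) = f i) \<longleftrightarrow> (\<forall>k<?n. (\<Xi> \<omega> \<inter> B (h k) \<noteq> {}) = f (h k))" for \<omega>
        using h hI unfolding bij_betw_def by (metis (no_types, lifting) atLeastLessThan_iff imageE)
      then show ?thesis using False ev by auto
    qed
    also have "prob \<dots> = (\<Prod>k\<in>{..<?n}. prob (?X k -` A k \<inter> space M))"
      using False by (intro indep_varsD_finite[OF indep]) auto
    also have "\<dots> = (\<Prod>k\<in>{..<?n}. pmf (bernoulli_pmf (1 - exp (- (r * measure lborel (B (h k)))))) (f (h k)))"
      by (intro prod.cong) (auto simp: pr)
    also have "\<dots> = (\<Prod>i\<in>I. pmf (bernoulli_pmf (1 - exp (- (r * measure lborel (B i))))) (f i))"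
      using h by (intro prod.reindex_bij_betw) (simp add: atLeast0LessThan)
    finally show ?thesis .
  qed
qed

text \<open>\<open>False\<close> outside \<open>I\<close>, to agree with the default value of
  \<open>bernoulli_field\<close>; the laws can then be compared on predicates of the whole
  function.\<close>

definition occupied :: "'i set \<Rightarrow> ('i \<Rightarrow> 'a set) \<Rightarrow> 'w \<Rightarrow> 'i \<Rightarrow> bool" where
  "occupied I B \<omega> = (\<lambda>i. i \<in> I \<and> \<Xi> \<omega> \<inter> B i \<noteq> {})"

text \<open>Only finitely many patterns occur, so an arbitrary \<open>Q\<close> yields a finite
  disjoint union of pattern events, and its probability is a finite sum.\<close>

lemma occupied_law:
  fixes B :: "'i \<Rightarrow> 'a set"
  assumes I: "finite I" and B: "\<And>i. i \<in> I \<Longrightarrow> B i \<in> sets borel \<and> B i \<subseteq> S \<and> bounded (B i)"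
    and disj: "disjoint_family_on B I"
  shows "{\<omega> \<in> space M. Q (occupied I B \<omega>)} \<in> events" (is ?ev)
    and "prob {\<omega> \<in> space M. Q (occupied I B \<omega>)} =
      measure_pmf.prob (bernoulli_field I (\<lambda>i. 1 - exp (- (r * measure lborel (B i))))) {\<zeta>. Q \<zeta>}" (is ?pr)
proof -
  let ?P = "bernoulli_field I (\<lambda>i. 1 - exp (- (r * measure lborel (B i))))"
  define F where "F = {f \<in> PiE_dflt I False (\<lambda>_. UNIV). Q f}"
  define E where "E f = {\<omega> \<in> space M. \<forall>i\<in>I. (\<Xi> \<omega> \<inter> B i \<noteq> {}) = f i}" for f
  have F: "finite F" unfolding F_def using I by (intro finite_subset[OF _ finite_PiE_dflt[of I "\<lambda>_. UNIV" False]]) auto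
  have E_ev: "E f \<in> events" for f
  proof -
    have "{\<omega> \<in> space M. (\<Xi> \<omega> \<inter> B i \<noteq> {}) = f i} \<in> events" if "i \<in> I" for i
    proof -
      have "{\<omega> \<in> space M. (\<Xi> \<omega> \<inter> B i \<noteq> {}) = f i} = {\<omega> \<in> space M. (card (\<Xi> \<omega> \<inter> B i) \<noteq> 0) = f i}"
        using count_eq_0_iff[of _ "B i"] B[OF that] by auto
      then show ?thesis using count_events[of "B i" "\<lambda>c. (c \<noteq> 0) = f i"] B[OF that] by simp
    qed
    then show ?thesis unfolding E_def using I by (intro sets.sets_Collect_finite_All) auto
  qed
  have E_eq: "E f = {\<omega> \<in> space M. occupied I B \<omega> = f}" if "f \<in> F" for f
    using that by (auto simp: E_def F_def occupied_def PiE_dflt_def fun_eq_iff)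
  have "occupied I B \<omega> \<in> PiE_dflt I False (\<lambda>_. UNIV)" for \<omega>
    by (auto simp: occupied_def PiE_dflt_def)
  with E_eq have ev: "{\<omega> \<in> space M. Q (occupied I B \<omega>)} = (\<Union>f\<in>F. E f)"
    by (auto simp: F_def)
  show ?ev unfolding ev by (rule sets.finite_UN[OF F E_ev])
  have "prob (\<Union>f\<in>F. E f) = (\<Sum>f\<in>F. prob (E f))"
  proof (rule finite_measure_finite_Union[OF F])
    show "E ` F \<subseteq> events" using E_ev by blast
    show "disjoint_family_on E F" using E_eq by (auto simp: disjoint_family_on_def)
  qed
  also have "\<dots> = (\<Sum>f\<in>F. pmf ?P f)"
  proof (rule sum.cong)
    fix f assume "f \<in> F"
    then show "prob (E f) = pmf ?P f"
      unfolding E_def using I B disj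
      by (subst prob_occupancy_pattern) (auto simp: pmf_Pi' F_def PiE_dflt_def)
  qed simp
  also have "\<dots> = measure_pmf.prob ?P F" using F by (simp add: measure_measure_pmf_finite)
  also have "\<dots> = measure_pmf.prob ?P {\<zeta>. Q \<zeta>}"
  proof (rule measure_prob_cong_0)
    fix f assume "f \<in> {\<zeta>. Q \<zeta>} - F"
    then show "pmf ?P f = 0" using I by (intro pmf_Pi_outside) (auto simp: F_def PiE_dflt_def)
  qed (auto simp: F_def)
  finally show ?pr using ev by simp
qed

end

section \<open>Parallelograms in the coordinates \<open>w\<close> and \<open>e\<close>\<close>

text \<open>Half-open in both coordinates, so that neighbouring boxes tile without overlap, as
  independence of counts requires.\<close>

definition pbox :: "real \<Rightarrow> real \<Rightarrow> real \<Rightarrow> real \<Rightarrow> real \<Rightarrow> real \<Rightarrow> (real \<times> real) set" where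
  "pbox \<alpha> \<beta> c d e f = {z. snd z - \<alpha> * fst z \<in> {c..<d} \<and> \<beta> * fst z - snd z \<in> {e..<f}}"

lemma pbox_borel [measurable]: "pbox \<alpha> \<beta> c d e f \<in> sets borel"
proof -
  have [measurable]: "fst \<in> borel_measurable (borel :: (real \<times> real) measure)"
    "snd \<in> borel_measurable (borel :: (real \<times> real) measure)"
    by (intro borel_measurable_continuous_onI continuous_intros)+
  have "pbox \<alpha> \<beta> c d e f = {z \<in> space borel. (c \<le> snd z - \<alpha> * fst z \<and> snd z - \<alpha> * fst z < d) \<and>
      (e \<le> \<beta> * fst z - snd z \<and> \<beta> * fst z - snd z < f)}"
    by (auto simp: pbox_def)
  also have "\<dots> \<in> sets borel" by measurable
  finally show ?thesis .
qed

lemma pbox_bounded: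
  assumes "\<alpha> < \<beta>"
  shows "bounded (pbox \<alpha> \<beta> c d e f)"
proof (rule bounded_subset)
  \<comment> \<open>The inverse of the coordinate change, read off from
    \<open>w + e = (\<beta> - \<alpha>) * x\<close> and
    \<open>\<beta> * w + \<alpha> * e = (\<beta> - \<alpha>) * y\<close>.\<close>
  let ?h = "\<lambda>p. ((fst p + snd p) / (\<beta> - \<alpha>), (\<beta> * fst p + \<alpha> * snd p) / (\<beta> - \<alpha>))"
  show "bounded (?h ` ({c..d} \<times> {e..f}))"
    using assms by (intro compact_imp_bounded compact_continuous_image compact_Times) (auto intro!: continuous_intros)
  show "pbox \<alpha> \<beta> c d e f \<subseteq> ?h ` ({c..d} \<times> {e..f})"
  proof
    fix z assume z: "z \<in> pbox \<alpha> \<beta> c d e f"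
    have "z = ?h (snd z - \<alpha> * fst z, \<beta> * fst z - snd z)"
      using assms by (cases z) (simp add: field_simps)
    then show "z \<in> ?h ` ({c..d} \<times> {e..f})"
      by (rule image_eqI) (use z in \<open>auto simp: pbox_def\<close>)
  qed
qed

lemma measure_pbox:
  assumes "\<alpha> < \<beta>" "c \<le> d" "e \<le> f"
  shows "measure lborel (pbox \<alpha> \<beta> c d e f) = (d - c) * (f - e) / (\<beta> - \<alpha>)"
proof -
  define k where "k = \<beta> - \<alpha>"
  have k: "0 < k" using assms by (simp add: k_def)
  let ?g1 = "indicator {c..<d} :: real \<Rightarrow> ennreal" and ?g2 = "indicator {e..<f} :: real \<Rightarrow> ennreal"
  have "emeasure lborel (pbox \<alpha> \<beta> c d e f) =
      (\<integral>\<^sup>+z. indicator (pbox \<alpha> \<beta> c d e f) z \<partial>(lborel \<Otimes>\<^sub>M lborel))"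
    unfolding lborel_prod by simp
  also have "\<dots> = (\<integral>\<^sup>+u. \<integral>\<^sup>+v. indicator (pbox \<alpha> \<beta> c d e f) (u, v) \<partial>lborel \<partial>lborel)"
    by (subst lborel.nn_integral_fst) (auto simp: lborel_prod)
  also have "\<dots> = (\<integral>\<^sup>+u. \<integral>\<^sup>+v. ?g1 (v - \<alpha> * u) * ?g2 (\<beta> * u - v) \<partial>lborel \<partial>lborel)"
    by (intro nn_integral_cong) (auto simp: pbox_def indicator_def)
  \<comment> \<open>For fixed \<open>u\<close> the shift \<open>w = v - \<alpha> * u\<close>
    preserves length and turns \<open>\<beta> * u - v\<close> into \<open>- w + k * u\<close>. After
    the exchange of integrals \<open>u\<close> is scaled by \<open>k\<close>, which produces the
    divisor \<open>\<beta> - \<alpha>\<close>.\<close>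
  also have "\<dots> = (\<integral>\<^sup>+u. \<integral>\<^sup>+w. ?g1 w * ?g2 (- w + k * u) \<partial>lborel \<partial>lborel)"
  proof (rule nn_integral_cong)
    fix u
    show "(\<integral>\<^sup>+v. ?g1 (v - \<alpha> * u) * ?g2 (\<beta> * u - v) \<partial>lborel) = (\<integral>\<^sup>+w. ?g1 w * ?g2 (- w + k * u) \<partial>lborel)"
      by (subst nn_integral_real_affine[where c = 1 and t = "\<alpha> * u"]) (auto simp: k_def algebra_simps)
  qed
  also have "\<dots> = (\<integral>\<^sup>+w. \<integral>\<^sup>+u. ?g1 w * ?g2 (- w + k * u) \<partial>lborel \<partial>lborel)"
    by (rule lborel_pair.Fubini') simp
  also have "\<dots> = (\<integral>\<^sup>+w. ?g1 w * ennreal ((f - e) / k) \<partial>lborel)"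
  proof (rule nn_integral_cong)
    fix w
    have "ennreal (f - e) = (\<integral>\<^sup>+x. ?g2 x \<partial>lborel)" using assms by simp
    also have "\<dots> = ennreal k * (\<integral>\<^sup>+u. ?g2 (- w + k * u) \<partial>lborel)"
      using k by (subst nn_integral_real_affine[where c = k and t = "- w"]) auto
    finally have "ennreal (1 / k) * ennreal (f - e) = ennreal (1 / k) * (ennreal k * (\<integral>\<^sup>+u. ?g2 (- w + k * u) \<partial>lborel))"
      by simp
    also have "\<dots> = (\<integral>\<^sup>+u. ?g2 (- w + k * u) \<partial>lborel)"
      using k by (simp add: mult.assoc[symmetric] flip: ennreal_mult)
    also have "ennreal (1 / k) * ennreal (f - e) = ennreal ((f - e) / k)"
      using k assms by (simp flip: ennreal_mult)
    finally show "(\<integral>\<^sup>+u. ?g1 w * ?g2 (- w + k * u) \<partial>lborel) = ?g1 w * ennreal ((f - e) / k)"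
      by (subst nn_integral_cmult) auto
  qed
  also have "\<dots> = ennreal ((d - c) * (f - e) / k)"
    using assms k by (subst nn_integral_multc) (auto simp flip: ennreal_mult)
  finally show ?thesis using assms k by (simp add: measure_def k_def)
qed

section \<open>Chains in parallelograms\<close>

text \<open>Numbering starts at 1, like the cells of \<open>lpp0\<close>; everything below
  \<open>c\<close> receives number 0 through the truncation in \<open>nat\<close>, hence
  \<open>1 \<le> i\<close> in \<open>strip_iff\<close>.\<close>

definition strip :: "real \<Rightarrow> real \<Rightarrow> nat \<Rightarrow> real \<Rightarrow> nat" where
  "strip c x n w = nat (\<lfloor>(w - c) * n / x\<rfloor> + 1)"

lemma strip_iff:
  assumes "0 < x" "0 < n" "1 \<le> i"
  shows "w \<in> {c + (real i - 1) * x / n..<c + real i * x / n} \<longleftrightarrow> strip c x n w = i"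
proof -
  have "strip c x n w = i \<longleftrightarrow> \<lfloor>(w - c) * n / x\<rfloor> = int i - 1"
    using assms(3) by (auto simp: strip_def)
  also have "\<dots> \<longleftrightarrow> real i - 1 \<le> (w - c) * n / x \<and> (w - c) * n / x < real i"
    by (simp add: floor_eq_iff)
  also have "\<dots> \<longleftrightarrow> w \<in> {c + (real i - 1) * x / n..<c + real i * x / n}"
    using assms(1,2) by (auto simp: field_simps)
  finally show ?thesis ..
qed

lemma strip_range:
  assumes "0 < x" "0 < n" "w \<in> {c..<c + x}"
  shows "strip c x n w \<in> {1..n}"
proof -
  have "(w - c) * n < x * n"
    using assms by (intro mult_strict_right_mono) auto
  then have "0 \<le> (w - c) * n / x" "(w - c) * n / x < n"
    using assms by (simp_all add: divide_less_eq mult.commute)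
  then have "0 \<le> \<lfloor>(w - c) * n / x\<rfloor>" "\<lfloor>(w - c) * n / x\<rfloor> < int n"
    by (simp_all only: zero_le_floor floor_less_iff of_int_of_nat_eq)
  then show ?thesis by (simp add: strip_def nat_le_iff le_nat_iff Suc_le_eq del: zero_le_floor)
qed

lemma strip_mono: "0 < x \<Longrightarrow> w \<le> w' \<Longrightarrow> strip c x n w \<le> strip c x n w'"
  unfolding strip_def by (intro nat_mono add_mono floor_mono divide_right_mono mult_right_mono) auto

definition slope_chain :: "real \<Rightarrow> real \<Rightarrow> (real \<times> real) set \<Rightarrow> (real \<times> real) list \<Rightarrow> bool" where
  "slope_chain \<alpha> \<beta> A ps \<longleftrightarrow> distinct ps \<and> set ps \<subseteq> A \<and> successively (slope_le \<alpha> \<beta>) ps"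

lemma slope_le_iff:
  assumes "\<alpha> < \<beta>"
  shows "slope_le \<alpha> \<beta> p q \<longleftrightarrow>
    snd p - \<alpha> * fst p \<le> snd q - \<alpha> * fst q \<and> \<beta> * fst p - snd p \<le> \<beta> * fst q - snd q"
proof
  assume "snd p - \<alpha> * fst p \<le> snd q - \<alpha> * fst q \<and> \<beta> * fst p - snd p \<le> \<beta> * fst q - snd q"
  \<comment> \<open>The sum of the two inequalities is the order of the first coordinates, scaled by
    \<open>\<beta> - \<alpha>\<close>.\<close>
  moreover from this have "(\<beta> - \<alpha>) * fst p \<le> (\<beta> - \<alpha>) * fst q" by (simp add: algebra_simps)
  with assms have "fst p \<le> fst q" by simp
  ultimately show "slope_le \<alpha> \<beta> p q" by (simp add: slope_le_def algebra_simps)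
qed (simp add: slope_le_def algebra_simps)

lemma transp_slope_le: "\<alpha> < \<beta> \<Longrightarrow> transp (slope_le \<alpha> \<beta>)"
  by (auto simp: transp_def slope_le_iff)

text \<open>Makes distinctness part of a pairwise relation, so that it travels through
  \<open>sorted_wrt\<close> together with the order.\<close>

lemma sorted_wrt_neq_iff: "sorted_wrt (\<lambda>x y. R x y \<and> x \<noteq> y) xs \<longleftrightarrow> distinct xs \<and> sorted_wrt R xs"
  by (induction xs) auto

lemma slope_chain_iff:
  "\<alpha> < \<beta> \<Longrightarrow> slope_chain \<alpha> \<beta> A ps \<longleftrightarrow> distinct ps \<and> set ps \<subseteq> A \<and> sorted_wrt (slope_le \<alpha> \<beta>) ps"
  by (simp add: slope_chain_def successively_conv_sorted_wrt transp_slope_le)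

lemma quarter_plane_borel [measurable]: "quarter_plane \<in> sets borel"
  unfolding quarter_plane_def by (intro borel_closed closed_Times) auto

lemma pbox_subset_quarter_plane:
  assumes "0 \<le> \<alpha>" "\<alpha> < \<beta>" "0 \<le> c" "0 \<le> e"
  shows "pbox \<alpha> \<beta> c d e f \<subseteq> quarter_plane"
proof
  fix z assume "z \<in> pbox \<alpha> \<beta> c d e f"
  then have z: "c \<le> snd z - \<alpha> * fst z" "e \<le> \<beta> * fst z - snd z" by (auto simp: pbox_def)
  then have "0 \<le> (\<beta> - \<alpha>) * fst z" using assms by (simp add: algebra_simps)
  then have "0 \<le> fst z" using assms by (simp add: zero_le_mult_iff)
  moreover from this have "0 \<le> \<alpha> * fst z" using assms by simp
  then have "0 \<le> snd z" using z assms by linarith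
  ultimately show "z \<in> quarter_plane" by (cases z) (auto simp: quarter_plane_def)
qed

lemma measure_Int_pbox_le:
  assumes "\<alpha> < \<beta>" "c \<le> d" "e \<le> f" "A \<in> sets borel"
  shows "measure lborel (pbox \<alpha> \<beta> c d e f \<inter> A) \<le> (d - c) * (f - e) / (\<beta> - \<alpha>)"
proof -
  have "measure lborel (pbox \<alpha> \<beta> c d e f \<inter> A) \<le> measure lborel (pbox \<alpha> \<beta> c d e f)"
    using assms(4) emeasure_bounded_finite[OF pbox_bounded[OF assms(1)], of c d e f]
    by (intro measure_mono_fmeasurable) (auto intro!: fmeasurableI)
  with measure_pbox[OF assms(1-3)] show ?thesis by simp
qed

definition pcell :: "real \<Rightarrow> real \<Rightarrow> real \<Rightarrow> real \<Rightarrow> real \<Rightarrow> real \<Rightarrow> nat \<Rightarrow> nat \<times> nat \<Rightarrow> (real \<times> real) set" where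
  "pcell \<alpha> \<beta> c x e y n = (\<lambda>(i, j). pbox \<alpha> \<beta> (c + (real i - 1) * x / n) (c + real i * x / n)
     (e + (real j - 1) * y / n) (e + real j * y / n))"

lemma pcell_iff:
  assumes "0 < x" "0 < y" "0 < n" "1 \<le> i" "1 \<le> j"
  shows "z \<in> pcell \<alpha> \<beta> c x e y n (i, j) \<longleftrightarrow>
    strip c x n (snd z - \<alpha> * fst z) = i \<and> strip e y n (\<beta> * fst z - snd z) = j"
  by (simp only: pcell_def pbox_def prod.case mem_Collect_eq strip_iff assms)

lemma disjoint_pcell:
  assumes "0 < x" "0 < y" "0 < n"
  shows "disjoint_family_on (\<lambda>c'. pcell \<alpha> \<beta> c x e y n c' \<inter> A) ({1..n} \<times> {1..n})"
proof -
  have "ij = kl" if "ij \<in> {1..n} \<times> {1..n}" "kl \<in> {1..n} \<times> {1..n}"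
    "z \<in> pcell \<alpha> \<beta> c x e y n ij" "z \<in> pcell \<alpha> \<beta> c x e y n kl" for ij kl z
    using that assms by (cases ij; cases kl) (auto simp: pcell_iff)
  then show ?thesis unfolding disjoint_family_on_def by blast
qed

lemma one_minus_exp_le: "0 \<le> x \<Longrightarrow> 1 - exp (- x) \<le> x" for x :: real
  using exp_ge_add_one_self[of "- x"] by linarith

section \<open>Tail bounds for chains in one parallelogram\<close>

locale sloped_poisson_process = homogeneous_poisson_process M quarter_plane 1 \<Xi>
  for M :: "'w measure" and \<Xi> :: "'w \<Rightarrow> (real \<times> real) set" +
  fixes \<alpha> \<beta> :: real
  assumes \<alpha>_nonneg: "0 \<le> \<alpha>" and \<alpha>_less_\<beta>: "\<alpha> < \<beta>"
begin

text \<open>Two distinct points in one strip would contradict its count bound. The coordinate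
  \<open>g\<close> is general in order to serve both families of strips.\<close>

lemma strict_strips:
  fixes g :: "real \<times> real \<Rightarrow> real" and T :: "nat \<Rightarrow> (real \<times> real) set"
  assumes T: "card (\<Xi> \<omega> \<inter> T (strip c x n (g p))) < 2" and fin: "finite (\<Xi> \<omega> \<inter> T (strip c x n (g p)))"
    and "p \<in> \<Xi> \<omega>" "q \<in> \<Xi> \<omega>" "p \<noteq> q" "g p \<le> g q" "0 < x"
    and "p \<in> T (strip c x n (g p))" "q \<in> T (strip c x n (g q))"
  shows "strip c x n (g p) < strip c x n (g q)"
proof (rule ccontr)
  assume "\<not> strip c x n (g p) < strip c x n (g q)"
  with strip_mono[of x "g p" "g q" c n] assms have eq: "strip c x n (g q) = strip c x n (g p)" by auto
  have "card {p, q} \<le> card (\<Xi> \<omega> \<inter> T (strip c x n (g p)))"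
    using assms eq fin by (intro card_mono) auto
  with T \<open>p \<noteq> q\<close> show False by simp
qed

text \<open>Unless some strip holds two points, a chain visits strictly increasing cells and is
  bounded by their passage time. The box may stick out of the quarter-plane, so cells are clipped
  and merely dominated by the nominal Bernoulli field.\<close>

lemma box_upper_tail:
  fixes c d e f \<rho> A :: real
  assumes cd: "c < d" and ef: "e < f" and \<rho>: "0 < \<rho>"
  defines "A \<equiv> (d - c) * (f - e) / (\<beta> - \<alpha>)"
  shows "\<exists>E\<in>events. prob E \<le> 4 * sqrt A / \<rho>\<^sup>2 \<and>
    (\<forall>\<omega>\<in>space M - E. \<forall>ps. slope_chain \<alpha> \<beta> (\<Xi> \<omega> \<inter> pbox \<alpha> \<beta> c d e f) ps \<longrightarrow>
       length ps < 2 * sqrt A + 2 * \<rho>)"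
proof -
  define x y where "x = d - c" and "y = f - e"
  have xy: "0 < x" "0 < y" using cd ef by (auto simp: x_def y_def)
  have k: "0 < \<beta> - \<alpha>" using \<alpha>_less_\<beta> by simp
  have A: "0 < A" "A = x * y / (\<beta> - \<alpha>)" using xy k by (auto simp: A_def x_def y_def)
  \<comment> \<open>Half of the allowed probability: one share for the tail of the passage time, one
    for strips with two points.\<close>
  define \<epsilon> where "\<epsilon> = 2 * sqrt A / \<rho>\<^sup>2"
  have \<epsilon>: "0 < \<epsilon>" using A \<rho> by (simp add: \<epsilon>_def)
  \<comment> \<open>\<open>2 * A\<^sup>2 / n\<close> bounds the probability that one of the
    \<open>2 * n\<close> strips, each of area at most \<open>A / n\<close>, holds two
    points.\<close>
  obtain n :: nat where "2 * A\<^sup>2 / \<epsilon> < n" using reals_Archimedean2 by blast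
  moreover have "0 < 2 * A\<^sup>2 / \<epsilon>" using A(1) \<epsilon> by (intro divide_pos_pos mult_pos_pos zero_less_power) auto
  ultimately have n: "0 < n" "2 * A\<^sup>2 / n < \<epsilon>"
    using \<epsilon> by (auto simp: divide_less_eq mult.commute intro!: gr0I)
  define I where "I = {1..n} \<times> {1..n}"
  define B where "B = (\<lambda>ij. pcell \<alpha> \<beta> c x e y n ij \<inter> quarter_plane)"
  \<comment> \<open>Full strips rather than cells: strictness is required in each coordinate
    separately, so two points that share only a strip already do harm.\<close>
  define H where "H i = pbox \<alpha> \<beta> (c + (real i - 1) * x / n) (c + real i * x / n) e f \<inter> quarter_plane" for i :: nat
  define V where "V j = pbox \<alpha> \<beta> c d (e + (real j - 1) * y / n) (e + real j * y / n) \<inter> quarter_plane" for j :: nat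
  define p where "p = 1 - exp (- (A / n\<^sup>2))"
  have p: "0 \<le> p" "p \<le> 1" "p \<le> A / n\<^sup>2"
    using A(1) one_minus_exp_le[of "A / n\<^sup>2"] by (auto simp: p_def)
  have B: "B ij \<in> sets borel \<and> B ij \<subseteq> quarter_plane \<and> bounded (B ij)" for ij
    using pbox_bounded[OF \<alpha>_less_\<beta>] by (auto simp: B_def pcell_def split: prod.splits intro: bounded_Int)
  have H: "H i \<in> sets borel" "H i \<subseteq> quarter_plane" "bounded (H i)" for i
    using pbox_bounded[OF \<alpha>_less_\<beta>] by (auto simp: H_def intro: bounded_Int)
  have V: "V i \<in> sets borel" "V i \<subseteq> quarter_plane" "bounded (V i)" for i
    using pbox_bounded[OF \<alpha>_less_\<beta>] by (auto simp: V_def intro: bounded_Int)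
  have B_le: "measure lborel (B ij) \<le> A / n\<^sup>2" for ij
  proof -
    obtain i j where ij: "ij = (i, j)" by (cases ij)
    have "measure lborel (B ij) \<le> (c + real i * x / n - (c + (real i - 1) * x / n)) *
        (e + real j * y / n - (e + (real j - 1) * y / n)) / (\<beta> - \<alpha>)"
      unfolding B_def ij pcell_def prod.case using xy \<alpha>_less_\<beta>
      by (intro measure_Int_pbox_le) (auto intro!: divide_right_mono)
    also have "\<dots> = (x / n) * (y / n) / (\<beta> - \<alpha>)"
      by (simp add: diff_divide_distrib left_diff_distrib)
    finally show ?thesis by (simp add: A(2) power2_eq_square mult.commute)
  qed
  have H_le: "prob {\<omega> \<in> space M. 2 \<le> card (\<Xi> \<omega> \<inter> H i)} \<le> (A / n)\<^sup>2" for i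
  proof -
    have "measure lborel (H i) \<le> (c + real i * x / n - (c + (real i - 1) * x / n)) * (f - e) / (\<beta> - \<alpha>)"
      unfolding H_def using xy \<alpha>_less_\<beta> ef by (intro measure_Int_pbox_le) (auto intro!: divide_right_mono)
    also have "\<dots> = (x / n) * y / (\<beta> - \<alpha>)"
      by (simp add: diff_divide_distrib left_diff_distrib y_def)
    finally have "1 * measure lborel (H i) \<le> A / n" by (simp add: A(2) mult.commute)
    then have "(1 * measure lborel (H i))\<^sup>2 \<le> (A / n)\<^sup>2" by (intro power_mono) auto
    with prob_count_ge_2[OF H, of i] show ?thesis by linarith
  qed
  have V_le: "prob {\<omega> \<in> space M. 2 \<le> card (\<Xi> \<omega> \<inter> V j)} \<le> (A / n)\<^sup>2" for j
  proof -
    have "measure lborel (V j) \<le> (d - c) * (e + real j * y / n - (e + (real j - 1) * y / n)) / (\<beta> - \<alpha>)"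
      unfolding V_def using xy \<alpha>_less_\<beta> cd by (intro measure_Int_pbox_le) (auto intro!: divide_right_mono)
    also have "\<dots> = x * (y / n) / (\<beta> - \<alpha>)"
      by (simp add: diff_divide_distrib left_diff_distrib x_def)
    finally have "1 * measure lborel (V j) \<le> A / n" by (simp add: A(2) mult.commute)
    then have "(1 * measure lborel (V j))\<^sup>2 \<le> (A / n)\<^sup>2" by (intro power_mono) auto
    with prob_count_ge_2[OF V, of j] show ?thesis by linarith
  qed
  define E1 where "E1 = {\<omega> \<in> space M. 2 * sqrt A + 2 * \<rho> \<le> lpp0 (occupied I B \<omega>) n n}"
  define E2 where "E2 = (\<Union>i\<in>{1..n}. {\<omega> \<in> space M. 2 \<le> card (\<Xi> \<omega> \<inter> H i)} \<union> {\<omega> \<in> space M. 2 \<le> card (\<Xi> \<omega> \<inter> V i)})"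
  have disj: "disjoint_family_on B I"
    unfolding I_def B_def by (rule disjoint_pcell[OF xy n(1)])
  have finI: "finite I" by (simp add: I_def)
  have law: "{\<omega> \<in> space M. Q (occupied I B \<omega>)} \<in> events"
    "prob {\<omega> \<in> space M. Q (occupied I B \<omega>)} =
      measure_pmf.prob (bernoulli_field I (\<lambda>i. 1 - exp (- (1 * measure lborel (B i))))) {\<zeta>. Q \<zeta>}" for Q
    using occupied_law[OF finI B disj, of Q] by simp_all
  have E1: "E1 \<in> events" unfolding E1_def by (rule law)
  have E2: "E2 \<in> events" unfolding E2_def
    by (intro sets.finite_UN sets.Un count_events H V) auto
  have "prob E1 = measure_pmf.prob (bernoulli_field I (\<lambda>i. 1 - exp (- (1 * measure lborel (B i)))))
      {\<zeta>. 2 * sqrt A + 2 * \<rho> \<le> lpp0 \<zeta> n n}"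
    unfolding E1_def by (rule law)
  also have "\<dots> \<le> measure_pmf.prob (bernoulli_field I (\<lambda>_. p)) {\<zeta>. 2 * sqrt A + 2 * \<rho> \<le> lpp0 \<zeta> n n}"
  proof (rule bernoulli_field_prob_mono)
    fix \<zeta> \<zeta>' :: "nat \<times> nat \<Rightarrow> bool" assume *: "2 * sqrt A + 2 * \<rho> \<le> lpp0 \<zeta> n n" "\<And>c. \<zeta> c \<Longrightarrow> \<zeta>' c"
    then have "lpp0 \<zeta> n n \<le> lpp0 \<zeta>' n n" by (intro lpp_mono) auto
    then have "real (lpp0 \<zeta> n n) \<le> lpp0 \<zeta>' n n" by simp
    with * show "2 * sqrt A + 2 * \<rho> \<le> lpp0 \<zeta>' n n" by linarith
  qed (use B_le in \<open>auto simp: I_def p_def\<close>)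
  also have "\<dots> \<le> measure_pmf.prob (bernoulli_field I (\<lambda>_. p)) {\<zeta>. 2 * sqrt (p * n * n) + 2 * \<rho> \<le> lpp0 \<zeta> n n}"
  proof -
    have "p * n * n \<le> A" using p(3) n by (simp add: field_simps power2_eq_square)
    then have "sqrt (p * n * n) \<le> sqrt A" by simp
    then show ?thesis by (intro measure_pmf.finite_measure_mono) (auto simp del: real_sqrt_le_iff)
  qed
  also have "\<dots> \<le> 2 * sqrt (p * n * n) / \<rho>\<^sup>2"
    unfolding I_def using p \<rho> by (intro lpp0_upper_tail)
  also have "\<dots> \<le> \<epsilon>"
  proof -
    have "p * n * n \<le> A" using p(3) n by (simp add: field_simps power2_eq_square)
    then show ?thesis unfolding \<epsilon>_def by (intro divide_right_mono) auto
  qed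
  finally have E1_le: "prob E1 \<le> \<epsilon>" .
  have "prob E2 \<le> (\<Sum>i\<in>{1..n}. prob ({\<omega> \<in> space M. 2 \<le> card (\<Xi> \<omega> \<inter> H i)} \<union> {\<omega> \<in> space M. 2 \<le> card (\<Xi> \<omega> \<inter> V i)}))"
    unfolding E2_def by (intro measure_UNION_le sets.Un count_events H V) auto
  also have "\<dots> \<le> (\<Sum>i\<in>{1..n}. 2 * (A / n)\<^sup>2)"
  proof (rule sum_mono)
    fix i
    have "prob ({\<omega> \<in> space M. 2 \<le> card (\<Xi> \<omega> \<inter> H i)} \<union> {\<omega> \<in> space M. 2 \<le> card (\<Xi> \<omega> \<inter> V i)}) \<le>
       prob {\<omega> \<in> space M. 2 \<le> card (\<Xi> \<omega> \<inter> H i)} + prob {\<omega> \<in> space M. 2 \<le> card (\<Xi> \<omega> \<inter> V i)}"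
      by (intro measure_Un_le count_events H V)
    with H_le[of i] V_le[of i]
    show "prob ({\<omega> \<in> space M. 2 \<le> card (\<Xi> \<omega> \<inter> H i)} \<union> {\<omega> \<in> space M. 2 \<le> card (\<Xi> \<omega> \<inter> V i)}) \<le> 2 * (A / n)\<^sup>2"
      by linarith
  qed
  also have "\<dots> = 2 * A\<^sup>2 / n" using n by (simp add: power2_eq_square)
  finally have E2_le: "prob E2 \<le> \<epsilon>" using n by linarith
  have "prob (E1 \<union> E2) \<le> prob E1 + prob E2" by (rule measure_Un_le[OF E1 E2])
  with E1_le E2_le have "prob (E1 \<union> E2) \<le> 4 * sqrt A / \<rho>\<^sup>2" by (simp add: \<epsilon>_def)
  moreover have "length ps < 2 * sqrt A + 2 * \<rho>"
    if \<omega>: "\<omega> \<in> space M - (E1 \<union> E2)" and ps: "slope_chain \<alpha> \<beta> (\<Xi> \<omega> \<inter> pbox \<alpha> \<beta> c d e f) ps" for \<omega> ps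
  proof -
    let ?T1 = "\<lambda>z::real \<times> real. snd z - \<alpha> * fst z" and ?T2 = "\<lambda>z::real \<times> real. \<beta> * fst z - snd z"
    define \<iota> where "\<iota> z = (strip c x n (?T1 z), strip e y n (?T2 z))" for z
    have psd: "distinct ps" "set ps \<subseteq> \<Xi> \<omega> \<inter> pbox \<alpha> \<beta> c d e f" "sorted_wrt (slope_le \<alpha> \<beta>) ps"
      using ps \<alpha>_less_\<beta> by (auto simp: slope_chain_iff)
    have in_ps: "z \<in> \<Xi> \<omega>" "z \<in> quarter_plane" "strip c x n (?T1 z) \<in> {1..n}" "strip e y n (?T2 z) \<in> {1..n}"
      "z \<in> H (strip c x n (?T1 z))" "z \<in> V (strip e y n (?T2 z))" if "z \<in> set ps" for z
    proof -
      show z: "z \<in> \<Xi> \<omega>" "z \<in> quarter_plane" using that psd points_in_S[of \<omega>] \<omega> by auto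
      have zb: "z \<in> pbox \<alpha> \<beta> c d e f" using that psd by auto
      show s: "strip c x n (?T1 z) \<in> {1..n}" "strip e y n (?T2 z) \<in> {1..n}"
        using zb strip_range[OF xy(1) n(1), of "?T1 z" c] strip_range[OF xy(2) n(1), of "?T2 z" e]
        by (simp_all add: pbox_def x_def y_def)
      show "z \<in> H (strip c x n (?T1 z))"
        using zb z strip_iff[of x n "strip c x n (?T1 z)" "?T1 z" c] s xy n by (auto simp: H_def pbox_def)
      show "z \<in> V (strip e y n (?T2 z))"
        using zb z strip_iff[of y n "strip e y n (?T2 z)" "?T2 z" e] s xy n by (auto simp: V_def pbox_def)
    qed
    have few: "card (\<Xi> \<omega> \<inter> H i) < 2" "card (\<Xi> \<omega> \<inter> V i) < 2" if "i \<in> {1..n}" for i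
      using \<omega> that by (auto simp: E2_def not_le)
    have fin: "finite (\<Xi> \<omega> \<inter> H i)" "finite (\<Xi> \<omega> \<inter> V i)" for i
      using \<omega> H V by (auto intro: locally_finite)
    have "sorted_wrt (\<lambda>p q. slope_le \<alpha> \<beta> p q \<and> p \<noteq> q) ps"
      using psd by (simp only: sorted_wrt_neq_iff)
    then have "sorted_wrt (\<lambda>p q. strictly_below (\<iota> p) (\<iota> q)) ps"
    proof (rule sorted_wrt_mono_rel[rotated])
      fix p q assume pq: "p \<in> set ps" "q \<in> set ps" "slope_le \<alpha> \<beta> p q \<and> p \<noteq> q"
      then have le: "?T1 p \<le> ?T1 q" "?T2 p \<le> ?T2 q" using \<alpha>_less_\<beta> by (auto simp: slope_le_iff)
      show "strictly_below (\<iota> p) (\<iota> q)"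
        unfolding strictly_below_def \<iota>_def fst_conv snd_conv
        using pq in_ps[of p] in_ps[of q] few fin le xy
        by (auto intro!: strict_strips[where T = H and g = ?T1] strict_strips[where T = V and g = ?T2])
    qed
    then have "sorted_wrt strictly_below (map \<iota> ps)" by (simp add: sorted_wrt_map)
    moreover have "set (map \<iota> ps) \<subseteq> {1..n} \<times> {1..n}" using in_ps by (auto simp: \<iota>_def)
    moreover have "occupied I B \<omega> ij" if "ij \<in> set (map \<iota> ps)" for ij
    proof -
      from that obtain z where z: "z \<in> set ps" "ij = \<iota> z" by auto
      then have "z \<in> B ij" using in_ps[of z] xy n by (auto simp: B_def \<iota>_def pcell_iff)
      with z in_ps[of z] show ?thesis by (auto simp: occupied_def I_def \<iota>_def)
    qed
    ultimately have "length (map \<iota> ps) \<le> lpp0 (occupied I B \<omega>) n n"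
      by (rule length_chain_le_lpp0)
    moreover have "lpp0 (occupied I B \<omega>) n n < 2 * sqrt A + 2 * \<rho>"
      using \<omega> by (auto simp: E1_def)
    ultimately show ?thesis by simp
  qed
  ultimately show ?thesis using E1 E2 by (intro bexI[of _ "E1 \<union> E2"]) auto
qed

text \<open>One point is picked in each cell of an optimal strict chain; strictly increasing cells
  force strictly increasing coordinates, so no coincidences have to be excluded. A box with its
  corner at the origin lies in the quarter-plane, which makes all cell areas exact. \<open>K\<close>
  must not depend on the box, so that the bounds can be summed over dilations.\<close>

lemma box_lower_tail:
  assumes \<eta>: "0 < \<eta>" "\<eta> \<le> 1 / 36"
  shows "\<exists>K. \<forall>d f A. 0 < d \<and> 0 < f \<and> A = d * f / (\<beta> - \<alpha>) \<longrightarrow> (\<exists>E\<in>events. prob E \<le> K / sqrt A \<and>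
    (\<forall>\<omega>\<in>space M - E. \<exists>ps. slope_chain \<alpha> \<beta> (\<Xi> \<omega> \<inter> pbox \<alpha> \<beta> 0 d 0 f) ps \<and>
       (2 - 14 * sqrt \<eta>) * sqrt A \<le> length ps))"
proof -
  obtain J :: nat where "1 / \<eta> < J" using reals_Archimedean2 by blast
  moreover have "1 < 1 / \<eta>" using \<eta> by simp
  ultimately have "1 < real J" by linarith
  then have J: "1 \<le> J" "1 / J \<le> \<eta>" using \<eta> \<open>1 / \<eta> < J\<close> by (auto simp: field_simps)
  define K where "K = 2 * (8 * J + 10) / \<eta>\<^sup>2"
  have "\<exists>E\<in>events. prob E \<le> K / sqrt A \<and>
    (\<forall>\<omega>\<in>space M - E. \<exists>ps. slope_chain \<alpha> \<beta> (\<Xi> \<omega> \<inter> pbox \<alpha> \<beta> 0 d 0 f) ps \<and>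
       (2 - 14 * sqrt \<eta>) * sqrt A \<le> length ps)"
    if df: "0 < d" "0 < f" and A_eq: "A = d * f / (\<beta> - \<alpha>)" for d f A
  proof -
    have A: "0 < A" using df \<alpha>_less_\<beta> by (simp add: A_eq)
    \<comment> \<open>Fine enough for the cell area \<open>x\<close> below to satisfy
      \<open>sqrt x \<le> \<eta>\<close>; then \<open>p = 1 - exp (- x)\<close> is at least
      \<open>(1 - \<eta>)\<^sup>2 * x\<close>.\<close>
    obtain q :: nat where q: "sqrt A / \<eta> < q" using reals_Archimedean2 by blast
    have "0 < sqrt A / \<eta>" using A \<eta> by simp
    with q have q1: "1 \<le> q" by (auto intro: gr0I)
    define n where "n = J * q"
    have n: "0 < n" using J q1 by (simp add: n_def)
    have "q \<le> n" using J by (simp add: n_def)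
    with q have "sqrt A / \<eta> \<le> n" by linarith
    then have "sqrt A / n \<le> \<eta>" using \<eta> n by (simp add: field_simps)
    define x where "x = A / n\<^sup>2"
    have x: "0 < x" "sqrt x \<le> \<eta>"
      using A n \<open>sqrt A / n \<le> \<eta>\<close> by (auto simp: x_def real_sqrt_divide)
    define p where "p = 1 - exp (- x)"
    have p: "0 < p" "p \<le> 1" "p \<le> x" using x one_minus_exp_le[of x] by (auto simp: p_def)
    have sp: "sqrt p \<le> \<eta>" using x p(3) real_sqrt_le_mono[OF p(3)] by linarith
    define s where "s = n * sqrt p"
    have "exp (- x) \<le> 1 / (1 + x)"
      using exp_ge_add_one_self[of x] x by (simp add: exp_minus field_simps)
    then have "x / (1 + x) \<le> p" using x by (simp add: p_def field_simps)
    moreover have "x \<le> \<eta>\<^sup>2" using x by (metis less_imp_le real_sqrt_le_iff real_sqrt_abs abs_of_pos \<eta>(1))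
    moreover have "(1 - \<eta>)\<^sup>2 * (1 + \<eta>\<^sup>2) \<le> 1"
    proof -
      have "\<eta>\<^sup>2 \<le> \<eta>" using \<eta> by (simp add: power2_eq_square)
      then have "(1 - \<eta>) * (1 + \<eta>\<^sup>2) \<le> (1 - \<eta>) * (1 + \<eta>)" using \<eta> by (intro mult_left_mono) auto
      also have "\<dots> \<le> 1" by (simp add: algebra_simps)
      finally have "(1 - \<eta>) * ((1 - \<eta>) * (1 + \<eta>\<^sup>2)) \<le> 1 * 1" using \<eta> by (intro mult_mono) auto
      then show ?thesis by (simp add: power2_eq_square mult.assoc)
    qed
    ultimately have "(1 - \<eta>)\<^sup>2 * x \<le> p"
    proof -
      have "(1 - \<eta>)\<^sup>2 * (1 + x) \<le> (1 - \<eta>)\<^sup>2 * (1 + \<eta>\<^sup>2)" using \<open>x \<le> \<eta>\<^sup>2\<close> by (intro mult_left_mono) auto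
      also note \<open>\<dots> \<le> 1\<close>
      finally have "x * ((1 - \<eta>)\<^sup>2 * (1 + x)) \<le> x * 1" using x by (intro mult_left_mono) auto
      then have "(1 - \<eta>)\<^sup>2 * x \<le> x / (1 + x)" using x by (simp add: le_divide_eq mult_ac)
      with \<open>x / (1 + x) \<le> p\<close> show ?thesis by linarith
    qed
    then have "sqrt ((1 - \<eta>)\<^sup>2 * x) \<le> sqrt p" by simp
    then have "(1 - \<eta>) * sqrt x \<le> sqrt p" using \<eta> by (simp add: real_sqrt_mult)
    then have "n * ((1 - \<eta>) * sqrt x) \<le> s" unfolding s_def by (intro mult_left_mono) auto
    then have s_ge: "(1 - \<eta>) * sqrt A \<le> s" using n by (simp add: x_def real_sqrt_divide)
    have sA: "sqrt A / 2 \<le> s"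
    proof -
      have "(1 / 2) * sqrt A \<le> (1 - \<eta>) * sqrt A" using \<eta> A by (intro mult_right_mono) auto
      with s_ge show ?thesis by simp
    qed
    have s0: "0 < s" using n p by (simp add: s_def)

    define I where "I = {1..n} \<times> {1..n}"
    \<comment> \<open>Intersecting with \<open>UNIV\<close> brings the cells into the shape of
      \<open>disjoint_pcell\<close>.\<close>
    define B where "B = (\<lambda>ij. pcell \<alpha> \<beta> 0 d 0 f n ij \<inter> UNIV)"
    have B_sub: "B (i, j) \<subseteq> pbox \<alpha> \<beta> 0 d 0 f" if "i \<in> {1..n}" "j \<in> {1..n}" for i j
    proof -
      have "real i * d / n \<le> d" "real j * f / n \<le> f"
        using that df n by (auto simp: divide_le_eq mult.commute)
      moreover have "0 \<le> (real i - 1) * d / n" "0 \<le> (real j - 1) * f / n"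
        using that df by auto
      ultimately show ?thesis by (auto simp: B_def pcell_def pbox_def)
    qed
    have B: "B ij \<in> sets borel \<and> B ij \<subseteq> quarter_plane \<and> bounded (B ij)" if "ij \<in> I" for ij
    proof -
      have "B ij \<subseteq> quarter_plane"
        using B_sub pbox_subset_quarter_plane[OF \<alpha>_nonneg \<alpha>_less_\<beta>, of 0 0 d f] that by (fastforce simp: I_def)
      then show ?thesis using pbox_bounded[OF \<alpha>_less_\<beta>] by (auto simp: B_def pcell_def split: prod.splits)
    qed
    have B_eq: "measure lborel (B ij) = x" for ij
    proof -
      obtain i j where ij: "ij = (i, j)" by (cases ij)
      have "measure lborel (B ij) = (0 + real i * d / n - (0 + (real i - 1) * d / n)) *
          (0 + real j * f / n - (0 + (real j - 1) * f / n)) / (\<beta> - \<alpha>)"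
        unfolding B_def ij pcell_def prod.case Int_UNIV_right using df \<alpha>_less_\<beta>
        by (intro measure_pbox) (auto intro!: divide_right_mono)
      also have "\<dots> = (d / n) * (f / n) / (\<beta> - \<alpha>)"
        by (simp add: diff_divide_distrib left_diff_distrib)
      finally show ?thesis by (simp add: A_eq x_def power2_eq_square mult.commute)
    qed
    define E where "E = {\<omega> \<in> space M. lpp0 (occupied I B \<omega>) n n < (2 - 12 * sqrt \<eta>) * s}"
    have disj: "disjoint_family_on B I"
      unfolding I_def B_def by (rule disjoint_pcell[OF df n])
    have finI: "finite I" by (simp add: I_def)
    have law: "{\<omega> \<in> space M. Q (occupied I B \<omega>)} \<in> events"
      "prob {\<omega> \<in> space M. Q (occupied I B \<omega>)} =
        measure_pmf.prob (bernoulli_field I (\<lambda>i. 1 - exp (- (1 * measure lborel (B i))))) {\<zeta>. Q \<zeta>}" for Q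
      using occupied_law[OF finI B disj, of Q] by simp_all
    have E: "E \<in> events" unfolding E_def by (rule law)
    have "prob E = measure_pmf.prob (bernoulli_field I (\<lambda>_. p)) {\<zeta>. lpp0 \<zeta> n n < (2 - 12 * sqrt \<eta>) * s}"
      unfolding E_def p_def by (subst law(2)) (simp add: B_eq)
    also have "\<dots> \<le> (8 * J + 10) / (\<eta>\<^sup>2 * s)"
      unfolding I_def using p sp \<eta> J q1 by (intro lpp0_lower_tail[OF _ _ _ _ _ _ _ _ n_def s_def]) auto
    also have "\<dots> \<le> (8 * J + 10) / (\<eta>\<^sup>2 * (sqrt A / 2))"
      using sA A \<eta> s0 by (intro divide_left_mono mult_left_mono mult_pos_pos) auto
    also have "\<dots> = K / sqrt A" by (simp add: K_def field_simps)
    finally have "prob E \<le> K / sqrt A" .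
    moreover have "\<exists>ps. slope_chain \<alpha> \<beta> (\<Xi> \<omega> \<inter> pbox \<alpha> \<beta> 0 d 0 f) ps \<and> (2 - 14 * sqrt \<eta>) * sqrt A \<le> length ps"
      if \<omega>: "\<omega> \<in> space M - E" for \<omega>
    proof -
      obtain cs where cs: "sorted_wrt strictly_below cs" "set cs \<subseteq> {1..n} \<times> {1..n}"
        "\<forall>c\<in>set cs. occupied I B \<omega> c" "length cs = lpp0 (occupied I B \<omega>) n n"
        using lpp0_attained by blast
      then have "\<forall>c\<in>set cs. \<exists>z. z \<in> \<Xi> \<omega> \<inter> B c" by (auto simp: occupied_def)
      then obtain h where h: "\<And>c. c \<in> set cs \<Longrightarrow> h c \<in> \<Xi> \<omega> \<inter> B c" by metis
      have below: "snd (h c) - \<alpha> * fst (h c) < snd (h c') - \<alpha> * fst (h c') \<and>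
          \<beta> * fst (h c) - snd (h c) < \<beta> * fst (h c') - snd (h c')"
        if "c \<in> set cs" "c' \<in> set cs" "strictly_below c c'" for c c'
      proof -
        have "strip 0 d n (snd (h c) - \<alpha> * fst (h c)) < strip 0 d n (snd (h c') - \<alpha> * fst (h c'))"
          "strip 0 f n (\<beta> * fst (h c) - snd (h c)) < strip 0 f n (\<beta> * fst (h c') - snd (h c'))"
          using that h[of c] h[of c'] cs(2) df n
          by (cases c; cases c'; force simp: B_def pcell_iff strictly_below_def)+
        then show ?thesis
          using strip_mono[OF df(1)] strip_mono[OF df(2)] by (meson leD leI)
      qed
      have "sorted_wrt (\<lambda>p q. slope_le \<alpha> \<beta> p q \<and> p \<noteq> q) (map h cs)"
        unfolding sorted_wrt_map
        by (rule sorted_wrt_mono_rel[OF _ cs(1)]) (use below \<alpha>_less_\<beta> in \<open>force simp: slope_le_iff\<close>)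
      then have "sorted_wrt (slope_le \<alpha> \<beta>) (map h cs)" "distinct (map h cs)"
        by (simp_all only: sorted_wrt_neq_iff)
      moreover have "set (map h cs) \<subseteq> \<Xi> \<omega> \<inter> pbox \<alpha> \<beta> 0 d 0 f"
      proof
        fix z assume "z \<in> set (map h cs)"
        then obtain i j where ij: "(i, j) \<in> set cs" "z = h (i, j)" by auto
        with cs(2) have "i \<in> {1..n}" "j \<in> {1..n}" by auto
        with B_sub[OF this] h[OF ij(1)] ij(2) show "z \<in> \<Xi> \<omega> \<inter> pbox \<alpha> \<beta> 0 d 0 f" by blast
      qed
      ultimately have "slope_chain \<alpha> \<beta> (\<Xi> \<omega> \<inter> pbox \<alpha> \<beta> 0 d 0 f) (map h cs)"
        using \<alpha>_less_\<beta> by (simp add: slope_chain_iff)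
      moreover have "(2 - 14 * sqrt \<eta>) * sqrt A \<le> length (map h cs)"
      proof -
        \<comment> \<open>The bound \<open>\<eta> \<le> 1 / 36\<close> makes
          \<open>2 - 12 * sqrt \<eta>\<close> nonnegative, so \<open>s\<close> may be replaced by
          its lower bound \<open>(1 - \<eta>) * sqrt A\<close>; the factor \<open>1 - \<eta>\<close>
          costs the further \<open>2 * sqrt \<eta>\<close>.\<close>
        have "sqrt \<eta> \<le> sqrt (1 / 36)" using \<eta> by simp
        also have "sqrt (1 / 36) = 1 / 6" by (simp add: real_sqrt_divide)
        finally have s6: "sqrt \<eta> \<le> 1 / 6" .
        have "\<eta> = sqrt \<eta> * sqrt \<eta>" using \<eta> by simp
        also have "\<dots> \<le> 1 * sqrt \<eta>" using s6 \<eta> by (intro mult_right_mono) auto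
        finally have "2 * \<eta> - 12 * sqrt \<eta> * \<eta> \<le> 2 * sqrt \<eta>" using \<eta> by (smt (verit) mult_nonneg_nonneg real_sqrt_ge_zero)
        then have "2 - 14 * sqrt \<eta> \<le> (2 - 12 * sqrt \<eta>) * (1 - \<eta>)" by (simp add: algebra_simps)
        then have "(2 - 14 * sqrt \<eta>) * sqrt A \<le> (2 - 12 * sqrt \<eta>) * (1 - \<eta>) * sqrt A"
          using A by (intro mult_right_mono) auto
        also have "\<dots> \<le> (2 - 12 * sqrt \<eta>) * s"
          unfolding mult.assoc using s_ge s6 by (intro mult_left_mono) auto
        also have "\<dots> \<le> lpp0 (occupied I B \<omega>) n n" using \<omega> by (auto simp: E_def)
        finally show ?thesis using cs(4) by simp
      qed
      ultimately show ?thesis by blast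
    qed
    ultimately show ?thesis using E by blast
  qed
  then show ?thesis by blast
qed

end

section \<open>Almost sure bounds and the limit\<close>

lemma summable_inverse_Suc_squares: "summable (\<lambda>k. C / (real (Suc k))\<^sup>2)"
proof -
  have "summable (\<lambda>k. 1 / real k ^ 2)"
    using inverse_power_summable[of 2, where 'a = real] by (simp add: divide_inverse)
  then have "summable (\<lambda>k. 1 / real (Suc k) ^ 2)" by (subst summable_Suc_iff)
  then show ?thesis using summable_mult[of _ C] by fastforce
qed

context sloped_poisson_process
begin

lemma AE_box_upper:
  fixes c d e f \<epsilon> :: real
  assumes cd: "c < d" and ef: "e < f" and \<epsilon>: "0 < \<epsilon>"
  shows "AE \<omega> in M. \<forall>\<^sub>F k in sequentially. \<forall>ps.
    slope_chain \<alpha> \<beta> (\<Xi> \<omega> \<inter> pbox \<alpha> \<beta> (c * (real (Suc k))\<^sup>2) (d * (real (Suc k))\<^sup>2) (e * (real (Suc k))\<^sup>2) (f * (real (Suc k))\<^sup>2)) ps \<longrightarrow>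
    length ps \<le> (2 * sqrt ((d - c) * (f - e) / (\<beta> - \<alpha>)) + \<epsilon>) * (real (Suc k))\<^sup>2"
proof -
  define s where "s k = (real (Suc k))\<^sup>2" for k
  have s: "0 < s k" for k by (simp add: s_def)
  define A where "A = (d - c) * (f - e) / (\<beta> - \<alpha>)"
  have A: "0 < A" using cd ef \<alpha>_less_\<beta> by (simp add: A_def)
  have A_scale: "sqrt ((d * s k - c * s k) * (f * s k - e * s k) / (\<beta> - \<alpha>)) = sqrt A * s k" for k
  proof -
    have "(d * s k - c * s k) * (f * s k - e * s k) / (\<beta> - \<alpha>) = A * (s k)\<^sup>2"
      by (simp add: A_def power2_eq_square algebra_simps)
    then show ?thesis using s[of k] by (simp add: real_sqrt_mult)
  qed
  have ex: "\<exists>E. E \<in> events \<and> prob E \<le> (16 * sqrt A / \<epsilon>\<^sup>2) / s k \<and>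
    (\<forall>\<omega>\<in>space M - E. \<forall>ps. slope_chain \<alpha> \<beta> (\<Xi> \<omega> \<inter> pbox \<alpha> \<beta> (c * s k) (d * s k) (e * s k) (f * s k)) ps \<longrightarrow>
       length ps < (2 * sqrt A + \<epsilon>) * s k)" for k
  proof -
    \<comment> \<open>The choice \<open>\<rho> = \<epsilon> * s k / 2\<close> makes the permitted
      deviation proportional to the dilation factor.\<close>
    have eq1: "4 * (sqrt A * s k) / (\<epsilon> * s k / 2)\<^sup>2 = (16 * sqrt A / \<epsilon>\<^sup>2) / s k"
      using s[of k] \<epsilon> by (simp add: power2_eq_square field_simps)
    have eq2: "2 * (sqrt A * s k) + 2 * (\<epsilon> * s k / 2) = (2 * sqrt A + \<epsilon>) * s k"
      by (simp add: algebra_simps)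
    have "c * s k < d * s k" "e * s k < f * s k" "0 < \<epsilon> * s k / 2"
      using cd ef \<epsilon> s[of k] by auto
    from box_upper_tail[OF this] show ?thesis
      unfolding A_scale eq1 eq2 Bex_def .
  qed
  obtain E where E': "\<forall>k. E k \<in> events \<and> prob (E k) \<le> (16 * sqrt A / \<epsilon>\<^sup>2) / s k \<and>
    (\<forall>\<omega>\<in>space M - E k. \<forall>ps. slope_chain \<alpha> \<beta> (\<Xi> \<omega> \<inter> pbox \<alpha> \<beta> (c * s k) (d * s k) (e * s k) (f * s k)) ps \<longrightarrow>
       length ps < (2 * sqrt A + \<epsilon>) * s k)"
    by atomize_elim (rule choice, rule allI, rule ex)
  have E: "E k \<in> events" "prob (E k) \<le> (16 * sqrt A / \<epsilon>\<^sup>2) / s k"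
    "\<omega> \<in> space M - E k \<Longrightarrow>
       slope_chain \<alpha> \<beta> (\<Xi> \<omega> \<inter> pbox \<alpha> \<beta> (c * s k) (d * s k) (e * s k) (f * s k)) ps \<Longrightarrow>
       length ps < (2 * sqrt A + \<epsilon>) * s k" for k \<omega> ps
    using E'[rule_format, of k] by simp_all
  have "summable (\<lambda>k. prob (E k))"
    by (rule summable_comparison_test'[OF summable_inverse_Suc_squares[of "16 * sqrt A / \<epsilon>\<^sup>2"], of 0])
      (use E(2) in \<open>auto simp: s_def\<close>)
  then have "AE \<omega> in M. \<forall>\<^sub>F k in sequentially. \<omega> \<in> space M - E k"
    using E(1) by (intro borel_cantelli_AE1) (auto simp: emeasure_eq_measure)
  then show ?thesis
  proof (rule eventually_mono)
    fix \<omega> assume "\<forall>\<^sub>F k in sequentially. \<omega> \<in> space M - E k"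
    then show "\<forall>\<^sub>F k in sequentially. \<forall>ps.
      slope_chain \<alpha> \<beta> (\<Xi> \<omega> \<inter> pbox \<alpha> \<beta> (c * (real (Suc k))\<^sup>2) (d * (real (Suc k))\<^sup>2) (e * (real (Suc k))\<^sup>2) (f * (real (Suc k))\<^sup>2)) ps \<longrightarrow>
      length ps \<le> (2 * sqrt ((d - c) * (f - e) / (\<beta> - \<alpha>)) + \<epsilon>) * (real (Suc k))\<^sup>2"
      unfolding s_def[symmetric] A_def[symmetric] by (rule eventually_mono) (use E(3) less_imp_le in blast)
  qed
qed

lemma AE_box_lower:
  fixes d f \<epsilon> :: real
  assumes df: "0 < d" "0 < f" and \<epsilon>: "0 < \<epsilon>"
  shows "AE \<omega> in M. \<forall>\<^sub>F k in sequentially. \<exists>ps.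
    slope_chain \<alpha> \<beta> (\<Xi> \<omega> \<inter> pbox \<alpha> \<beta> 0 (d * (real (Suc k))\<^sup>2) 0 (f * (real (Suc k))\<^sup>2)) ps \<and>
    (2 * sqrt (d * f / (\<beta> - \<alpha>)) - \<epsilon>) * (real (Suc k))\<^sup>2 \<le> length ps"
proof -
  define s where "s k = (real (Suc k))\<^sup>2" for k
  have s: "0 < s k" for k by (simp add: s_def)
  define A where "A = d * f / (\<beta> - \<alpha>)"
  have A: "0 < A" using df \<alpha>_less_\<beta> by (simp add: A_def)
  have A_scale: "sqrt (d * s k * (f * s k) / (\<beta> - \<alpha>)) = sqrt A * s k" for k
  proof -
    have "d * s k * (f * s k) / (\<beta> - \<alpha>) = A * (s k)\<^sup>2"
      by (simp add: A_def power2_eq_square algebra_simps)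
    then show ?thesis using s[of k] by (simp add: real_sqrt_mult)
  qed
  \<comment> \<open>\<open>\<gamma>\<close> stands for \<open>sqrt \<eta>\<close>: the bound 1 / 6
    is \<open>\<eta> \<le> 1 / 36\<close>, and the other bound keeps the loss
    \<open>14 * sqrt \<eta> * sqrt A\<close> below \<open>\<epsilon>\<close>.\<close>
  define \<gamma> where "\<gamma> = min (1 / 6) (\<epsilon> / (14 * sqrt A))"
  have \<gamma>: "0 < \<gamma>" "\<gamma> \<le> 1 / 6" "\<gamma> \<le> \<epsilon> / (14 * sqrt A)" using \<epsilon> A by (auto simp: \<gamma>_def)
  then have \<gamma>A: "14 * \<gamma> * sqrt A \<le> \<epsilon>" using A by (simp add: field_simps)
  have "\<gamma>\<^sup>2 \<le> (1 / 6)\<^sup>2" using \<gamma> by (intro power_mono) auto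
  then have \<eta>: "0 < \<gamma>\<^sup>2" "\<gamma>\<^sup>2 \<le> 1 / 36" "sqrt (\<gamma>\<^sup>2) = \<gamma>" using \<gamma> by (auto simp: power2_eq_square)
  obtain K where K: "\<And>d f A. 0 < d \<Longrightarrow> 0 < f \<Longrightarrow> A = d * f / (\<beta> - \<alpha>) \<Longrightarrow> \<exists>E\<in>events. prob E \<le> K / sqrt A \<and>
    (\<forall>\<omega>\<in>space M - E. \<exists>ps. slope_chain \<alpha> \<beta> (\<Xi> \<omega> \<inter> pbox \<alpha> \<beta> 0 d 0 f) ps \<and> (2 - 14 * \<gamma>) * sqrt A \<le> length ps)"
    using box_lower_tail[OF \<eta>(1,2)] unfolding \<eta>(3) by blast
  have ex: "\<exists>E. E \<in> events \<and> prob E \<le> K / sqrt A / s k \<and>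
    (\<forall>\<omega>\<in>space M - E. \<exists>ps. slope_chain \<alpha> \<beta> (\<Xi> \<omega> \<inter> pbox \<alpha> \<beta> 0 (d * s k) 0 (f * s k)) ps \<and>
       (2 * sqrt A - \<epsilon>) * s k \<le> length ps)" for k
  proof -
    have "0 < d * s k" "0 < f * s k" using df s[of k] by auto
    from K[OF this refl, unfolded A_scale] obtain E where E: "E \<in> events" "prob E \<le> K / (sqrt A * s k)"
      "\<forall>\<omega>\<in>space M - E. \<exists>ps. slope_chain \<alpha> \<beta> (\<Xi> \<omega> \<inter> pbox \<alpha> \<beta> 0 (d * s k) 0 (f * s k)) ps \<and>
         (2 - 14 * \<gamma>) * (sqrt A * s k) \<le> length ps"
      by (elim bexE conjE)
    have le: "(2 * sqrt A - \<epsilon>) * s k \<le> (2 - 14 * \<gamma>) * (sqrt A * s k)"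
      unfolding mult.assoc[symmetric] using \<gamma>A s[of k] by (intro mult_right_mono) (auto simp: algebra_simps)
    show ?thesis
    proof (intro exI[of _ E] conjI ballI)
      show "prob E \<le> K / sqrt A / s k" using E(2) by simp
      fix \<omega> assume "\<omega> \<in> space M - E"
      with E(3) obtain ps where "slope_chain \<alpha> \<beta> (\<Xi> \<omega> \<inter> pbox \<alpha> \<beta> 0 (d * s k) 0 (f * s k)) ps"
        "(2 - 14 * \<gamma>) * (sqrt A * s k) \<le> length ps" by blast
      with le show "\<exists>ps. slope_chain \<alpha> \<beta> (\<Xi> \<omega> \<inter> pbox \<alpha> \<beta> 0 (d * s k) 0 (f * s k)) ps \<and>
         (2 * sqrt A - \<epsilon>) * s k \<le> length ps"
        by (intro exI[of _ ps]) linarith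
    qed (rule E(1))
  qed
  obtain E where E': "\<forall>k. E k \<in> events \<and> prob (E k) \<le> K / sqrt A / s k \<and>
    (\<forall>\<omega>\<in>space M - E k. \<exists>ps. slope_chain \<alpha> \<beta> (\<Xi> \<omega> \<inter> pbox \<alpha> \<beta> 0 (d * s k) 0 (f * s k)) ps \<and>
       (2 * sqrt A - \<epsilon>) * s k \<le> length ps)"
    by atomize_elim (rule choice, rule allI, rule ex)
  have E: "E k \<in> events" "prob (E k) \<le> K / sqrt A / s k"
    "\<omega> \<in> space M - E k \<Longrightarrow>
       \<exists>ps. slope_chain \<alpha> \<beta> (\<Xi> \<omega> \<inter> pbox \<alpha> \<beta> 0 (d * s k) 0 (f * s k)) ps \<and> (2 * sqrt A - \<epsilon>) * s k \<le> length ps" for k \<omega>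
    using E'[rule_format, of k] by simp_all
  have "summable (\<lambda>k. prob (E k))"
    by (rule summable_comparison_test'[OF summable_inverse_Suc_squares[of "K / sqrt A"], of 0])
      (use E(2) in \<open>auto simp: s_def\<close>)
  then have "AE \<omega> in M. \<forall>\<^sub>F k in sequentially. \<omega> \<in> space M - E k"
    using E(1) by (intro borel_cantelli_AE1) (auto simp: emeasure_eq_measure)
  then show ?thesis
  proof (rule eventually_mono)
    fix \<omega> assume "\<forall>\<^sub>F k in sequentially. \<omega> \<in> space M - E k"
    then show "\<forall>\<^sub>F k in sequentially. \<exists>ps.
      slope_chain \<alpha> \<beta> (\<Xi> \<omega> \<inter> pbox \<alpha> \<beta> 0 (d * (real (Suc k))\<^sup>2) 0 (f * (real (Suc k))\<^sup>2)) ps \<and>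
      (2 * sqrt (d * f / (\<beta> - \<alpha>)) - \<epsilon>) * (real (Suc k))\<^sup>2 \<le> length ps"
      unfolding s_def[symmetric] A_def[symmetric] by (rule eventually_mono) (rule E(3))
  qed
qed

end

section \<open>Deterministic facts on longest chains and limits\<close>

lemma longest_chain_altdef:
  "longest_chain \<alpha> \<beta> A x y = Max (length ` {ps. slope_chain \<alpha> \<beta> (A \<inter> ({0..x} \<times> {0..y})) ps})"
proof -
  have "{length ps |ps. distinct ps \<and> set ps \<subseteq> A \<inter> ({0..x} \<times> {0..y}) \<and> successively (slope_le \<alpha> \<beta>) ps} =
      length ` {ps. slope_chain \<alpha> \<beta> (A \<inter> ({0..x} \<times> {0..y})) ps}"
    by (auto simp: slope_chain_def)
  then show ?thesis by (simp only: longest_chain_def)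
qed

lemma
  assumes "finite (A \<inter> ({0..x} \<times> {0..y}))"
  shows length_le_longest_chain: "slope_chain \<alpha> \<beta> (A \<inter> ({0..x} \<times> {0..y})) ps \<Longrightarrow> length ps \<le> longest_chain \<alpha> \<beta> A x y"
    and longest_chain_attained: "\<exists>ps. slope_chain \<alpha> \<beta> (A \<inter> ({0..x} \<times> {0..y})) ps \<and> length ps = longest_chain \<alpha> \<beta> A x y"
proof -
  let ?S = "{ps. slope_chain \<alpha> \<beta> (A \<inter> ({0..x} \<times> {0..y})) ps}"
  have "length ps \<le> card (A \<inter> ({0..x} \<times> {0..y}))" if "ps \<in> ?S" for ps
    using that card_mono[OF assms, of "set ps"] by (auto simp: slope_chain_def distinct_card)
  then have fin: "finite (length ` ?S)"
    by (auto intro: finite_subset[of _ "{..card (A \<inter> ({0..x} \<times> {0..y}))}"])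
  show "slope_chain \<alpha> \<beta> (A \<inter> ({0..x} \<times> {0..y})) ps \<Longrightarrow> length ps \<le> longest_chain \<alpha> \<beta> A x y"
    unfolding longest_chain_altdef using fin by (intro Max_ge) auto
  have "[] \<in> ?S" by (simp add: slope_chain_def)
  then have "longest_chain \<alpha> \<beta> A x y \<in> length ` ?S"
    unfolding longest_chain_altdef using fin by (intro Max_in) auto
  then show "\<exists>ps. slope_chain \<alpha> \<beta> (A \<inter> ({0..x} \<times> {0..y})) ps \<and> length ps = longest_chain \<alpha> \<beta> A x y"
    by auto
qed

lemma longest_chain_mono:
  assumes "finite (A \<inter> ({0..x'} \<times> {0..y'}))" "x \<le> x'" "y \<le> y'"
  shows "longest_chain \<alpha> \<beta> A x y \<le> longest_chain \<alpha> \<beta> A x' y'"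
proof -
  have sub: "A \<inter> ({0..x} \<times> {0..y}) \<subseteq> A \<inter> ({0..x'} \<times> {0..y'})" using assms by auto
  from longest_chain_attained[OF finite_subset[OF sub assms(1)]]
  obtain ps where "slope_chain \<alpha> \<beta> (A \<inter> ({0..x} \<times> {0..y})) ps" "length ps = longest_chain \<alpha> \<beta> A x y" by blast
  moreover from this have "slope_chain \<alpha> \<beta> (A \<inter> ({0..x'} \<times> {0..y'})) ps"
    using sub by (auto simp: slope_chain_def)
  ultimately show ?thesis using length_le_longest_chain[OF assms(1)] by metis
qed

lemma tendsto_from_squares:
  fixes g :: "real \<Rightarrow> real"
  assumes mono: "\<And>s t. 0 \<le> s \<Longrightarrow> s \<le> t \<Longrightarrow> g s \<le> g t" and nonneg: "\<And>t. 0 \<le> t \<Longrightarrow> 0 \<le> g t"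
    and lim: "(\<lambda>k. g ((real (Suc k))\<^sup>2) / (real (Suc k))\<^sup>2) \<longlonglongrightarrow> F"
  shows "((\<lambda>t. g t / t) \<longlongrightarrow> F) at_top"
proof -
  define s where "s k = (real (Suc k))\<^sup>2" for k
  have s: "0 < s k" for k by (simp add: s_def)
  have lim': "(\<lambda>k. g (s k) / s k) \<longlonglongrightarrow> F" using lim by (simp add: s_def)
  have r1: "(\<lambda>k. s (Suc k) / s k) \<longlonglongrightarrow> 1" and r2: "(\<lambda>k. s k / s (Suc k)) \<longlonglongrightarrow> 1"
    unfolding s_def by real_asymp+
  have u: "(\<lambda>k. g (s (Suc k)) / s k) \<longlonglongrightarrow> F"
    using tendsto_mult[OF LIMSEQ_Suc[OF lim'] r1] s by (simp add: less_imp_neq[symmetric])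
  have l: "(\<lambda>k. g (s k) / s (Suc k)) \<longlonglongrightarrow> F"
    using tendsto_mult[OF lim' r2] s by (simp add: less_imp_neq[symmetric])
  \<comment> \<open>\<open>s k\<close> is the square of \<open>k + 1\<close>, hence the shift: for
    \<open>t \<ge> 1\<close>, \<open>s (\<kappa> t)\<close> and \<open>s (Suc (\<kappa> t))\<close>
    are the consecutive squares around \<open>t\<close>. Their ratio tends to 1.\<close>
  define \<kappa> where "\<kappa> t = nat (\<lfloor>sqrt t\<rfloor> - 1)" for t
  have \<kappa>_lim: "filterlim \<kappa> sequentially at_top"
    unfolding \<kappa>_def by (intro filterlim_compose[OF filterlim_nat_sequentially]) real_asymp
  have \<kappa>: "s (\<kappa> t) \<le> t" "t \<le> s (Suc (\<kappa> t))" if "1 \<le> t" for t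
  proof -
    have "1 \<le> \<lfloor>sqrt t\<rfloor>" using that by (simp add: le_floor_iff)
    then have "real (Suc (\<kappa> t)) = of_int \<lfloor>sqrt t\<rfloor>" by (simp add: \<kappa>_def)
    then have "real (Suc (\<kappa> t)) \<le> sqrt t" "sqrt t \<le> real (Suc (Suc (\<kappa> t)))" by linarith+
    then have "(real (Suc (\<kappa> t)))\<^sup>2 \<le> (sqrt t)\<^sup>2" "(sqrt t)\<^sup>2 \<le> (real (Suc (Suc (\<kappa> t))))\<^sup>2"
      using that by (intro power_mono; simp)+
    then show "s (\<kappa> t) \<le> t" "t \<le> s (Suc (\<kappa> t))" using that by (simp_all add: s_def)
  qed
  show ?thesis
  proof (rule tendsto_sandwich)
    show "((\<lambda>t. g (s (\<kappa> t)) / s (Suc (\<kappa> t))) \<longlongrightarrow> F) at_top"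
      by (rule filterlim_compose[OF l \<kappa>_lim])
    show "((\<lambda>t. g (s (Suc (\<kappa> t))) / s (\<kappa> t)) \<longlongrightarrow> F) at_top"
      by (rule filterlim_compose[OF u \<kappa>_lim])
    show "\<forall>\<^sub>F t in at_top. g (s (\<kappa> t)) / s (Suc (\<kappa> t)) \<le> g t / t"
      using eventually_ge_at_top[of 1]
    proof eventually_elim
      case (elim t)
      then show ?case using \<kappa>[OF elim] s[of "\<kappa> t"] mono[of "s (\<kappa> t)" t] nonneg[of "s (\<kappa> t)"]
        by (intro frac_le) auto
    qed
    show "\<forall>\<^sub>F t in at_top. g t / t \<le> g (s (Suc (\<kappa> t))) / s (\<kappa> t)"
      using eventually_ge_at_top[of 1]
    proof eventually_elim
      case (elim t)
      then show ?case using \<kappa>[OF elim] s[of "\<kappa> t"] mono[of t "s (Suc (\<kappa> t))"] nonneg[of t]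
        nonneg[of "s (Suc (\<kappa> t))"] by (intro frac_le) auto
    qed
  qed
qed

text \<open>The arithmetic-geometric inequality for \<open>lam * X\<close> and
  \<open>Y / lam\<close>: the concave limit functional lies below each of its tangent planes, one
  for every \<open>lam\<close>.\<close>

lemma two_sqrt_le_weighted_mean:
  fixes lam X Y k :: real
  assumes "0 < lam" "0 \<le> X" "0 \<le> Y" "0 < k"
  shows "2 * sqrt (X * Y / k) \<le> (lam * X + Y / lam) / sqrt k"
proof -
  have "sqrt ((lam * X) * (Y / lam)) \<le> (lam * X + Y / lam) / 2"
    using assms by (intro arith_geo_mean_sqrt) auto
  moreover have "(lam * X) * (Y / lam) = X * Y" using assms by simp
  ultimately have "2 * sqrt (X * Y) \<le> lam * X + Y / lam" by simp
  then have "2 * sqrt (X * Y) / sqrt k \<le> (lam * X + Y / lam) / sqrt k"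
    using assms by (intro divide_right_mono) auto
  then show ?thesis by (simp add: real_sqrt_divide)
qed

text \<open>The tolerances are only \<open>1 / (m + 1)\<close>, so that the almost sure statements
  behind them form a countable family; \<open>C\<close> absorbs what rounding adds.\<close>

lemma eventually_upper_lower_imp_LIMSEQ:
  fixes X :: "nat \<Rightarrow> real"
  assumes upper: "\<And>m. \<forall>\<^sub>F n in sequentially. X n \<le> F + C * (1 / real (Suc m))"
    and lower: "\<And>m. \<forall>\<^sub>F n in sequentially. F - 1 / real (Suc m) \<le> X n" and C: "0 < C"
  shows "X \<longlonglongrightarrow> F"
proof (rule order_tendstoI)
  fix y assume "y < F"
  then obtain m where "1 / real (Suc m) < F - y" using nat_approx_posE[of "F - y"] by auto
  with lower[of m] show "\<forall>\<^sub>F n in sequentially. y < X n" by (auto elim: eventually_mono)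
next
  fix y assume "F < y"
  then obtain m where "1 / real (Suc m) < (y - F) / C" using nat_approx_posE[of "(y - F) / C"] C by auto
  then have "C * (1 / real (Suc m)) < y - F" using C by (simp add: field_simps)
  with upper[of m] show "\<forall>\<^sub>F n in sequentially. X n < y" by (auto elim: eventually_mono)
qed

section \<open>From parallelograms to the rectangle\<close>

context sloped_poisson_process
begin

text \<open>A chain may begin and end anywhere. It lies in the parallelogram spanned by its first
  and last points, which is rounded outwards to multiples of \<open>\<delta> * s\<close>; finitely
  many such boxes suffice, uniformly in \<open>s\<close>. Rounding adds at most
  \<open>2 * \<delta>\<close> to each rescaled side, and the linear bound turns this into the
  multiple of \<open>\<delta>\<close> in the conclusion.\<close>

lemma longest_chain_upper_from_boxes:
  fixes a b lam F \<delta> s :: real and N :: int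
  assumes ab: "0 < a" "0 < b" and lam: "0 < lam" and s: "0 < s" and \<delta>: "0 < \<delta>" and F: "0 \<le> F"
    and H: "\<And>u v. 0 \<le> u \<Longrightarrow> u \<le> a \<Longrightarrow> 0 \<le> v \<Longrightarrow> v \<le> b \<Longrightarrow>
      (lam * (v - \<alpha> * u) + (\<beta> * u - v) / lam) / sqrt (\<beta> - \<alpha>) \<le> F"
    and \<omega>: "\<omega> \<in> space M" and N: "(b + (\<alpha> + \<beta>) * a) / \<delta> \<le> N"
    and boxes: "\<And>i j k l ps. i \<in> {-N..N} \<Longrightarrow> j \<in> {-N..N} \<Longrightarrow> k \<in> {i..N} \<Longrightarrow> l \<in> {j..N} \<Longrightarrow>
      slope_chain \<alpha> \<beta> (\<Xi> \<omega> \<inter> pbox \<alpha> \<beta> (of_int i * \<delta> * s) ((of_int k + 1) * \<delta> * s)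
        (of_int j * \<delta> * s) ((of_int l + 1) * \<delta> * s)) ps \<Longrightarrow>
      length ps \<le> (2 * sqrt (((of_int k + 1) * \<delta> - of_int i * \<delta>) * ((of_int l + 1) * \<delta> - of_int j * \<delta>) / (\<beta> - \<alpha>)) + \<delta>) * s"
  shows "longest_chain \<alpha> \<beta> (\<Xi> \<omega>) (a * s) (b * s) \<le> (F + (2 * (lam + 1 / lam) / sqrt (\<beta> - \<alpha>) + 1) * \<delta>) * s"
proof -
  define \<kappa> where "\<kappa> = sqrt (\<beta> - \<alpha>)"
  have \<kappa>: "0 < \<kappa>" using \<alpha>_less_\<beta> by (simp add: \<kappa>_def)
  let ?T1 = "\<lambda>z::real \<times> real. snd z - \<alpha> * fst z" and ?T2 = "\<lambda>z::real \<times> real. \<beta> * fst z - snd z"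
  have \<beta>: "0 < \<beta>" using \<alpha>_nonneg \<alpha>_less_\<beta> by simp
  have fin: "finite (\<Xi> \<omega> \<inter> ({0..a * s} \<times> {0..b * s}))"
    using \<omega> by (intro locally_finite bounded_Times) auto
  from longest_chain_attained[OF this] obtain ps
    where ps: "slope_chain \<alpha> \<beta> (\<Xi> \<omega> \<inter> ({0..a * s} \<times> {0..b * s})) ps"
      "length ps = longest_chain \<alpha> \<beta> (\<Xi> \<omega>) (a * s) (b * s)" by blast
  have psd: "distinct ps" "set ps \<subseteq> \<Xi> \<omega> \<inter> ({0..a * s} \<times> {0..b * s})" "sorted_wrt (slope_le \<alpha> \<beta>) ps"
    using ps \<alpha>_less_\<beta> by (auto simp: slope_chain_iff)
  have C0: "0 \<le> (2 * (lam + 1 / lam) / \<kappa> + 1) * \<delta>" using lam \<delta> \<kappa> by simp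
  show ?thesis
  proof (cases "ps = []")
    case True
    with ps(2) have "longest_chain \<alpha> \<beta> (\<Xi> \<omega>) (a * s) (b * s) = 0" by simp
    then show ?thesis using F C0 s by (simp add: \<kappa>_def)
  next
    case False
    define p q where "p = hd ps" and "q = last ps"
    have pq: "p \<in> set ps" "q \<in> set ps" using False by (auto simp: p_def q_def)
    have refl: "slope_le \<alpha> \<beta> z z" for z using \<alpha>_less_\<beta> by (simp add: slope_le_iff)
    have between: "slope_le \<alpha> \<beta> p z" "slope_le \<alpha> \<beta> z q" if z: "z \<in> set ps" for z
    proof -
      obtain i where i: "i < length ps" "z = ps ! i" using z by (auto simp: in_set_conv_nth)
      show "slope_le \<alpha> \<beta> p z"
        using sorted_wrt_nth_less[OF psd(3), of 0 i] i refl False by (cases "i = 0") (auto simp: p_def hd_conv_nth)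
      show "slope_le \<alpha> \<beta> z q"
        using sorted_wrt_nth_less[OF psd(3), of i "length ps - 1"] i refl False
        by (cases "i = length ps - 1") (auto simp: q_def last_conv_nth)
    qed
    define ix where "ix g = \<lfloor>g / (\<delta> * s)\<rfloor>" for g
    have ds: "0 < \<delta> * s" using \<delta> s by simp
    have ix: "of_int (ix g) * \<delta> * s \<le> g" "g < (of_int (ix g) + 1) * \<delta> * s" for g
    proof -
      have "of_int (ix g) \<le> g / (\<delta> * s)" "g / (\<delta> * s) < of_int (ix g) + 1"
        unfolding ix_def by linarith+
      then show "of_int (ix g) * \<delta> * s \<le> g" "g < (of_int (ix g) + 1) * \<delta> * s"
        using ds by (simp_all add: le_divide_eq divide_less_eq mult.assoc)
    qed
    have ix_mono: "g \<le> h \<Longrightarrow> ix g \<le> ix h" for g h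
      unfolding ix_def using ds by (intro floor_mono divide_right_mono) auto
    have rect: "0 \<le> fst z" "fst z \<le> a * s" "0 \<le> snd z" "snd z \<le> b * s" if "z \<in> set ps" for z
      using psd(2) that by auto
    \<comment> \<open>The coordinates \<open>w\<close> and \<open>e\<close> may be negative on the
      rectangle, so indices of both signs occur; in modulus they stay below
      \<open>(b + (\<alpha> + \<beta>) * a) * s\<close>.\<close>
    have ix_range: "ix g \<in> {-N..N}" if "\<bar>g\<bar> \<le> (b + (\<alpha> + \<beta>) * a) * s" for g
    proof -
      have "\<bar>g / (\<delta> * s)\<bar> \<le> (b + (\<alpha> + \<beta>) * a) / \<delta>"
        using that \<delta> s by (simp add: field_simps abs_mult)
      with N have "- real_of_int N \<le> g / (\<delta> * s)" "g / (\<delta> * s) \<le> real_of_int N" by linarith+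
      then have "- N \<le> ix g" "ix g \<le> N" unfolding ix_def by (simp_all add: le_floor_iff floor_le_iff)
      then show ?thesis by simp
    qed
    have range: "ix (?T1 z) \<in> {-N..N}" "ix (?T2 z) \<in> {-N..N}" if "z \<in> set ps" for z
    proof -
      note r = rect[OF that]
      have "0 \<le> \<alpha> * fst z" "0 \<le> \<beta> * fst z" "\<alpha> * fst z \<le> \<alpha> * (a * s)" "\<beta> * fst z \<le> \<beta> * (a * s)"
        "0 \<le> \<alpha> * (a * s)" "0 \<le> \<beta> * (a * s)" "0 \<le> b * s"
        using r \<alpha>_nonneg \<beta> ab s by (auto intro: mult_left_mono)
      then have "\<bar>?T1 z\<bar> \<le> b * s + \<alpha> * (a * s) + \<beta> * (a * s)" "\<bar>?T2 z\<bar> \<le> b * s + \<alpha> * (a * s) + \<beta> * (a * s)"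
        using r by linarith+
      moreover have "b * s + \<alpha> * (a * s) + \<beta> * (a * s) = (b + (\<alpha> + \<beta>) * a) * s" by (simp add: algebra_simps)
      ultimately show "ix (?T1 z) \<in> {-N..N}" "ix (?T2 z) \<in> {-N..N}" by (auto intro!: ix_range simp del: atLeastAtMost_iff)
    qed
    define i j k l where "i = ix (?T1 p)" and "j = ix (?T2 p)" and "k = ix (?T1 q)" and "l = ix (?T2 q)"
    have T_le: "?T1 p \<le> ?T1 q" "?T2 p \<le> ?T2 q"
      using between(2)[OF pq(1)] \<alpha>_less_\<beta> by (auto simp: slope_le_iff)
    have ijkl: "i \<in> {-N..N}" "j \<in> {-N..N}" "k \<in> {i..N}" "l \<in> {j..N}"
      using range[OF pq(1)] range[OF pq(2)] ix_mono[OF T_le(1)] ix_mono[OF T_le(2)]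
      by (auto simp: i_def j_def k_def l_def)
    have "set ps \<subseteq> pbox \<alpha> \<beta> (of_int i * \<delta> * s) ((of_int k + 1) * \<delta> * s) (of_int j * \<delta> * s) ((of_int l + 1) * \<delta> * s)"
    proof
      fix z assume "z \<in> set ps"
      from between[OF this] \<alpha>_less_\<beta> have "?T1 p \<le> ?T1 z" "?T2 p \<le> ?T2 z" "?T1 z \<le> ?T1 q" "?T2 z \<le> ?T2 q"
        by (auto simp: slope_le_iff)
      with ix[of "?T1 p"] ix[of "?T2 p"] ix[of "?T1 q"] ix[of "?T2 q"]
      show "z \<in> pbox \<alpha> \<beta> (of_int i * \<delta> * s) ((of_int k + 1) * \<delta> * s) (of_int j * \<delta> * s) ((of_int l + 1) * \<delta> * s)"
        unfolding pbox_def i_def j_def k_def l_def by (simp only: mem_Collect_eq atLeastLessThan_iff) linarith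
    qed
    then have chain: "slope_chain \<alpha> \<beta> (\<Xi> \<omega> \<inter> pbox \<alpha> \<beta> (of_int i * \<delta> * s) ((of_int k + 1) * \<delta> * s)
        (of_int j * \<delta> * s) ((of_int l + 1) * \<delta> * s)) ps"
      using ps(1) by (auto simp: slope_chain_def)
    define X Y where "X = (of_int k + 1) * \<delta> - of_int i * \<delta>" and "Y = (of_int l + 1) * \<delta> - of_int j * \<delta>"
    have len: "length ps \<le> (2 * sqrt (X * Y / (\<beta> - \<alpha>)) + \<delta>) * s"
      unfolding X_def Y_def by (rule boxes[OF ijkl chain])
    have "of_int i * \<delta> \<le> (of_int k + 1) * \<delta>" "of_int j * \<delta> \<le> (of_int l + 1) * \<delta>"
      using ijkl \<delta> by (intro mult_right_mono; simp)+
    then have XY: "0 \<le> X" "0 \<le> Y" by (simp_all add: X_def Y_def)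
    have X_le: "X * s \<le> ?T1 q - ?T1 p + 2 * \<delta> * s" and Y_le: "Y * s \<le> ?T2 q - ?T2 p + 2 * \<delta> * s"
      using ix(1)[of "?T1 q"] ix(2)[of "?T1 p"] ix(1)[of "?T2 q"] ix(2)[of "?T2 p"]
      unfolding X_def Y_def i_def j_def k_def l_def by (simp_all add: algebra_simps)
    \<comment> \<open>The displacement from first to last point in units of \<open>s\<close>; it
      fits into the \<open>a\<close> by \<open>b\<close> rectangle, as \<open>H\<close>
      demands.\<close>
    define u v where "u = (fst q - fst p) / s" and "v = (snd q - snd p) / s"
    have le: "fst p \<le> fst q" "\<alpha> * (fst q - fst p) \<le> snd q - snd p"
      using between(2)[OF pq(1)] by (auto simp: slope_le_def)
    moreover from le(1) have "0 \<le> \<alpha> * (fst q - fst p)" using \<alpha>_nonneg by simp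
    ultimately have uv: "0 \<le> u" "u \<le> a" "0 \<le> v" "v \<le> b"
      using rect[OF pq(1)] rect[OF pq(2)] s by (auto simp: u_def v_def divide_le_eq)
    have us: "u * s = fst q - fst p" "v * s = snd q - snd p" using s by (simp_all add: u_def v_def)
    have "(v - \<alpha> * u + 2 * \<delta>) * s = v * s - \<alpha> * (u * s) + 2 * \<delta> * s"
      by (simp add: algebra_simps)
    also have "\<dots> = ?T1 q - ?T1 p + 2 * \<delta> * s" unfolding us by (simp add: algebra_simps)
    finally have "X * s \<le> (v - \<alpha> * u + 2 * \<delta>) * s" using X_le by simp
    then have X_le': "X \<le> v - \<alpha> * u + 2 * \<delta>" using s by simp
    have "(\<beta> * u - v + 2 * \<delta>) * s = \<beta> * (u * s) - v * s + 2 * \<delta> * s"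
      by (simp add: algebra_simps)
    also have "\<dots> = ?T2 q - ?T2 p + 2 * \<delta> * s" unfolding us by (simp add: algebra_simps)
    finally have "Y * s \<le> (\<beta> * u - v + 2 * \<delta>) * s" using Y_le by simp
    then have Y_le': "Y \<le> \<beta> * u - v + 2 * \<delta>" using s by simp
    have "2 * sqrt (X * Y / (\<beta> - \<alpha>)) \<le> (lam * X + Y / lam) / \<kappa>"
      unfolding \<kappa>_def using lam XY \<alpha>_less_\<beta> by (intro two_sqrt_le_weighted_mean) auto
    also have "\<dots> \<le> (lam * (v - \<alpha> * u + 2 * \<delta>) + (\<beta> * u - v + 2 * \<delta>) / lam) / \<kappa>"
      using X_le' Y_le' lam \<kappa> by (intro divide_right_mono add_mono mult_left_mono) auto
    also have "\<dots> = (lam * (v - \<alpha> * u) + (\<beta> * u - v) / lam) / \<kappa> + 2 * (lam + 1 / lam) / \<kappa> * \<delta>"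
      using lam \<kappa> by (simp add: field_simps)
    also have "\<dots> \<le> F + 2 * (lam + 1 / lam) / \<kappa> * \<delta>"
      using H[OF uv] by (simp add: \<kappa>_def)
    finally have "2 * sqrt (X * Y / (\<beta> - \<alpha>)) + \<delta> \<le> F + (2 * (lam + 1 / lam) / \<kappa> + 1) * \<delta>"
      by (simp add: algebra_simps)
    then have "(2 * sqrt (X * Y / (\<beta> - \<alpha>)) + \<delta>) * s \<le> (F + (2 * (lam + 1 / lam) / \<kappa> + 1) * \<delta>) * s"
      using s by (intro mult_right_mono) auto
    with len ps(2) show ?thesis by (simp add: \<kappa>_def)
  qed
qed

text \<open>
  The weight \<open>lam\<close> is a tangent direction: \<open>H\<close> bounds the concave limit of every displacement
  inside the rectangle by a linear form, and \<open>(w, e)\<close> is a displacement attaining the bound.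
\<close>

lemma AE_longest_chain_limit:
  fixes a b lam F w e :: real
  assumes ab: "0 < a" "0 < b" and lam: "0 < lam"
    and H: "\<And>u v. 0 \<le> u \<Longrightarrow> u \<le> a \<Longrightarrow> 0 \<le> v \<Longrightarrow> v \<le> b \<Longrightarrow>
      (lam * (v - \<alpha> * u) + (\<beta> * u - v) / lam) / sqrt (\<beta> - \<alpha>) \<le> F"
    and we: "0 < w" "0 < e" "(w + e) / (\<beta> - \<alpha>) \<le> a" "(\<beta> * w + \<alpha> * e) / (\<beta> - \<alpha>) \<le> b"
    and F: "2 * sqrt (w * e / (\<beta> - \<alpha>)) = F"
  shows "AE \<omega> in M. ((\<lambda>t. real (longest_chain \<alpha> \<beta> (\<Xi> \<omega>) (a * t) (b * t)) / t) \<longlongrightarrow> F) at_top"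
proof -
  define s where "s n = (real (Suc n))\<^sup>2" for n
  have s: "0 < s n" for n by (simp add: s_def)
  define \<delta> where "\<delta> m = 1 / real (Suc m)" for m
  have \<delta>: "0 < \<delta> m" for m by (simp add: \<delta>_def)
  have F0: "0 \<le> F" using we \<alpha>_less_\<beta> by (simp add: F[symmetric])
  define C where "C = 2 * (lam + 1 / lam) / sqrt (\<beta> - \<alpha>) + 1"
  have C: "0 < C" using lam \<alpha>_less_\<beta> unfolding C_def by (intro add_nonneg_pos divide_nonneg_nonneg) auto
  \<comment> \<open>One tuple holds the tolerance and the grid box, so that all exceptional sets
    form a single countable family.\<close>
  define P where "P \<omega> n = (\<lambda>(m, i, j, k, l). \<forall>ps.
      slope_chain \<alpha> \<beta> (\<Xi> \<omega> \<inter> pbox \<alpha> \<beta> (of_int i * \<delta> m * s n) ((of_int k + 1) * \<delta> m * s n)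
        (of_int j * \<delta> m * s n) ((of_int l + 1) * \<delta> m * s n)) ps \<longrightarrow>
      length ps \<le> (2 * sqrt (((of_int k + 1) * \<delta> m - of_int i * \<delta> m) * ((of_int l + 1) * \<delta> m - of_int j * \<delta> m) / (\<beta> - \<alpha>)) + \<delta> m) * s n)"
    for \<omega> n and q :: "nat \<times> int \<times> int \<times> int \<times> int"
  have "AE \<omega> in M. \<forall>\<^sub>F n in sequentially. P \<omega> n (m, i, j, k, l)" if "i \<le> k" "j \<le> l" for m i j k l
  proof -
    have "of_int i * \<delta> m < (of_int k + 1) * \<delta> m" "of_int j * \<delta> m < (of_int l + 1) * \<delta> m"
      using that \<delta>[of m] by (intro mult_strict_right_mono; simp)+
    from AE_box_upper[OF this \<delta>[of m]] show ?thesis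
      unfolding P_def prod.case s_def .
  qed
  then have pt: "AE \<omega> in M. (case q of (m, i, j, k, l) \<Rightarrow> i \<le> k \<and> j \<le> l) \<longrightarrow> (\<forall>\<^sub>F n in sequentially. P \<omega> n q)" for q
    by (cases q) auto
  then have U: "AE \<omega> in M. \<forall>q. (case q of (m, i, j, k, l) \<Rightarrow> i \<le> k \<and> j \<le> l) \<longrightarrow> (\<forall>\<^sub>F n in sequentially. P \<omega> n q)"
    unfolding AE_all_countable using pt by blast
  have L: "AE \<omega> in M. \<forall>m. \<forall>\<^sub>F n in sequentially. \<exists>ps.
      slope_chain \<alpha> \<beta> (\<Xi> \<omega> \<inter> pbox \<alpha> \<beta> 0 (w * s n) 0 (e * s n)) ps \<and> (F - \<delta> m) * s n \<le> length ps"
    unfolding AE_all_countable s_def F[symmetric] by (intro allI AE_box_lower we \<delta>)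
  from U L AE_space show ?thesis
  proof eventually_elim
    case (elim \<omega>)
    note \<omega> = elim(3)
    let ?L = "\<lambda>t. real (longest_chain \<alpha> \<beta> (\<Xi> \<omega>) (a * t) (b * t))"
    have fin: "finite (\<Xi> \<omega> \<inter> ({0..x} \<times> {0..y}))" for x y
      using \<omega> by (intro locally_finite bounded_Times) auto
    have "(\<lambda>n. ?L (s n) / s n) \<longlonglongrightarrow> F"
    proof (rule eventually_upper_lower_imp_LIMSEQ[where C = C])
      fix m
      define N where "N = \<lceil>(b + (\<alpha> + \<beta>) * a) / \<delta> m\<rceil>"
      have N: "(b + (\<alpha> + \<beta>) * a) / \<delta> m \<le> N" unfolding N_def by (rule le_of_int_ceiling)
      define Q where "Q = {q \<in> {m} \<times> {-N..N} \<times> {-N..N} \<times> {-N..N} \<times> {-N..N}. case q of (m, i, j, k, l) \<Rightarrow> i \<le> k \<and> j \<le> l}"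
      have "finite Q" unfolding Q_def by (rule finite_subset[of _ "{m} \<times> {-N..N} \<times> {-N..N} \<times> {-N..N} \<times> {-N..N}"]) auto
      moreover have "\<forall>q\<in>Q. \<forall>\<^sub>F n in sequentially. P \<omega> n q" using elim(1) by (auto simp: Q_def)
      ultimately have "\<forall>\<^sub>F n in sequentially. \<forall>q\<in>Q. P \<omega> n q" by (rule eventually_ball_finite)
      then show "\<forall>\<^sub>F n in sequentially. ?L (s n) / s n \<le> F + C * (1 / real (Suc m))"
      proof (rule eventually_mono)
        fix n assume n: "\<forall>q\<in>Q. P \<omega> n q"
        have "?L (s n) \<le> (F + C * \<delta> m) * s n"
          unfolding C_def
        proof (rule longest_chain_upper_from_boxes[OF ab lam s \<delta> F0 H \<omega>, where N = N])
          fix i j k l ps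
          assume "i \<in> {-N..N}" "j \<in> {-N..N}" "k \<in> {i..N}" "l \<in> {j..N}"
          then have "(m, i, j, k, l) \<in> Q" by (auto simp: Q_def)
          with n have P: "P \<omega> n (m, i, j, k, l)" by blast
          assume "slope_chain \<alpha> \<beta> (\<Xi> \<omega> \<inter> pbox \<alpha> \<beta> (of_int i * \<delta> m * s n) ((of_int k + 1) * \<delta> m * s n)
            (of_int j * \<delta> m * s n) ((of_int l + 1) * \<delta> m * s n)) ps"
          with P show "length ps \<le> (2 * sqrt (((of_int k + 1) * \<delta> m - of_int i * \<delta> m) *
              ((of_int l + 1) * \<delta> m - of_int j * \<delta> m) / (\<beta> - \<alpha>)) + \<delta> m) * s n"
            unfolding P_def prod.case by blast
        qed (use N in auto)
        then show "?L (s n) / s n \<le> F + C * (1 / real (Suc m))"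
          using s[of n] by (simp add: \<delta>_def divide_le_eq)
      qed
      show "\<forall>\<^sub>F n in sequentially. F - 1 / real (Suc m) \<le> ?L (s n) / s n"
        using elim(2)[rule_format, of m]
      proof (rule eventually_mono)
        fix n assume "\<exists>ps. slope_chain \<alpha> \<beta> (\<Xi> \<omega> \<inter> pbox \<alpha> \<beta> 0 (w * s n) 0 (e * s n)) ps \<and> (F - \<delta> m) * s n \<le> length ps"
        then obtain ps where ps: "slope_chain \<alpha> \<beta> (\<Xi> \<omega> \<inter> pbox \<alpha> \<beta> 0 (w * s n) 0 (e * s n)) ps"
          "(F - \<delta> m) * s n \<le> length ps" by blast
        \<comment> \<open>Both Cartesian coordinates increase with \<open>w\<close> and
          \<open>e\<close>, so the corner \<open>(w * s n, e * s n)\<close> decides; the last two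
          parts of \<open>we\<close> say that it lies in the rectangle.\<close>
        have "pbox \<alpha> \<beta> 0 (w * s n) 0 (e * s n) \<subseteq> {0..a * s n} \<times> {0..b * s n}"
        proof
          fix z assume z: "z \<in> pbox \<alpha> \<beta> 0 (w * s n) 0 (e * s n)"
          then have "z \<in> quarter_plane"
            using pbox_subset_quarter_plane[OF \<alpha>_nonneg \<alpha>_less_\<beta>, of 0 0] by auto
          then have pos: "0 \<le> fst z" "0 \<le> snd z" by (auto simp: quarter_plane_def)
          have T: "snd z - \<alpha> * fst z \<le> w * s n" "\<beta> * fst z - snd z \<le> e * s n" using z by (auto simp: pbox_def)
          have k: "0 < \<beta> - \<alpha>" "0 \<le> \<beta>" using \<alpha>_less_\<beta> \<alpha>_nonneg by auto
          have "(\<beta> - \<alpha>) * fst z \<le> (w + e) * s n" using T by (simp add: algebra_simps)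
          also have "\<dots> \<le> (\<beta> - \<alpha>) * a * s n"
            using we(3) k s[of n] by (intro mult_right_mono) (auto simp: divide_le_eq mult.commute)
          finally have "(\<beta> - \<alpha>) * fst z \<le> (\<beta> - \<alpha>) * (a * s n)" by (simp add: mult.assoc)
          then have 1: "fst z \<le> a * s n" using k by simp
          have "(\<beta> - \<alpha>) * snd z = \<beta> * (snd z - \<alpha> * fst z) + \<alpha> * (\<beta> * fst z - snd z)"
            by (simp add: algebra_simps)
          also have "\<dots> \<le> \<beta> * (w * s n) + \<alpha> * (e * s n)"
            using T k \<alpha>_nonneg by (intro add_mono mult_left_mono) auto
          also have "\<dots> = (\<beta> * w + \<alpha> * e) * s n" by (simp add: algebra_simps)
          also have "\<dots> \<le> (\<beta> - \<alpha>) * b * s n"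
            using we(4) k s[of n] by (intro mult_right_mono) (auto simp: divide_le_eq mult.commute)
          finally have "(\<beta> - \<alpha>) * snd z \<le> (\<beta> - \<alpha>) * (b * s n)" by (simp add: mult.assoc)
          then have 2: "snd z \<le> b * s n" using k by simp
          show "z \<in> {0..a * s n} \<times> {0..b * s n}" using pos 1 2 by (cases z) auto
        qed
        then have "slope_chain \<alpha> \<beta> (\<Xi> \<omega> \<inter> ({0..a * s n} \<times> {0..b * s n})) ps"
          using ps(1) by (auto simp: slope_chain_def)
        then have "length ps \<le> longest_chain \<alpha> \<beta> (\<Xi> \<omega>) (a * s n) (b * s n)"
          by (rule length_le_longest_chain[OF fin])
        with ps(2) have "(F - \<delta> m) * s n \<le> ?L (s n)" by linarith
        then show "F - 1 / real (Suc m) \<le> ?L (s n) / s n"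
          using s[of n] by (simp add: \<delta>_def le_divide_eq)
      qed
    qed (rule C)
    then show ?case
      unfolding s_def
    proof (intro tendsto_from_squares[of ?L])
      fix t t' :: real assume "0 \<le> t" "t \<le> t'"
      then show "?L t \<le> ?L t'"
        using ab by (intro of_nat_mono longest_chain_mono fin mult_left_mono) auto
    qed auto
  qed
qed

end

theorem theorem2:
  fixes M :: "'w measure" and \<Xi> :: "'w \<Rightarrow> (real \<times> real) set"
    and a b \<alpha> \<beta> :: real
  assumes "homogeneous_poisson_process M quarter_plane 1 \<Xi>"
    and "0 < a" and "0 < b" and "0 \<le> \<alpha>" and "\<alpha> < \<beta>"
  shows "AE \<omega> in M.
    ((\<lambda>t. real (longest_chain \<alpha> \<beta> (\<Xi> \<omega>) (a * t) (b * t)) / t) \<longlongrightarrow>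
      (if b / a > (\<alpha> + \<beta>) / 2 then
         a * sqrt (\<beta> - \<alpha>)
       else if b / a \<ge> harmonic_threshold \<alpha> \<beta> then
         2 * sqrt ((\<beta> * a - b) * (b - a * \<alpha>)) / sqrt (\<beta> - \<alpha>)
       else
         b * sqrt (1 / \<alpha> - 1 / \<beta>))) at_top"
proof -
  interpret homogeneous_poisson_process M quarter_plane 1 \<Xi> by (rule assms(1))
  interpret sloped_poisson_process M \<Xi> \<alpha> \<beta> by unfold_locales (use assms in auto)
  note a = \<open>0 < a\<close> and b = \<open>0 < b\<close> and \<alpha> = \<open>0 \<le> \<alpha>\<close> and \<alpha>\<beta> = \<open>\<alpha> < \<beta>\<close>
  define \<kappa> where "\<kappa> = sqrt (\<beta> - \<alpha>)"
  have \<kappa>: "0 < \<kappa>" "\<kappa> * \<kappa> = \<beta> - \<alpha>" using \<alpha>\<beta> by (auto simp: \<kappa>_def)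
  have \<beta>: "0 < \<beta>" using \<alpha> \<alpha>\<beta> by simp
  consider (steep) "(\<alpha> + \<beta>) / 2 < b / a" | (flat) "b / a \<le> (\<alpha> + \<beta>) / 2" "b / a < harmonic_threshold \<alpha> \<beta>"
    | (middle) "b / a \<le> (\<alpha> + \<beta>) / 2" "harmonic_threshold \<alpha> \<beta> \<le> b / a"
    by linarith
  then show ?thesis
  proof cases
    case steep
    have "AE \<omega> in M. ((\<lambda>t. real (longest_chain \<alpha> \<beta> (\<Xi> \<omega>) (a * t) (b * t)) / t) \<longlongrightarrow> a * \<kappa>) at_top"
    \<comment> \<open>With \<open>lam = 1\<close> the linear form depends on \<open>u\<close> only,
      so the width is the constraint. The best chain follows the central slope
      \<open>(\<alpha> + \<beta>) / 2\<close>, that is \<open>w = e\<close>, and reaches width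
      \<open>a\<close> below height \<open>b\<close>.\<close>
    proof (rule AE_longest_chain_limit[where lam = 1 and w = "(\<beta> - \<alpha>) * a / 2" and e = "(\<beta> - \<alpha>) * a / 2"])
      fix u v :: real assume uv: "0 \<le> u" "u \<le> a" "0 \<le> v" "v \<le> b"
      have "1 * (v - \<alpha> * u) + (\<beta> * u - v) / 1 = u * (\<kappa> * \<kappa>)"
        unfolding \<kappa>(2) by (simp add: algebra_simps)
      then have "(1 * (v - \<alpha> * u) + (\<beta> * u - v) / 1) / \<kappa> = u * \<kappa>"
        using \<kappa>(1) by simp
      also have "\<dots> \<le> a * \<kappa>" using uv \<kappa> by (intro mult_right_mono) auto
      finally show "(1 * (v - \<alpha> * u) + (\<beta> * u - v) / 1) / sqrt (\<beta> - \<alpha>) \<le> a * \<kappa>" by (simp add: \<kappa>_def)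
    next
      have "(\<beta> - \<alpha>) * a / 2 * ((\<beta> - \<alpha>) * a / 2) / (\<beta> - \<alpha>) = (\<beta> - \<alpha>) * (a / 2)\<^sup>2"
      proof -
        have "k * a / 2 * (k * a / 2) / k = k * (a / 2)\<^sup>2" if "0 < k" for k
          using that by (simp add: power2_eq_square)
        from this[of "\<beta> - \<alpha>"] \<alpha>\<beta> show ?thesis by simp
      qed
      then show "2 * sqrt ((\<beta> - \<alpha>) * a / 2 * ((\<beta> - \<alpha>) * a / 2) / (\<beta> - \<alpha>)) = a * \<kappa>"
        using a by (simp add: real_sqrt_mult \<kappa>_def)
      have "(\<beta> * ((\<beta> - \<alpha>) * a / 2) + \<alpha> * ((\<beta> - \<alpha>) * a / 2)) / (\<beta> - \<alpha>) = (\<alpha> + \<beta>) / 2 * a"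
        using \<alpha>\<beta> by (simp add: field_simps)
      also have "\<dots> \<le> b" using steep a by (simp add: less_divide_eq)
      finally show "(\<beta> * ((\<beta> - \<alpha>) * a / 2) + \<alpha> * ((\<beta> - \<alpha>) * a / 2)) / (\<beta> - \<alpha>) \<le> b" .
    qed (use a b \<alpha>\<beta> in auto)
    with steep show ?thesis by (simp add: \<kappa>_def)
  next
    case flat
    \<comment> \<open>Excludes \<open>\<alpha> = 0\<close>: there the threshold is 0 and the
      positive ratio \<open>b / a\<close> cannot lie below it.\<close>
    have "0 < b / a" using a b by simp
    with flat(2) have \<alpha>0: "0 < \<alpha>" using \<alpha> by (cases "\<alpha> = 0") (auto simp: harmonic_threshold_def)
    \<comment> \<open>This value cancels the coefficient of \<open>u\<close>, so the height is the
      constraint. The witness used below has \<open>\<beta> * w = \<alpha> * e\<close> and height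
      \<open>b\<close>; its slope is the harmonic threshold.\<close>
    define lam where "lam = sqrt (\<beta> / \<alpha>)"
    have lam: "0 < lam" "lam * lam = \<beta> / \<alpha>" using \<alpha>0 \<beta> by (auto simp: lam_def)
    define F where "F = b * sqrt (1 / \<alpha> - 1 / \<beta>)"
    have lam_F: "b * ((lam - 1 / lam) / \<kappa>) = F"
    proof -
      have "(lam - 1 / lam) / \<kappa> = (lam * lam - 1) / (lam * \<kappa>)" using lam \<kappa> by (simp add: field_simps)
      also have "\<dots> = (\<kappa> * \<kappa>) / \<alpha> / (lam * \<kappa>)" unfolding lam(2) \<kappa>(2) using \<alpha>0 by (simp add: field_simps)
      also have "\<dots> = \<kappa> / (\<alpha> * lam)" using \<kappa>(1) by simp
      also have "\<alpha> * lam = sqrt (\<alpha> * \<beta>)"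
        using \<alpha>0 \<beta> by (simp add: lam_def real_sqrt_divide real_sqrt_mult field_simps)
      also have "\<kappa> / sqrt (\<alpha> * \<beta>) = sqrt ((\<beta> - \<alpha>) / (\<alpha> * \<beta>))" by (simp add: \<kappa>_def real_sqrt_divide)
      also have "(\<beta> - \<alpha>) / (\<alpha> * \<beta>) = 1 / \<alpha> - 1 / \<beta>" using \<alpha>0 \<beta> by (simp add: field_simps)
      finally show ?thesis by (simp add: F_def)
    qed
    have "AE \<omega> in M. ((\<lambda>t. real (longest_chain \<alpha> \<beta> (\<Xi> \<omega>) (a * t) (b * t)) / t) \<longlongrightarrow> F) at_top"
    proof (rule AE_longest_chain_limit[where lam = lam and w = "b * (\<beta> - \<alpha>) / (2 * \<beta>)" and e = "b * (\<beta> - \<alpha>) / (2 * \<alpha>)"])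
      fix u v :: real assume uv: "0 \<le> u" "u \<le> a" "0 \<le> v" "v \<le> b"
      have "\<beta> * u = \<alpha> * (lam * lam) * u" using \<alpha>0 by (simp add: lam(2))
      then have "lam * (v - \<alpha> * u) + (\<beta> * u - v) / lam = v * (lam - 1 / lam)"
        using lam(1) by (simp add: field_simps)
      then have "(lam * (v - \<alpha> * u) + (\<beta> * u - v) / lam) / \<kappa> = v * ((lam - 1 / lam) / \<kappa>)" by simp
      also have "\<dots> \<le> b * ((lam - 1 / lam) / \<kappa>)"
      proof -
        have "1 \<le> lam" using \<alpha>0 \<alpha>\<beta> by (simp add: lam_def)
        then have "1 / lam \<le> lam" using lam(1) by (smt (verit) divide_le_eq_1)
        then show ?thesis using uv \<kappa> by (intro mult_right_mono) auto
      qed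
      finally show "(lam * (v - \<alpha> * u) + (\<beta> * u - v) / lam) / sqrt (\<beta> - \<alpha>) \<le> F"
        using lam_F by (simp add: \<kappa>_def)
    next
      have "b * (\<beta> - \<alpha>) / (2 * \<beta>) * (b * (\<beta> - \<alpha>) / (2 * \<alpha>)) / (\<beta> - \<alpha>) = (b / 2)\<^sup>2 * (1 / \<alpha> - 1 / \<beta>)"
        using \<alpha>0 \<beta> \<alpha>\<beta> by (simp add: power2_eq_square divide_simps)
      then show "2 * sqrt (b * (\<beta> - \<alpha>) / (2 * \<beta>) * (b * (\<beta> - \<alpha>) / (2 * \<alpha>)) / (\<beta> - \<alpha>)) = F"
        using b by (simp add: real_sqrt_mult F_def)
      have "(b * (\<beta> - \<alpha>) / (2 * \<beta>) + b * (\<beta> - \<alpha>) / (2 * \<alpha>)) / (\<beta> - \<alpha>) = b * (1 / \<beta> + 1 / \<alpha>) / 2"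
        using \<alpha>0 \<beta> \<alpha>\<beta> by (simp add: divide_simps) (simp add: algebra_simps)
      also have "\<dots> \<le> a"
      proof -
        have pos: "0 < 1 / \<beta> + 1 / \<alpha>" using \<alpha>0 \<beta> by (intro add_pos_pos) auto
        have "b / a \<le> 2 / (1 / \<beta> + 1 / \<alpha>)" using flat(2) \<alpha>0 by (simp add: harmonic_threshold_def)
        then have "b * (1 / \<beta> + 1 / \<alpha>) \<le> 2 * a"
          using pos a by (simp only: divide_le_eq le_divide_eq times_divide_eq_left if_True)
        then show ?thesis by simp
      qed
      finally show "(b * (\<beta> - \<alpha>) / (2 * \<beta>) + b * (\<beta> - \<alpha>) / (2 * \<alpha>)) / (\<beta> - \<alpha>) \<le> a" .
      show "(\<beta> * (b * (\<beta> - \<alpha>) / (2 * \<beta>)) + \<alpha> * (b * (\<beta> - \<alpha>) / (2 * \<alpha>))) / (\<beta> - \<alpha>) \<le> b"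
        using \<alpha>0 \<beta> \<alpha>\<beta> by simp
    qed (use a b \<alpha>0 \<beta> \<alpha>\<beta> lam in auto)
    with flat show ?thesis by (simp add: F_def)
  next
    case middle
    \<comment> \<open>The displacement to the corner \<open>(a, b)\<close> itself: both width and
      height are exhausted.\<close>
    define w e where "w = b - a * \<alpha>" and "e = \<beta> * a - b"
    have "b \<le> (\<alpha> + \<beta>) / 2 * a" using middle(1) a by (simp add: divide_le_eq)
    then have e_ge: "w \<le> e" by (simp add: w_def e_def algebra_simps)
    have thr: "2 * \<alpha> * \<beta> * a \<le> (\<alpha> + \<beta>) * b"
    proof (cases "\<alpha> = 0")
      case True
      then show ?thesis using b \<beta> by simp
    next
      case False
      then have \<alpha>0: "0 < \<alpha>" using \<alpha> by simp
      have "2 / (1 / \<beta> + 1 / \<alpha>) = 2 * \<alpha> * \<beta> / (\<alpha> + \<beta>)" using \<alpha>0 \<beta> by (simp add: field_simps)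
      then have "2 * \<alpha> * \<beta> / (\<alpha> + \<beta>) \<le> b / a" using middle(2) False by (simp add: harmonic_threshold_def)
      then show ?thesis using a \<alpha>0 \<beta> by (simp add: field_simps)
    qed
    then have \<alpha>e: "\<alpha> * e \<le> \<beta> * w" by (simp add: w_def e_def algebra_simps)
    have sum: "w + e = (\<beta> - \<alpha>) * a" by (simp add: w_def e_def algebra_simps)
    then have "0 < w + e" using a \<alpha>\<beta> by simp
    then have e0: "0 < e" using e_ge by linarith
    have w0: "0 < w"
    proof (cases "\<alpha> = 0")
      case True
      then show ?thesis using b by (simp add: w_def)
    next
      case False
      then have "0 < \<beta> * w" using \<alpha>e e0 \<alpha> by (smt (verit) mult_pos_pos)
      then show ?thesis using \<beta> by (simp add: zero_less_mult_iff)
    qed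
    \<comment> \<open>The tangent at \<open>(w, e)\<close>. The case conditions, in the form
      \<open>w \<le> e\<close> and \<open>\<alpha> * e \<le> \<beta> * w\<close>, say precisely that
      the coefficients of \<open>v\<close> and \<open>u\<close> in the linear form are nonnegative,
      so its maximum over the rectangle is attained at \<open>(a, b)\<close>.\<close>
    define lam where "lam = sqrt (e / w)"
    have lam: "0 < lam" "lam * lam = e / w" using w0 e0 by (auto simp: lam_def)
    define F where "F = 2 * sqrt (e * w) / \<kappa>"
    have lw: "lam * w = sqrt (e * w)" "e / lam = sqrt (e * w)"
      using w0 e0 by (simp_all add: lam_def real_sqrt_divide real_sqrt_mult field_simps)
    have "AE \<omega> in M. ((\<lambda>t. real (longest_chain \<alpha> \<beta> (\<Xi> \<omega>) (a * t) (b * t)) / t) \<longlongrightarrow> F) at_top"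
    proof (rule AE_longest_chain_limit[where lam = lam and w = w and e = e])
      fix u v :: real assume uv: "0 \<le> u" "u \<le> a" "0 \<le> v" "v \<le> b"
      have cv: "0 \<le> lam - 1 / lam"
      proof -
        have "1 \<le> lam" using w0 e_ge by (simp add: lam_def)
        then show ?thesis using lam(1) by (smt (verit) divide_le_eq_1)
      qed
      have "\<alpha> * (lam * lam) \<le> \<beta>"
        using \<alpha>e w0 by (simp add: lam(2) divide_le_eq)
      then have cu: "0 \<le> \<beta> / lam - \<alpha> * lam"
        using lam(1) by (simp add: le_divide_eq mult.assoc)
      have "lam * (v - \<alpha> * u) + (\<beta> * u - v) / lam = v * (lam - 1 / lam) + u * (\<beta> / lam - \<alpha> * lam)"
        using lam(1) by (simp add: field_simps)
      also have "\<dots> \<le> b * (lam - 1 / lam) + a * (\<beta> / lam - \<alpha> * lam)"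
        using uv cu cv by (intro add_mono mult_right_mono) auto
      also have "\<dots> = lam * w + e / lam"
        using lam(1) by (simp add: w_def e_def field_simps)
      finally have "(lam * (v - \<alpha> * u) + (\<beta> * u - v) / lam) / \<kappa> \<le> 2 * sqrt (e * w) / \<kappa>"
        using \<kappa> unfolding lw by (intro divide_right_mono) auto
      then show "(lam * (v - \<alpha> * u) + (\<beta> * u - v) / lam) / sqrt (\<beta> - \<alpha>) \<le> F" by (simp add: F_def \<kappa>_def)
    next
      show "2 * sqrt (w * e / (\<beta> - \<alpha>)) = F" by (simp add: F_def \<kappa>_def real_sqrt_divide mult.commute)
      show "(w + e) / (\<beta> - \<alpha>) \<le> a" unfolding sum using \<alpha>\<beta> by simp
      have "\<beta> * w + \<alpha> * e = (\<beta> - \<alpha>) * b" by (simp add: w_def e_def algebra_simps)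
      then show "(\<beta> * w + \<alpha> * e) / (\<beta> - \<alpha>) \<le> b" using \<alpha>\<beta> by simp
    qed (use a b lam w0 e0 in auto)
    with middle show ?thesis by (simp add: F_def \<kappa>_def w_def e_def)
  qed
qed

end
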